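(* Let $d\ge 6$, and let $p>(d-1)^2$ be a prime. Let $K_d$ be the complete graph on $d$ vertices, and let $G$ be the basic Kac-Moody-Steinberg group $G(K_d,\mathbb F_p)$. Then $G$ is a Golod-Shafarevich group with respect to $p$ and has property $(T)$.
   Context: Basic Kac-Moody-Steinberg (KMS) group: let $R$ be an associative ring with $1$ and $X$ a finite graph without loops or multiple edges with vertices $\{1,\ldots,d\}$ and edge set $E(X)$. For each $i$ let $G_i=\{x_i(r): r\in R\}$ with $x_i(r)x_i(s)=x_i(r+s)$, so $G_i\cong(R,+)$. Then $G(X,R)$ is the group generated by $G_1,\ldots,G_d$ subject to: (1) if $(i,j)\notin E(X)$, then $G_i$ and $G_j$ commute; (2) if $(i,j)\in E(X)$, then $[x_i(r),x_j(s)]=[x_i(1),x_j(rs)]$ for all $r,s\in R$, and $[G_i,G_j]$ commutes with both $G_i$ and $G_j$. Golod-Shafarevich group: let $p$ be a prime and let $\langle X\mid \mathcal R\rangle$ be a group presentation with $|X|<\infty$. The degree of an element $f$ of the free group on $X$ with respect to the Zassenhaus $p$-filtration is the smallest degree of a monomial occurring in $f-1$ under the Magnus embedding $x\mapsto 1+x$ of the free group into the algebra $\mathbb F_p\langle\langle X\rangle\rangle$ of noncommutative power series. Let $r_i$ be the number of relations in $\mathcal R$ of degree $i$. The presentation satisfies the Golod-Shafarevich condition with respect to $p$ if there is a real number $0<t<1$ with $1-|X|t+\sum_{i\ge1}r_it^i<0$. A group is a Golod-Shafarevich group with respect to $p$ if it has a presentation satisfying this condition. Property $(T)$: a discrete group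 $G$ has property $(T)$ if there are a finite $S\subseteq G$ and $\varepsilon>0$ such that in every unitary representation of $G$ on a complex Hilbert space without nonzero invariant vectors, every nonzero vector $v$ satisfies $\|sv-v\|>\varepsilon\|v\|$ for some $s\in S$. *)

theory Defs
  imports
    "HOL-Analysis.Analysis"
    "HOL-Algebra.Group_Action"
    "HOL-Algebra.Module"
    "HOL-Number_Theory.Residues"
    "HOL-Library.Extended_Nat"
begin

section \<open>Free groups and presentations\<close>

text \<open>
  The letter \<open>(x, True)\<close> stands for the generator \<open>x\<close> and \<open>(x, False)\<close> for its inverse.
  Elements of the free group are the reduced words; they are multiplied by pushing the letters of
  the left factor one after the other onto the right factor.
\<close>

type_synonym 'x fword = "('x \<times> bool) list"

fun letter_inv :: "'x \<times> bool \<Rightarrow> 'x \<times> bool" where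
  "letter_inv (x, b) = (x, \<not> b)"

fun freely_reduced :: "'x fword \<Rightarrow> bool" where
  "freely_reduced [] = True"
| "freely_reduced [a] = True"
| "freely_reduced (a # b # w) = (b \<noteq> letter_inv a \<and> freely_reduced (b # w))"

fun push :: "'x \<times> bool \<Rightarrow> 'x fword \<Rightarrow> 'x fword" where
  "push a [] = [a]"
| "push a (b # w) = (if b = letter_inv a then w else a # b # w)"

definition free_group :: "'x set \<Rightarrow> 'x fword monoid" where
  "free_group X = \<lparr>carrier = {w. freely_reduced w \<and> fst ` set w \<subseteq> X}, mult = foldr push, one = []\<rparr>"

definition normal_closure :: "('a, 'b) monoid_scheme \<Rightarrow> 'a set \<Rightarrow> 'a set" where
  "normal_closure G A = \<Inter> {N. N \<lhd> G \<and> A \<subseteq> N}"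

definition presented_group :: "'x set \<Rightarrow> 'x fword set \<Rightarrow> 'x fword set monoid" where
  "presented_group X Rel = free_group X Mod normal_closure (free_group X) Rel"

definition commutator :: "('a, 'b) monoid_scheme \<Rightarrow> 'a \<Rightarrow> 'a \<Rightarrow> 'a" where
  "commutator G a b = a \<otimes>\<^bsub>G\<^esub> b \<otimes>\<^bsub>G\<^esub> inv\<^bsub>G\<^esub> a \<otimes>\<^bsub>G\<^esub> inv\<^bsub>G\<^esub> b"

lemma letter_inv_inv [simp]: "letter_inv (letter_inv a) = a"
  by (cases a) auto

lemma freely_reduced_ConsD: "freely_reduced (a # w) \<Longrightarrow> freely_reduced w"
  by (cases w) auto

lemma freely_reduced_push: "freely_reduced w \<Longrightarrow> freely_reduced (push a w)"
  by (cases w) (auto dest: freely_reduced_ConsD)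

lemma push_push_inv: "freely_reduced w \<Longrightarrow> push a (push (letter_inv a) w) = w"
  by (cases w rule: freely_reduced.cases) auto

lemma freely_reduced_foldr_push: "freely_reduced v \<Longrightarrow> freely_reduced (foldr push u v)"
  by (induction u) (auto intro: freely_reduced_push)

lemma foldr_push_push:
  "freely_reduced w \<Longrightarrow> foldr push (push a v) w = push a (foldr push v w)"
  using push_push_inv[of _ a] by (cases v) (auto simp: freely_reduced_foldr_push)

lemma foldr_push_assoc:
  "freely_reduced w \<Longrightarrow> foldr push (foldr push u v) w = foldr push u (foldr push v w)"
  by (induction u) (auto simp: foldr_push_push)

lemma foldr_push_Nil: "freely_reduced w \<Longrightarrow> foldr push w [] = w"
proof (induction w rule: freely_reduced.induct)
  case (3 a b w)
  then show ?case by (metis foldr.simps(2) comp_apply push.simps(2) freely_reduced.simps(3))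
qed auto

lemma fst_letter_inv [simp]: "fst (letter_inv a) = fst a"
  by (cases a) auto

lemma letters_push: "fst ` set (push a w) \<subseteq> insert (fst a) (fst ` set w)"
  by (cases w) auto

lemma letters_foldr_push: "fst ` set (foldr push u v) \<subseteq> fst ` set u \<union> fst ` set v"
proof (induction u)
  case (Cons a u)
  have "fst ` set (push a (foldr push u v)) \<subseteq> insert (fst a) (fst ` set (foldr push u v))"
    by (rule letters_push)
  also have "\<dots> \<subseteq> insert (fst a) (fst ` set u \<union> fst ` set v)"
    using Cons.IH by (rule insert_mono)
  finally show ?case by simp
qed auto

lemma foldr_push_inverse:
  "freely_reduced v \<Longrightarrow> foldr push (map letter_inv (rev u)) (foldr push u v) = v"
proof (induction u)
  case (Cons a u)
  then show ?case
    using push_push_inv[of "foldr push u v" "letter_inv a"] by (auto simp: freely_reduced_foldr_push)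
qed auto

theorem group_free_group: "group (free_group X)"
proof (rule groupI)
  fix u v assume "u \<in> carrier (free_group X)" "v \<in> carrier (free_group X)"
  then show "u \<otimes>\<^bsub>free_group X\<^esub> v \<in> carrier (free_group X)"
    using subset_trans[OF letters_foldr_push[of u v], of X]
    by (simp add: free_group_def freely_reduced_foldr_push)
next
  fix u assume u: "u \<in> carrier (free_group X)"
  let ?v = "foldr push (map letter_inv (rev u)) []"
  have "fst ` set ?v \<subseteq> X"
    using letters_foldr_push[of "map letter_inv (rev u)" "[]"] u
    by (force simp: free_group_def)
  moreover have "foldr push ?v u = []"
    using u foldr_push_assoc[of u "map letter_inv (rev u)" "[]"]
      foldr_push_inverse[of "[]" u] by (auto simp: free_group_def foldr_push_Nil)
  ultimately show "\<exists>v\<in>carrier (free_group X). v \<otimes>\<^bsub>free_group X\<^esub> u = \<one>\<^bsub>free_group X\<^esub>"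
    by (intro bexI[of _ ?v]) (auto simp: free_group_def freely_reduced_foldr_push)
qed (auto simp: free_group_def foldr_push_assoc)


section \<open>Basic Kac-Moody-Steinberg groups\<close>

text \<open>
  The vertices of the graph are \<open>1, \<dots>, d\<close>, and \<open>E\<close> is its set of edges, an edge being a
  two-element set of vertices.  The generator \<open>(i, r)\<close> is \<open>x\<^sub>i(r)\<close>.
  An equation \<open>u = v\<close> is rendered by the relator \<open>u v\<^sup>-\<^sup>1\<close>.
  For \<open>i = j\<close> the second family says that \<open>G\<^sub>i\<close> is abelian, which the first family already implies.
  As an edge has no orientation, the third and fourth families are imposed for both orders of
  its endpoints.  That \<open>[G\<^sub>i, G\<^sub>j]\<close> commutes with \<open>G\<^sub>i\<close> and \<open>G\<^sub>j\<close> is imposed on the generators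
  \<open>[x\<^sub>i(r), x\<^sub>j(s)]\<close> of that subgroup.
\<close>

definition kms_gen :: "nat \<Rightarrow> 'r \<Rightarrow> (nat \<times> 'r) fword" where
  "kms_gen i r = [((i, r), True)]"

definition kms_relators :: "nat \<Rightarrow> nat set set \<Rightarrow> ('r, 'm) ring_scheme \<Rightarrow> (nat \<times> 'r) fword set" where
  "kms_relators d E R =
    (let F = free_group ({1..d} \<times> carrier R); x = kms_gen; V = {1..d} in
      {x i r \<otimes>\<^bsub>F\<^esub> x i s \<otimes>\<^bsub>F\<^esub> inv\<^bsub>F\<^esub> (x i (r \<oplus>\<^bsub>R\<^esub> s)) | i r s.
         i \<in> V \<and> r \<in> carrier R \<and> s \<in> carrier R}
    \<union> {commutator F (x i r) (x j s) | i j r s.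
         i \<in> V \<and> j \<in> V \<and> {i, j} \<notin> E \<and> r \<in> carrier R \<and> s \<in> carrier R}
    \<union> {commutator F (x i r) (x j s) \<otimes>\<^bsub>F\<^esub>
         inv\<^bsub>F\<^esub> (commutator F (x i \<one>\<^bsub>R\<^esub>) (x j (r \<otimes>\<^bsub>R\<^esub> s))) | i j r s.
         i \<in> V \<and> j \<in> V \<and> {i, j} \<in> E \<and> r \<in> carrier R \<and> s \<in> carrier R}
    \<union> {commutator F (commutator F (x i r) (x j s)) (x k t) | i j k r s t.
         i \<in> V \<and> j \<in> V \<and> {i, j} \<in> E \<and> k \<in> {i, j} \<and>
         r \<in> carrier R \<and> s \<in> carrier R \<and> t \<in> carrier R})"

definition kms_group :: "nat \<Rightarrow> nat set set \<Rightarrow> ('r, 'm) ring_scheme \<Rightarrow> (nat \<times> 'r) fword set monoid" where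
  "kms_group d E R = presented_group ({1..d} \<times> carrier R) (kms_relators d E R)"

definition complete_graph_edges :: "nat \<Rightarrow> nat set set" where
  "complete_graph_edges d = {e. e \<subseteq> {1..d} \<and> card e = 2}"


section \<open>Golod-Shafarevich groups\<close>

text \<open>
  Noncommutative power series over \<open>K\<close> in the variables \<open>X\<close>: a series is the function that assigns
  to each monomial, i.e. to each word over \<open>X\<close>, its coefficient.
\<close>

definition nc_power_series :: "'x set \<Rightarrow> ('k, 'm) ring_scheme \<Rightarrow> ('x list \<Rightarrow> 'k) ring" where
  "nc_power_series X K =
    \<lparr>carrier = {f. (\<forall>w\<in>lists X. f w \<in> carrier K) \<and> (\<forall>w. w \<notin> lists X \<longrightarrow> f w = \<zero>\<^bsub>K\<^esub>)},
     mult = (\<lambda>f g w. \<Oplus>\<^bsub>K\<^esub>k\<in>{..length w}. f (take k w) \<otimes>\<^bsub>K\<^esub> g (drop k w)),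
     one = (\<lambda>w. if w = [] then \<one>\<^bsub>K\<^esub> else \<zero>\<^bsub>K\<^esub>),
     zero = (\<lambda>w. \<zero>\<^bsub>K\<^esub>),
     add = (\<lambda>f g w. f w \<oplus>\<^bsub>K\<^esub> g w)\<rparr>"

definition nc_var :: "('k, 'm) ring_scheme \<Rightarrow> 'x \<Rightarrow> 'x list \<Rightarrow> 'k" where
  "nc_var K x = (\<lambda>w. if w = [x] then \<one>\<^bsub>K\<^esub> else \<zero>\<^bsub>K\<^esub>)"

definition magnus_letter :: "'x set \<Rightarrow> ('k, 'm) ring_scheme \<Rightarrow> 'x \<times> bool \<Rightarrow> 'x list \<Rightarrow> 'k" where
  "magnus_letter X K a =
    (let A = nc_power_series X K; y = \<one>\<^bsub>A\<^esub> \<oplus>\<^bsub>A\<^esub> nc_var K (fst a)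
     in if snd a then y else inv\<^bsub>A\<^esub> y)"

definition magnus :: "'x set \<Rightarrow> ('k, 'm) ring_scheme \<Rightarrow> 'x fword \<Rightarrow> 'x list \<Rightarrow> 'k" where
  "magnus X K w =
    foldr (\<lambda>a f. magnus_letter X K a \<otimes>\<^bsub>nc_power_series X K\<^esub> f) w \<one>\<^bsub>nc_power_series X K\<^esub>"

text \<open>The degree is \<open>\<infinity>\<close> for the identity, since then no monomial occurs.\<close>

definition zassenhaus_degree :: "nat \<Rightarrow> 'x set \<Rightarrow> 'x fword \<Rightarrow> enat" where
  "zassenhaus_degree p X f =
    (let K = residue_ring (int p); A = nc_power_series X K; h = magnus X K f \<ominus>\<^bsub>A\<^esub> \<one>\<^bsub>A\<^esub>
     in INF w \<in> {w. h w \<noteq> \<zero>\<^bsub>K\<^esub>}. enat (length w))"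

definition relators_of_degree :: "nat \<Rightarrow> 'x set \<Rightarrow> 'x fword set \<Rightarrow> nat \<Rightarrow> 'x fword set" where
  "relators_of_degree p X Rel i = {f \<in> Rel. zassenhaus_degree p X f = enat i}"

text \<open>
  \<open>Rel\<close> may be infinite.  The inequality is meaningful only if every \<open>r\<^sub>i\<close> is finite and the
  series (with nonnegative terms) converges, so both are demanded: \<open>card\<close> of an infinite set and
  \<open>suminf\<close> of a divergent series carry no information.
\<close>

definition golod_shafarevich_presentation :: "nat \<Rightarrow> 'x set \<Rightarrow> 'x fword set \<Rightarrow> bool" where
  "golod_shafarevich_presentation p X Rel \<longleftrightarrow>
     finite X \<and> Rel \<subseteq> carrier (free_group X) \<and>
     (\<forall>i\<ge>1. finite (relators_of_degree p X Rel i)) \<and>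
     (\<exists>t::real. 0 < t \<and> t < 1 \<and>
        summable (\<lambda>i. real (card (relators_of_degree p X Rel (Suc i))) * t ^ Suc i) \<and>
        1 - real (card X) * t
          + (\<Sum>i. real (card (relators_of_degree p X Rel (Suc i))) * t ^ Suc i) < 0)"

text \<open>Generating sets are finite, so it is no restriction to take them to be sets of naturals.\<close>

definition golod_shafarevich_group :: "nat \<Rightarrow> ('g, 'b) monoid_scheme \<Rightarrow> bool" where
  "golod_shafarevich_group p G \<longleftrightarrow>
     (\<exists>(X :: nat set) Rel. golod_shafarevich_presentation p X Rel \<and> presented_group X Rel \<cong> G)"


section \<open>Complex Hilbert spaces and unitary representations\<close>

definition complex_ring :: "complex ring" where
  "complex_ring = \<lparr>carrier = UNIV, mult = (*), one = 1, zero = 0, add = (+)\<rparr>"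

text \<open>
  The fields \<open>mult\<close> and \<open>one\<close> that a module record inherits from the ring record are irrelevant.
  The inner product is linear in its first argument.
\<close>

record 'h hilbert = "(complex, 'h) module" +
  ip :: "'h \<Rightarrow> 'h \<Rightarrow> complex"

definition hnorm :: "('h, 'm) hilbert_scheme \<Rightarrow> 'h \<Rightarrow> real" where
  "hnorm V x = sqrt (Re (ip V x x))"

locale complex_hilbert_space = module complex_ring V for V :: "'h hilbert" (structure) +
  assumes ip_add_left:
      "\<lbrakk>x \<in> carrier V; y \<in> carrier V; z \<in> carrier V\<rbrakk> \<Longrightarrow> ip V (x \<oplus> y) z = ip V x z + ip V y z"
    and ip_smult_left:
      "\<lbrakk>x \<in> carrier V; y \<in> carrier V\<rbrakk> \<Longrightarrow> ip V (c \<odot>\<^bsub>V\<^esub> x) y = c * ip V x y"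
    and ip_cnj: "\<lbrakk>x \<in> carrier V; y \<in> carrier V\<rbrakk> \<Longrightarrow> ip V y x = cnj (ip V x y)"
    and ip_nonneg: "x \<in> carrier V \<Longrightarrow> 0 \<le> Re (ip V x x)"
    and ip_definite: "\<lbrakk>x \<in> carrier V; ip V x x = 0\<rbrakk> \<Longrightarrow> x = \<zero>"
    and complete:
      "\<lbrakk>\<And>n. X n \<in> carrier V;
        \<And>e. 0 < e \<Longrightarrow> \<exists>N. \<forall>m\<ge>N. \<forall>n\<ge>N. hnorm V (X m \<ominus> X n) < e\<rbrakk>
       \<Longrightarrow> \<exists>L\<in>carrier V. (\<lambda>n::nat. hnorm V (X n \<ominus> L)) \<longlonglongrightarrow> 0"

definition unitary_representation ::
    "('g, 'b) monoid_scheme \<Rightarrow> 'h hilbert \<Rightarrow> ('g \<Rightarrow> 'h \<Rightarrow> 'h) \<Rightarrow> bool" where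
  "unitary_representation G V \<rho> \<longleftrightarrow>
     group_action G (carrier V) \<rho> \<and>
     (\<forall>g\<in>carrier G. \<forall>x\<in>carrier V. \<forall>y\<in>carrier V.
        \<rho> g (x \<oplus>\<^bsub>V\<^esub> y) = \<rho> g x \<oplus>\<^bsub>V\<^esub> \<rho> g y \<and> ip V (\<rho> g x) (\<rho> g y) = ip V x y) \<and>
     (\<forall>g\<in>carrier G. \<forall>x\<in>carrier V. \<forall>c. \<rho> g (c \<odot>\<^bsub>V\<^esub> x) = c \<odot>\<^bsub>V\<^esub> \<rho> g x)"

definition has_nonzero_invariant ::
    "('g, 'b) monoid_scheme \<Rightarrow> 'h hilbert \<Rightarrow> ('g \<Rightarrow> 'h \<Rightarrow> 'h) \<Rightarrow> bool" where
  "has_nonzero_invariant G V \<rho> \<longleftrightarrow>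
     (\<exists>v\<in>carrier V. v \<noteq> \<zero>\<^bsub>V\<^esub> \<and> (\<forall>g\<in>carrier G. \<rho> g v = v))"


section \<open>Property (T)\<close>

definition kazhdan_pair :: "'h itself \<Rightarrow> ('g, 'b) monoid_scheme \<Rightarrow> 'g set \<Rightarrow> real \<Rightarrow> bool" where
  "kazhdan_pair TYPE('h) G S \<epsilon> \<longleftrightarrow>
     (\<forall>(V :: 'h hilbert) \<rho>.
        complex_hilbert_space V \<longrightarrow> unitary_representation G V \<rho> \<longrightarrow>
        \<not> has_nonzero_invariant G V \<rho> \<longrightarrow>
        (\<forall>v\<in>carrier V. v \<noteq> \<zero>\<^bsub>V\<^esub> \<longrightarrow> (\<exists>s\<in>S. hnorm V (\<rho> s v \<ominus>\<^bsub>V\<^esub> v) > \<epsilon> * hnorm V v)))"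

lemma complex_ring_simps [simp]:
  "carrier complex_ring = UNIV" "a \<otimes>\<^bsub>complex_ring\<^esub> b = a * b" "\<one>\<^bsub>complex_ring\<^esub> = 1"
  "\<zero>\<^bsub>complex_ring\<^esub> = 0" "a \<oplus>\<^bsub>complex_ring\<^esub> b = a + b"
  by (simp_all add: complex_ring_def)

lemma cring_complex_ring: "cring complex_ring"
proof (intro cringI abelian_groupI comm_monoidI)
  fix x show "\<exists>y\<in>carrier complex_ring. y \<oplus>\<^bsub>complex_ring\<^esub> x = \<zero>\<^bsub>complex_ring\<^esub>"
    by (intro bexI[of _ "- x"]) auto
qed (auto simp: algebra_simps)

context complex_hilbert_space
begin

lemma smult_mem: "x \<in> carrier V \<Longrightarrow> c \<odot>\<^bsub>V\<^esub> x \<in> carrier V"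
  by simp

lemma ip_zero_left: "y \<in> carrier V \<Longrightarrow> ip V \<zero> y = 0"
  using ip_add_left[of \<zero> \<zero> y] by simp

lemma ip_neg_left:
  assumes "x \<in> carrier V" "y \<in> carrier V"
  shows "ip V (\<ominus> x) y = - ip V x y"
proof -
  have "ip V (\<ominus> x \<oplus> x) y = ip V (\<ominus> x) y + ip V x y"
    using assms by (intro ip_add_left) auto
  moreover have "\<ominus> x \<oplus> x = \<zero>"
    using assms by (simp add: l_neg)
  ultimately show ?thesis
    using ip_zero_left[OF assms(2)] by (simp add: eq_neg_iff_add_eq_0)
qed

lemma ip_diff_left:
  "\<lbrakk>x \<in> carrier V; y \<in> carrier V; z \<in> carrier V\<rbrakk> \<Longrightarrow> ip V (x \<ominus> y) z = ip V x z - ip V y z"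
  by (simp add: a_minus_def ip_add_left ip_neg_left)

lemma ip_smult_right:
  "\<lbrakk>x \<in> carrier V; y \<in> carrier V\<rbrakk> \<Longrightarrow> ip V x (c \<odot>\<^bsub>V\<^esub> y) = cnj c * ip V x y"
  by (metis ip_cnj ip_smult_left smult_mem complex_cnj_mult)

lemma ip_diff_right:
  "\<lbrakk>x \<in> carrier V; y \<in> carrier V; z \<in> carrier V\<rbrakk> \<Longrightarrow> ip V z (x \<ominus> y) = ip V z x - ip V z y"
  by (metis ip_cnj ip_diff_left minus_closed complex_cnj_diff)

lemma ip_self: "x \<in> carrier V \<Longrightarrow> ip V x x = of_real ((hnorm V x)\<^sup>2)"
  using ip_cnj[of x x] ip_nonneg[of x] by (simp add: hnorm_def complex_eq_iff)

lemma hnorm_ge_0: "x \<in> carrier V \<Longrightarrow> 0 \<le> hnorm V x"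
  using ip_nonneg[of x] by (simp add: hnorm_def)

lemma cauchy_schwarz:
  assumes x: "x \<in> carrier V" and y: "y \<in> carrier V"
  shows "cmod (ip V x y) \<le> hnorm V x * hnorm V y"
proof (cases "y = \<zero>")
  case True
  then show ?thesis
    using x ip_zero_left[OF x] ip_cnj[of \<zero> x] ip_zero_left[of \<zero>] by (simp add: hnorm_def)
next
  case False
  define n where "n = hnorm V y"
  have n: "n \<noteq> 0"
    using False ip_definite[OF y] ip_self[OF y] by (auto simp: n_def)
  define c where "c = ip V x y / of_real (n\<^sup>2)"
  let ?z = "x \<ominus> c \<odot>\<^bsub>V\<^esub> y"
  have c: "cnj c * ip V x y = of_real ((cmod (ip V x y))\<^sup>2 / n\<^sup>2)"
    unfolding c_def using complex_norm_square[of "ip V x y"] by (simp add: field_simps)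
  have "ip V ?z ?z = ip V x x - cnj c * ip V x y - c * (ip V y x - cnj c * ip V y y)"
    using x y smult_mem[OF y, of c]
    by (simp add: ip_diff_left ip_diff_right ip_smult_left ip_smult_right algebra_simps)
  also have "ip V y x - cnj c * ip V y y = 0"
    using n by (simp add: c_def ip_self[OF y] ip_cnj[OF x y] flip: n_def)
  finally have "ip V ?z ?z = of_real ((hnorm V x)\<^sup>2 - (cmod (ip V x y))\<^sup>2 / n\<^sup>2)"
    by (simp add: c ip_self[OF x])
  then have "0 \<le> (hnorm V x)\<^sup>2 - (cmod (ip V x y))\<^sup>2 / n\<^sup>2"
    using ip_nonneg[of ?z] x smult_mem[OF y, of c] by simp
  then have "(cmod (ip V x y))\<^sup>2 \<le> (hnorm V x * n)\<^sup>2"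
    using n by (simp add: field_simps power_mult_distrib)
  then show ?thesis
    unfolding n_def using hnorm_ge_0[OF x] hnorm_ge_0[OF y]
    by (simp add: power2_le_iff_abs_le)
qed

definition closed_subspace :: "'h set \<Rightarrow> bool" where
  "closed_subspace N \<longleftrightarrow> N \<subseteq> carrier V \<and> \<zero> \<in> N \<and> (\<forall>x\<in>N. \<forall>y\<in>N. x \<oplus> y \<in> N) \<and>
     (\<forall>c. \<forall>x\<in>N. c \<odot>\<^bsub>V\<^esub> x \<in> N) \<and>
     (\<forall>X L. range X \<subseteq> N \<longrightarrow> L \<in> carrier V \<longrightarrow> (\<lambda>n::nat. hnorm V (X n \<ominus> L)) \<longlonglongrightarrow> 0 \<longrightarrow> L \<in> N)"

lemma closed_subspace_carrier: "closed_subspace (carrier V)"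
  by (auto simp: closed_subspace_def)

lemma closed_subspace_Inter:
  assumes "\<N> \<noteq> {}" "\<And>N. N \<in> \<N> \<Longrightarrow> closed_subspace N"
  shows "closed_subspace (\<Inter>\<N>)"
proof -
  have "L \<in> N" if "range X \<subseteq> \<Inter>\<N>" "L \<in> carrier V" "(\<lambda>n::nat. hnorm V (X n \<ominus> L)) \<longlonglongrightarrow> 0" "N \<in> \<N>"
    for X L N
    using assms(2)[OF that(4)] that unfolding closed_subspace_def by blast
  moreover have "\<Inter>\<N> \<subseteq> carrier V"
    using assms unfolding closed_subspace_def by blast
  ultimately show ?thesis
    using assms(2) unfolding closed_subspace_def by blast
qed

lemma closed_subspace_perp:
  assumes w: "w \<in> carrier V"
  shows "closed_subspace {x \<in> carrier V. ip V x w = 0}"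
proof -
  have "ip V L w = 0"
    if X: "range X \<subseteq> {x \<in> carrier V. ip V x w = 0}" and L: "L \<in> carrier V"
      and lim: "(\<lambda>n::nat. hnorm V (X n \<ominus> L)) \<longlonglongrightarrow> 0" for X L
  proof -
    have "cmod (ip V L w) \<le> hnorm V (X n \<ominus> L) * hnorm V w" for n
    proof -
      have Xn: "X n \<in> carrier V" "ip V (X n) w = 0" using X by auto
      then have "ip V (X n \<ominus> L) w = - ip V L w"
        using L w by (simp add: ip_diff_left)
      then show ?thesis
        using cauchy_schwarz[of "X n \<ominus> L" w] Xn L w by simp
    qed
    moreover have "(\<lambda>n. hnorm V (X n \<ominus> L) * hnorm V w) \<longlonglongrightarrow> 0"
      using tendsto_mult_right[OF lim] by simp
    ultimately have "cmod (ip V L w) \<le> 0"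
      using LIMSEQ_le_const by blast
    then show ?thesis by simp
  qed
  then show ?thesis
    using w by (auto simp: closed_subspace_def ip_zero_left ip_add_left ip_smult_left)
qed

lemma minus_eq_zeroD:
  assumes "x \<in> carrier V" "y \<in> carrier V" "x \<ominus> y = \<zero>"
  shows "x = y"
proof -
  have "(x \<ominus> y) \<oplus> y = x"
    using assms(1,2) by (simp add: a_minus_def a_assoc l_neg)
  then show ?thesis using assms by simp
qed

lemma smult_minus_one: "x \<in> carrier V \<Longrightarrow> (- 1) \<odot>\<^bsub>V\<^esub> x = \<ominus> x"
proof -
  assume x: "x \<in> carrier V"
  have "ip V ((- 1) \<odot>\<^bsub>V\<^esub> x \<ominus> \<ominus> x) ((- 1) \<odot>\<^bsub>V\<^esub> x \<ominus> \<ominus> x) = 0"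
    using x smult_mem[OF x, of "- 1"] minus_closed[of "(- 1) \<odot>\<^bsub>V\<^esub> x" "\<ominus> x"]
    by (simp add: ip_diff_left ip_neg_left ip_smult_left)
  then have "(- 1) \<odot>\<^bsub>V\<^esub> x \<ominus> \<ominus> x = \<zero>"
    using x smult_mem[OF x, of "- 1"] by (intro ip_definite) auto
  then show ?thesis
    by (rule minus_eq_zeroD[rotated 2]) (use x smult_mem[OF x, of "- 1"] in auto)
qed

lemma closed_subspace_neg: "closed_subspace N \<Longrightarrow> x \<in> N \<Longrightarrow> \<ominus> x \<in> N"
  unfolding closed_subspace_def by (metis smult_minus_one subsetD)

lemma closed_subspace_minus: "closed_subspace N \<Longrightarrow> x \<in> N \<Longrightarrow> y \<in> N \<Longrightarrow> x \<ominus> y \<in> N"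
  using closed_subspace_neg unfolding closed_subspace_def a_minus_def by blast

lemma closed_subspace_vimage:
  assumes N: "closed_subspace N"
    and U: "\<And>x. x \<in> carrier V \<Longrightarrow> U x \<in> carrier V"
    and add: "\<And>x y. x \<in> carrier V \<Longrightarrow> y \<in> carrier V \<Longrightarrow> U (x \<oplus> y) = U x \<oplus> U y"
    and smult: "\<And>c x. x \<in> carrier V \<Longrightarrow> U (c \<odot>\<^bsub>V\<^esub> x) = c \<odot>\<^bsub>V\<^esub> U x"
    and ip: "\<And>x y. x \<in> carrier V \<Longrightarrow> y \<in> carrier V \<Longrightarrow> ip V (U x) (U y) = ip V x y"
  shows "closed_subspace {x \<in> carrier V. U x \<in> N}"
proof -
  have diff: "U (x \<ominus> y) = U x \<ominus> U y" if "x \<in> carrier V" "y \<in> carrier V" for x y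
    using that add[of x "\<ominus> y"] smult[of y "- 1"] U[of y]
    by (simp add: a_minus_def smult_minus_one)
  have norm: "hnorm V (U x) = hnorm V x" if "x \<in> carrier V" for x
    using that by (simp add: hnorm_def ip)
  have "U \<zero> = \<zero>"
    using add[of \<zero> \<zero>] U[of \<zero>] by simp
  moreover have "U L \<in> N"
    if X: "range X \<subseteq> {x \<in> carrier V. U x \<in> N}" and L: "L \<in> carrier V"
      and lim: "(\<lambda>n::nat. hnorm V (X n \<ominus> L)) \<longlonglongrightarrow> 0" for X L
  proof -
    have "X n \<in> carrier V" for n using X by auto
    then have "(\<lambda>n. hnorm V (U (X n) \<ominus> U L)) = (\<lambda>n. hnorm V (X n \<ominus> L))"
      using L by (auto simp: norm simp flip: diff)
    then have "(\<lambda>n. hnorm V (U (X n) \<ominus> U L)) \<longlonglongrightarrow> 0"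
      using lim by simp
    moreover have "range (\<lambda>n. U (X n)) \<subseteq> N" using X by auto
    ultimately show ?thesis
      using N U[OF L] unfolding closed_subspace_def by blast
  qed
  ultimately show ?thesis
    using N U add smult unfolding closed_subspace_def by auto
qed

end

theorem kazhdan_pair_transfer:
  fixes G :: "('g, 'b) monoid_scheme" (structure)
  assumes S: "S \<subseteq> carrier G" and pair: "kazhdan_pair TYPE('g \<Rightarrow> complex) G S \<epsilon>"
  shows "kazhdan_pair TYPE('h) G S \<epsilon>"
  unfolding kazhdan_pair_def
proof (intro allI impI ballI)
  fix V :: "'h hilbert" and \<rho> v
  assume V: "complex_hilbert_space V" and rep: "unitary_representation G V \<rho>"
    and noinv: "\<not> has_nonzero_invariant G V \<rho>" and v: "v \<in> carrier V" "v \<noteq> \<zero>\<^bsub>V\<^esub>"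
  interpret V: complex_hilbert_space V by (rule V)
  have act: "group_action G (carrier V) \<rho>"
    using rep by (simp add: unitary_representation_def)
  interpret act: group_action G "carrier V" \<rho> by (rule act)
  interpret G: group G
    using act by (simp add: group_action_def group_hom_def)
  have \<rho>_mem: "\<rho> g x \<in> carrier V" if "g \<in> carrier G" "x \<in> carrier V" for g x
    using act.element_image that by blast
  have \<rho>_mult: "\<rho> (g \<otimes> h) x = \<rho> g (\<rho> h x)"
    if "g \<in> carrier G" "h \<in> carrier G" "x \<in> carrier V" for g h x
    using act.composition_rule that by blast
  have \<rho>_one: "\<rho> \<one> x = x" if "x \<in> carrier V" for x
    using act.id_eq_one that by (metis restrict_apply')
  have \<rho>_add: "\<rho> g (x \<oplus>\<^bsub>V\<^esub> y) = \<rho> g x \<oplus>\<^bsub>V\<^esub> \<rho> g y"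
    and \<rho>_ip: "ip V (\<rho> g x) (\<rho> g y) = ip V x y"
    if "g \<in> carrier G" "x \<in> carrier V" "y \<in> carrier V" for g x y
    using rep that by (simp_all add: unitary_representation_def)
  have \<rho>_smult: "\<rho> g (c \<odot>\<^bsub>V\<^esub> x) = c \<odot>\<^bsub>V\<^esub> \<rho> g x" if "g \<in> carrier G" "x \<in> carrier V" for g x c
    using rep that by (simp add: unitary_representation_def)

  \<comment> \<open>The closed subspace generated by the orbit of \<open>v\<close> embeds into the functions on \<open>G\<close> by
     matrix coefficients.\<close>
  define M where "M = \<Inter> {N. V.closed_subspace N \<and> (\<forall>g\<in>carrier G. \<rho> g v \<in> N)}"
  have M: "V.closed_subspace M"
    unfolding M_def using V.closed_subspace_carrier \<rho>_mem v
    by (intro V.closed_subspace_Inter) auto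
  have M_least: "M \<subseteq> N" if "V.closed_subspace N" "\<And>g. g \<in> carrier G \<Longrightarrow> \<rho> g v \<in> N" for N
    unfolding M_def using that by blast
  have orbit_M: "\<rho> g v \<in> M" if "g \<in> carrier G" for g
    unfolding M_def using that by blast
  have M_carrier: "x \<in> carrier V" if "x \<in> M" for x
    using M that unfolding V.closed_subspace_def by blast
  have M_zero: "\<zero>\<^bsub>V\<^esub> \<in> M"
    using M unfolding V.closed_subspace_def by blast
  have M_add: "x \<oplus>\<^bsub>V\<^esub> y \<in> M" if "x \<in> M" "y \<in> M" for x y
    using M that unfolding V.closed_subspace_def by blast
  have M_smult: "c \<odot>\<^bsub>V\<^esub> x \<in> M" if "x \<in> M" for c x
    using M that unfolding V.closed_subspace_def by blast
  have M_neg: "\<ominus>\<^bsub>V\<^esub> x \<in> M" if "x \<in> M" for x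
    using V.closed_subspace_neg[OF M that] .
  have M_minus: "x \<ominus>\<^bsub>V\<^esub> y \<in> M" if "x \<in> M" "y \<in> M" for x y
    using V.closed_subspace_minus[OF M that] .
  have v_M: "v \<in> M"
    using orbit_M[of \<one>] \<rho>_one v by simp
  have \<rho>_M: "\<rho> g x \<in> M" if g: "g \<in> carrier G" and x: "x \<in> M" for g x
  proof -
    have "V.closed_subspace {x \<in> carrier V. \<rho> g x \<in> M}"
      by (rule V.closed_subspace_vimage[OF M]) (use g \<rho>_mem \<rho>_add \<rho>_smult \<rho>_ip in auto)
    moreover have "\<rho> h v \<in> {x \<in> carrier V. \<rho> g x \<in> M}" if "h \<in> carrier G" for h
      using \<rho>_mem[OF that] \<rho>_mult[OF g that] orbit_M[of "g \<otimes> h"] g that v by simp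
    ultimately show ?thesis using M_least x by blast
  qed

  define \<Phi> where "\<Phi> x = (\<lambda>g. if g \<in> carrier G then ip V x (\<rho> g v) else 0)" for x
  define \<Psi> where "\<Psi> = inv_into M \<Phi>"
  have \<Phi>_add: "\<Phi> (x \<oplus>\<^bsub>V\<^esub> y) = (\<lambda>g. \<Phi> x g + \<Phi> y g)" if "x \<in> M" "y \<in> M" for x y
    using that v \<rho>_mem by (auto simp: \<Phi>_def fun_eq_iff V.ip_add_left M_carrier)
  have \<Phi>_smult: "\<Phi> (c \<odot>\<^bsub>V\<^esub> x) = (\<lambda>g. c * \<Phi> x g)" if "x \<in> M" for c x
    using that v \<rho>_mem by (auto simp: \<Phi>_def fun_eq_iff V.ip_smult_left M_carrier)
  have \<Phi>_zero: "\<Phi> \<zero>\<^bsub>V\<^esub> = (\<lambda>_. 0)"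
    using v \<rho>_mem by (auto simp: \<Phi>_def fun_eq_iff V.ip_zero_left)
  have \<Phi>_kernel: "x = \<zero>\<^bsub>V\<^esub>" if x: "x \<in> M" and 0: "\<Phi> x = (\<lambda>_. 0)" for x
  proof -
    have "ip V x (\<rho> g v) = 0" if "g \<in> carrier G" for g
      using fun_cong[OF 0, of g] that by (simp add: \<Phi>_def)
    then have "\<rho> g v \<in> {y \<in> carrier V. ip V y x = 0}" if "g \<in> carrier G" for g
      using V.ip_cnj[of x "\<rho> g v"] that \<rho>_mem v M_carrier[OF x] by simp
    then have "M \<subseteq> {y \<in> carrier V. ip V y x = 0}"
      by (intro M_least V.closed_subspace_perp M_carrier x)
    then show ?thesis using x V.ip_definite by blast
  qed
  have inj: "inj_on \<Phi> M"
  proof (rule inj_onI)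
    fix x y assume xy: "x \<in> M" "y \<in> M" "\<Phi> x = \<Phi> y"
    have "\<Phi> (x \<ominus>\<^bsub>V\<^esub> y) = (\<lambda>_. 0)"
    proof
      fix g show "\<Phi> (x \<ominus>\<^bsub>V\<^esub> y) g = 0"
        using xy(1,2) fun_cong[OF xy(3), of g] v \<rho>_mem[of g v]
        by (simp add: \<Phi>_def V.ip_diff_left M_carrier split: if_splits)
    qed
    then have "x \<ominus>\<^bsub>V\<^esub> y = \<zero>\<^bsub>V\<^esub>"
      using xy by (intro \<Phi>_kernel M_minus)
    then show "x = y"
      using xy M_carrier V.minus_eq_zeroD by blast
  qed
  have \<Psi>\<Phi> [simp]: "\<Psi> (\<Phi> x) = x" if "x \<in> M" for x
    using inj that by (simp add: \<Psi>_def)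

  define W :: "('g \<Rightarrow> complex) hilbert" where
    "W = \<lparr>carrier = \<Phi> ` M, mult = (\<lambda>a b. a), one = (\<lambda>_. 0), zero = (\<lambda>_. 0),
         add = (\<lambda>a b g. a g + b g), smult = (\<lambda>c a g. c * a g), ip = (\<lambda>a b. ip V (\<Psi> a) (\<Psi> b))\<rparr>"
  have W_carrier: "carrier W = \<Phi> ` M" and W_zero: "\<zero>\<^bsub>W\<^esub> = \<Phi> \<zero>\<^bsub>V\<^esub>"
    by (simp_all add: W_def \<Phi>_zero)
  have W_add: "\<Phi> x \<oplus>\<^bsub>W\<^esub> \<Phi> y = \<Phi> (x \<oplus>\<^bsub>V\<^esub> y)" if "x \<in> M" "y \<in> M" for x y
    using that by (simp add: W_def \<Phi>_add)
  have W_smult: "c \<odot>\<^bsub>W\<^esub> \<Phi> x = \<Phi> (c \<odot>\<^bsub>V\<^esub> x)" if "x \<in> M" for c x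
    using that by (simp add: W_def \<Phi>_smult)
  have W_ip: "ip W (\<Phi> x) (\<Phi> y) = ip V x y" if "x \<in> M" "y \<in> M" for x y
    using that by (simp add: W_def)
  have W_norm: "hnorm W (\<Phi> x) = hnorm V x" if "x \<in> M" for x
    using that by (simp add: hnorm_def W_ip)
  note W_simps = W_carrier W_zero W_add W_smult W_ip
  have W_group: "abelian_group W"
  proof (rule abelian_groupI)
    fix a assume "a \<in> carrier W"
    then obtain x where "x \<in> M" "a = \<Phi> x" by (auto simp: W_carrier)
    then show "\<exists>b\<in>carrier W. b \<oplus>\<^bsub>W\<^esub> a = \<zero>\<^bsub>W\<^esub>"
      by (intro bexI[of _ "\<Phi> (\<ominus>\<^bsub>V\<^esub> x)"]) (auto simp: W_simps M_neg M_carrier V.l_neg)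
  qed (auto simp: W_simps M_add M_zero M_carrier V.a_ac)
  interpret W: abelian_group W by (rule W_group)
  have W_minus: "\<Phi> x \<ominus>\<^bsub>W\<^esub> \<Phi> y = \<Phi> (x \<ominus>\<^bsub>V\<^esub> y)" if "x \<in> M" "y \<in> M" for x y
  proof -
    have "\<ominus>\<^bsub>W\<^esub> \<Phi> y = \<Phi> (\<ominus>\<^bsub>V\<^esub> y)"
      by (rule W.minus_equality) (use that in \<open>auto simp: W_simps M_neg M_carrier V.l_neg\<close>)
    then show ?thesis
      using that by (simp add: a_minus_def W_add M_neg)
  qed
  have W_module: "module complex_ring W"
    by (rule moduleI[OF cring_complex_ring W_group])
      (auto simp: W_carrier W_smult W_add M_smult M_add M_carrier V.smult_r_distr
        V.smult_l_distr[simplified] V.smult_assoc1[simplified] V.smult_one[simplified])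
  have W_hilbert: "complex_hilbert_space W"
  proof (intro complex_hilbert_space.intro complex_hilbert_space_axioms.intro W_module)
    fix X :: "nat \<Rightarrow> 'g \<Rightarrow> complex"
    assume X: "\<And>n. X n \<in> carrier W"
      and Cauchy: "\<And>e. 0 < e \<Longrightarrow> \<exists>N. \<forall>m\<ge>N. \<forall>n\<ge>N. hnorm W (X m \<ominus>\<^bsub>W\<^esub> X n) < e"
    define Y where "Y n = \<Psi> (X n)" for n
    have Y: "Y n \<in> M" and XY: "X n = \<Phi> (Y n)" for n
      using X[of n] by (auto simp: W_carrier Y_def)
    have "\<exists>L\<in>carrier V. (\<lambda>n. hnorm V (Y n \<ominus>\<^bsub>V\<^esub> L)) \<longlonglongrightarrow> 0"
      using Cauchy Y by (intro V.complete) (auto simp: XY W_minus W_norm M_minus M_carrier)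
    then obtain L where L: "L \<in> carrier V" "(\<lambda>n. hnorm V (Y n \<ominus>\<^bsub>V\<^esub> L)) \<longlonglongrightarrow> 0" by blast
    moreover have "range Y \<subseteq> M" using Y by blast
    ultimately have "L \<in> M"
      using M unfolding V.closed_subspace_def by blast
    then show "\<exists>L\<in>carrier W. (\<lambda>n. hnorm W (X n \<ominus>\<^bsub>W\<^esub> L)) \<longlonglongrightarrow> 0"
      using L Y by (intro bexI[of _ "\<Phi> L"]) (auto simp: XY W_minus W_norm M_minus W_carrier)
  next
    fix a assume "a \<in> carrier W" "ip W a a = 0"
    then show "a = \<zero>\<^bsub>W\<^esub>"
      by (auto simp: W_simps dest: V.ip_definite[OF M_carrier])
  next
    fix a b assume "a \<in> carrier W" "b \<in> carrier W"
    then obtain x y where "x \<in> M" "a = \<Phi> x" "y \<in> M" "b = \<Phi> y"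
      by (auto simp: W_carrier)
    then show "ip W b a = cnj (ip W a b)"
      using V.ip_cnj[of x y] M_carrier by (simp add: W_ip)
  qed (auto simp: W_simps M_add M_smult M_carrier V.ip_add_left V.ip_smult_left V.ip_nonneg)

  define \<sigma> where "\<sigma> g = (\<lambda>a\<in>carrier W. \<Phi> (\<rho> g (\<Psi> a)))" for g
  have \<sigma>: "\<sigma> g (\<Phi> x) = \<Phi> (\<rho> g x)" if "x \<in> M" for g x
    using that by (simp add: \<sigma>_def W_carrier)
  have \<sigma>_mem: "\<sigma> g a \<in> carrier W" if "g \<in> carrier G" "a \<in> carrier W" for g a
    using that by (auto simp: W_carrier \<sigma> \<rho>_M)
  have \<sigma>_mult: "\<sigma> (g \<otimes> h) a = \<sigma> g (\<sigma> h a)"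
    if "g \<in> carrier G" "h \<in> carrier G" "a \<in> carrier W" for g h a
    using that by (auto simp: W_carrier \<sigma> \<rho>_M \<rho>_mult M_carrier)
  have \<sigma>_one: "\<sigma> \<one> a = a" if "a \<in> carrier W" for a
    using that by (auto simp: W_carrier \<sigma> \<rho>_one M_carrier)
  have \<sigma>_Bij: "\<sigma> g \<in> Bij (carrier W)" if g: "g \<in> carrier G" for g
  proof -
    have "bij_betw (\<sigma> g) (carrier W) (carrier W)"
      by (rule bij_betw_byWitness[where f' = "\<sigma> (inv g)"])
        (use g \<sigma>_mem in \<open>auto simp: \<sigma>_one simp flip: \<sigma>_mult\<close>)
    then show ?thesis by (simp add: Bij_def \<sigma>_def)
  qed
  have \<sigma>_hom: "\<sigma> \<in> hom G (BijGroup (carrier W))"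
  proof (rule homI)
    fix g h assume gh: "g \<in> carrier G" "h \<in> carrier G"
    have "\<sigma> (g \<otimes> h) = compose (carrier W) (\<sigma> g) (\<sigma> h)"
    proof
      fix a show "\<sigma> (g \<otimes> h) a = compose (carrier W) (\<sigma> g) (\<sigma> h) a"
        using \<sigma>_mult[OF gh, of a] by (cases "a \<in> carrier W") (auto simp: compose_def \<sigma>_def)
    qed
    then show "\<sigma> (g \<otimes> h) = \<sigma> g \<otimes>\<^bsub>BijGroup (carrier W)\<^esub> \<sigma> h"
      using gh by (simp add: BijGroup_def \<sigma>_Bij)
  qed (simp add: BijGroup_def \<sigma>_Bij)
  have W_rep: "unitary_representation G W \<sigma>"
    unfolding unitary_representation_def
  proof (intro conjI)
    show "group_action G (carrier W) \<sigma>"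
      using \<sigma>_hom group_BijGroup G.is_group
      by (simp add: group_action_def group_hom_def group_hom_axioms_def)
  qed (auto simp: W_simps \<sigma> \<rho>_M M_add M_smult \<rho>_add \<rho>_smult \<rho>_ip M_carrier)
  have "\<not> has_nonzero_invariant G W \<sigma>"
  proof
    assume "has_nonzero_invariant G W \<sigma>"
    then obtain x where x: "x \<in> M" "\<Phi> x \<noteq> \<zero>\<^bsub>W\<^esub>" "\<And>g. g \<in> carrier G \<Longrightarrow> \<sigma> g (\<Phi> x) = \<Phi> x"
      by (auto simp: has_nonzero_invariant_def W_carrier)
    have "\<rho> g x = x" if "g \<in> carrier G" for g
      using x(3)[OF that] x(1) \<rho>_M[OF that x(1)] inj by (simp add: \<sigma> inj_on_eq_iff)
    moreover have "x \<noteq> \<zero>\<^bsub>V\<^esub>"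
      using x(2) by (auto simp: W_zero)
    ultimately show False
      using noinv M_carrier[OF x(1)] unfolding has_nonzero_invariant_def by blast
  qed
  moreover have "\<Phi> v \<noteq> \<zero>\<^bsub>W\<^esub>"
    using v v_M M_zero inj by (simp add: W_zero inj_on_eq_iff)
  ultimately obtain s where s: "s \<in> S" "hnorm W (\<sigma> s (\<Phi> v) \<ominus>\<^bsub>W\<^esub> \<Phi> v) > \<epsilon> * hnorm W (\<Phi> v)"
    using pair[unfolded kazhdan_pair_def, rule_format, OF W_hilbert W_rep, of "\<Phi> v"] v_M
    by (auto simp: W_carrier)
  moreover have "hnorm W (\<sigma> s (\<Phi> v) \<ominus>\<^bsub>W\<^esub> \<Phi> v) = hnorm V (\<rho> s v \<ominus>\<^bsub>V\<^esub> v)"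
    using s(1) S v_M \<rho>_M[of s v] by (auto simp: \<sigma> W_minus W_norm M_minus)
  ultimately show "\<exists>s\<in>S. hnorm V (\<rho> s v \<ominus>\<^bsub>V\<^esub> v) > \<epsilon> * hnorm V v"
    using v_M by (auto simp: W_norm)
qed

text \<open>
  A definition in HOL cannot quantify over all types of vectors, so property (T) refers to all
  Hilbert spaces whose carrier is a set of functions from the type of group elements to the complex
  numbers.  This is no restriction: by \<open>kazhdan_pair_transfer\<close> above, a pair \<open>(S, \<epsilon>)\<close> that works
  for these Hilbert spaces works for the Hilbert spaces over any other type.
\<close>

definition property_T :: "('g, 'b) monoid_scheme \<Rightarrow> bool" where
  "property_T G \<longleftrightarrow>
     (\<exists>S \<epsilon>. finite S \<and> S \<subseteq> carrier G \<and> \<epsilon> > 0 \<and> kazhdan_pair TYPE('g \<Rightarrow> complex) G S \<epsilon>)"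

end

theory Submission
  imports Defs
begin

text \<open>
  Both halves rest on one description of the group \<open>G = G(K\<^sub>d, F\<^sub>p)\<close>.  Put \<open>a\<^sub>i = x\<^sub>i(1)\<close>.  Then
  \<open>x\<^sub>i(r) = a\<^sub>i\<^sup>r\<close>, and \<open>G\<close> is generated by \<open>a\<^sub>1, \<dots>, a\<^sub>d\<close> subject only to \<open>a\<^sub>i\<^sup>p = 1\<close> and to
  the condition that \<open>[a\<^sub>i, a\<^sub>j]\<close> commutes with \<open>a\<^sub>i\<close> and \<open>a\<^sub>j\<close>.  The relations
  \<open>[x\<^sub>i(r), x\<^sub>j(s)] = [x\<^sub>i(1), x\<^sub>j(rs)]\<close> follow from these, since \<open>[a\<^sup>r, b\<^sup>s] = [a, b]\<^sup>r\<^sup>s\<close> whenever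
  \<open>[a, b]\<close> commutes with \<open>a\<close> and \<open>b\<close> (\<open>commutator_pow_pow\<close>).  The locale
  \<open>class2_torsion_generated\<close> isolates these properties, and \<open>vertex_presentation_iso_kms\<close> says
  that they present \<open>G\<close>.

  \<^bold>\<open>Golod-Shafarevich.\<close>  The small presentation has \<open>d\<close> relators \<open>a\<^sub>i\<^sup>p\<close>, of degree at least \<open>p\<close>,
  and at most \<open>d(d - 1)\<close> relators \<open>[[a\<^sub>i, a\<^sub>j], a\<^sub>k]\<close> with \<open>i < j\<close> and \<open>k \<in> {i, j}\<close>, of degree at
  least \<open>3\<close>.  At \<open>t = 3/(2d)\<close> the polynomial \<open>1 - d t + d(d - 1) t\<^sup>3\<close> equals
  \<open>-1/2 + 27(d - 1)/(8d\<^sup>2)\<close>, which is at most \<open>-1/32\<close> for \<open>d \<ge> 6\<close>, and \<open>d t\<^sup>p\<close> is smaller than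
  \<open>1/32\<close>.

  \<^bold>\<open>Property (T).\<close>  In a unitary representation let \<open>P\<^sub>i\<close> be the average over the powers of \<open>a\<^sub>i\<close>,
  which is the orthogonal projection onto the vectors fixed by \<open>a\<^sub>i\<close>, and let \<open>Q\<^sub>i = 1 - P\<^sub>i\<close>.
  Two generators generate a quotient of the Heisenberg group modulo \<open>p\<close>.  On the vectors fixed by
  its centre \<open>P\<^sub>i\<close> and \<open>P\<^sub>j\<close> commute; on the orthogonal complement of these vectors
  \<open>\<parallel>P\<^sub>i P\<^sub>j\<parallel> \<le> 1/\<surd>p\<close>.  In both cases
  \<open>2 Re \<langle>Q\<^sub>i v, Q\<^sub>j v\<rangle> \<ge> - (\<parallel>Q\<^sub>i v\<parallel>\<^sup>2 + \<parallel>Q\<^sub>j v\<parallel>\<^sup>2) / \<surd>p\<close>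
  (\<open>heisenberg_pair_bound\<close>).  Summing over all pairs, the Laplacian \<open>D = \<Sum> Q\<^sub>i\<close> satisfies
  \<open>D\<^sup>2 \<ge> \<mu> D\<close> with \<open>\<mu> = 1 - (d - 1)/\<surd>p\<close> (\<open>sum_norm_lower_bound\<close>), and \<open>\<mu> > 0\<close> is exactly the
  hypothesis \<open>p > (d - 1)\<^sup>2\<close>.  So \<open>D\<close> has no spectrum strictly between \<open>0\<close> and \<open>\<mu>\<close>, and its kernel
  consists of the invariant vectors.  Instead of the spectral theorem, \<open>norm_le_of_laplacian_gap\<close>
  iterates the map \<open>v \<mapsto> v - D v / d\<close>: the energy \<open>\<langle>D v, v\<rangle> = \<Sum> \<parallel>Q\<^sub>i v\<parallel>\<^sup>2\<close> decays geometrically, so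
  the iterates converge to an invariant vector, and they travel at most a constant times the square
  root of the initial energy.  If \<open>0\<close> is the only invariant vector, then \<open>\<parallel>v\<parallel>\<close> is at most that
  distance.  A vector that is moved little by all powers of the \<open>a\<^sub>i\<close> has small energy, hence is zero.
\<close>

section \<open>Hilbert spaces and orthogonal projections\<close>

context complex_hilbert_space
begin

text \<open>
  Vector identities are reduced by this lemma to identities of complex numbers, where adjoints can
  be moved and sums evaluated by rewriting.
\<close>

lemma ip_eqI:
  assumes "x \<in> carrier V" "y \<in> carrier V" "\<And>z. z \<in> carrier V \<Longrightarrow> ip V x z = ip V y z"
  shows "x = y"
proof (rule minus_eq_zeroD[OF assms(1,2)], rule ip_definite)
  show "ip V (x \<ominus> y) (x \<ominus> y) = 0"
    using assms by (simp add: ip_diff_left)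
qed (use assms in simp)

lemma ip_zero_right: "x \<in> carrier V \<Longrightarrow> ip V x \<zero> = 0"
  using ip_cnj[of \<zero> x] ip_zero_left[of x] by simp

lemma ip_add_right:
  "\<lbrakk>x \<in> carrier V; y \<in> carrier V; z \<in> carrier V\<rbrakk> \<Longrightarrow> ip V z (x \<oplus> y) = ip V z x + ip V z y"
  by (metis ip_cnj ip_add_left add.m_closed complex_cnj_add)

lemma ip_finsum_left:
  assumes "finite A" "\<And>i. i \<in> A \<Longrightarrow> f i \<in> carrier V" "y \<in> carrier V"
  shows "ip V (\<Oplus>i\<in>A. f i) y = (\<Sum>i\<in>A. ip V (f i) y)"
  using assms
proof (induction A rule: finite_induct)
  case (insert i A)
  then have "f \<in> A \<rightarrow> carrier V" by auto
  then show ?case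
    using insert by (simp add: finsum_insert ip_add_left finsum_closed)
qed (simp add: ip_zero_left)

lemma Re_ip_commute: "\<lbrakk>x \<in> carrier V; y \<in> carrier V\<rbrakk> \<Longrightarrow> Re (ip V x y) = Re (ip V y x)"
  using ip_cnj[of y x] by simp

lemma hnorm_sq: "x \<in> carrier V \<Longrightarrow> (hnorm V x)\<^sup>2 = Re (ip V x x)"
  using ip_nonneg[of x] by (simp add: hnorm_def)

lemma hnorm_zero: "hnorm V \<zero> = 0"
  by (simp add: hnorm_def ip_zero_left)

lemma hnorm_eq_0D: "\<lbrakk>x \<in> carrier V; hnorm V x = 0\<rbrakk> \<Longrightarrow> x = \<zero>"
  using ip_definite[of x] ip_self[of x] by simp

lemma hnorm_smult: "x \<in> carrier V \<Longrightarrow> hnorm V (c \<odot>\<^bsub>V\<^esub> x) = cmod c * hnorm V x"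
proof -
  assume x: "x \<in> carrier V"
  have "ip V (c \<odot>\<^bsub>V\<^esub> x) (c \<odot>\<^bsub>V\<^esub> x) = of_real ((cmod c)\<^sup>2) * ip V x x"
    using x complex_norm_square[of c] by (simp add: ip_smult_left ip_smult_right)
  then have "(hnorm V (c \<odot>\<^bsub>V\<^esub> x))\<^sup>2 = (cmod c * hnorm V x)\<^sup>2"
    using x by (simp add: hnorm_sq power_mult_distrib)
  then show ?thesis
    using x by (metis power2_eq_imp_eq hnorm_ge_0 smult_mem mult_nonneg_nonneg norm_ge_zero)
qed

lemma Re_ip_le: "\<lbrakk>x \<in> carrier V; y \<in> carrier V\<rbrakk> \<Longrightarrow> Re (ip V x y) \<le> hnorm V x * hnorm V y"
  using cauchy_schwarz[of x y] complex_Re_le_cmod[of "ip V x y"] by linarith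

lemma hnorm_add_le:
  assumes "x \<in> carrier V" "y \<in> carrier V"
  shows "hnorm V (x \<oplus> y) \<le> hnorm V x + hnorm V y"
proof (rule power2_le_imp_le)
  have "(hnorm V (x \<oplus> y))\<^sup>2 = (hnorm V x)\<^sup>2 + (hnorm V y)\<^sup>2 + 2 * Re (ip V x y)"
    using assms Re_ip_commute[of x y] by (simp add: hnorm_sq ip_add_left ip_add_right)
  then show "(hnorm V (x \<oplus> y))\<^sup>2 \<le> (hnorm V x + hnorm V y)\<^sup>2"
    using Re_ip_le[OF assms] by (simp add: power2_sum)
qed (use assms hnorm_ge_0 in auto)

lemma hnorm_diff_triangle:
  assumes "x \<in> carrier V" "y \<in> carrier V" "z \<in> carrier V"
  shows "hnorm V (x \<ominus> z) \<le> hnorm V (x \<ominus> y) + hnorm V (y \<ominus> z)"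
proof -
  have "x \<ominus> z = (x \<ominus> y) \<oplus> (y \<ominus> z)"
    using assms by (intro ip_eqI) (auto simp: ip_add_left ip_diff_left)
  then show ?thesis using hnorm_add_le[of "x \<ominus> y" "y \<ominus> z"] assms by simp
qed

lemma hnorm_minus_commute:
  assumes "x \<in> carrier V" "y \<in> carrier V"
  shows "hnorm V (x \<ominus> y) = hnorm V (y \<ominus> x)"
  using assms by (simp add: hnorm_def ip_diff_left ip_diff_right)

text \<open>
  Linearity is a consequence of self-adjointness, by non-degeneracy of the inner product.
\<close>

definition projection :: "('h \<Rightarrow> 'h) \<Rightarrow> bool" where
  "projection P \<longleftrightarrow> (\<forall>x\<in>carrier V. P x \<in> carrier V \<and> P (P x) = P x \<and>
     (\<forall>y\<in>carrier V. ip V (P x) y = ip V x (P y)))"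

lemma projection_mem: "projection P \<Longrightarrow> x \<in> carrier V \<Longrightarrow> P x \<in> carrier V"
  and projection_idem: "projection P \<Longrightarrow> x \<in> carrier V \<Longrightarrow> P (P x) = P x"
  and projection_adj: "projection P \<Longrightarrow> x \<in> carrier V \<Longrightarrow> y \<in> carrier V \<Longrightarrow> ip V (P x) y = ip V x (P y)"
  by (auto simp: projection_def)

lemma projection_ip_self: "projection P \<Longrightarrow> x \<in> carrier V \<Longrightarrow> Re (ip V (P x) x) = (hnorm V (P x))\<^sup>2"
  by (metis projection_mem projection_idem projection_adj hnorm_sq)

lemma projection_norm_le:
  assumes "projection P" "x \<in> carrier V"
  shows "hnorm V (P x) \<le> hnorm V x"
proof -
  have "(hnorm V (P x))\<^sup>2 \<le> hnorm V (P x) * hnorm V x"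
    using Re_ip_le[of "P x" x] projection_ip_self[OF assms] projection_mem[OF assms] assms by simp
  then show ?thesis
    using hnorm_ge_0[OF projection_mem[OF assms]] hnorm_ge_0[OF assms(2)]
    by (cases "hnorm V (P x) = 0") (auto simp: power2_eq_square)
qed

text \<open>
  The map \<open>1 - P\<close> is the orthogonal projection onto the kernel of \<open>P\<close>.
\<close>

lemma projection_complement:
  assumes "projection P"
  shows "projection (\<lambda>x. x \<ominus> P x)"
proof -
  note mem = projection_mem[OF assms] and adj = projection_adj[OF assms] and idem = projection_idem[OF assms]
  have "x \<ominus> P x \<ominus> P (x \<ominus> P x) = x \<ominus> P x" if x: "x \<in> carrier V" for x
  proof -
    have "P (x \<ominus> P x) = \<zero>"
      using x by (intro ip_eqI) (auto simp: mem adj ip_diff_left idem ip_zero_left)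
    then show ?thesis using x mem by (simp add: a_minus_def)
  qed
  then show ?thesis
    by (auto simp: projection_def mem adj ip_diff_left ip_diff_right)
qed

end

section \<open>A spectral gap for sums of projections\<close>

context complex_hilbert_space
begin

text \<open>
  The completeness axiom in quantitative form: the limit is within the sum of the geometric series
  of step lengths from the starting point.
\<close>

lemma geometric_steps_converge:
  fixes q C :: real
  assumes X: "\<And>n. X n \<in> carrier V" and q: "0 \<le> q" "q < 1"
    and step: "\<And>n. hnorm V (X (Suc n) \<ominus> X n) \<le> C * q ^ n"
  shows "\<exists>L\<in>carrier V. (\<lambda>n::nat. hnorm V (X n \<ominus> L)) \<longlonglongrightarrow> 0 \<and> hnorm V (X 0 \<ominus> L) \<le> C / (1 - q)"
proof -
  have C: "0 \<le> C"
    using step[of 0] hnorm_ge_0[of "X 1 \<ominus> X 0"] X by simp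
  have dist: "hnorm V (X (n + k) \<ominus> X n) \<le> C / (1 - q) * (q ^ n - q ^ (n + k))" for n k
  proof (induction k)
    case (Suc k)
    have "hnorm V (X (n + Suc k) \<ominus> X n) \<le> hnorm V (X (Suc (n + k)) \<ominus> X (n + k)) + hnorm V (X (n + k) \<ominus> X n)"
      using hnorm_diff_triangle[OF X X X, of "Suc (n + k)" n "n + k"] by simp
    also have "\<dots> \<le> C * q ^ (n + k) + C / (1 - q) * (q ^ n - q ^ (n + k))"
      by (intro add_mono step Suc.IH)
    also have "\<dots> = C / (1 - q) * (q ^ n - q ^ (n + Suc k))"
      using q by (simp add: field_simps)
    finally show ?case .
  qed (use X hnorm_zero in \<open>simp add: a_minus_def r_neg\<close>)
  have dist': "hnorm V (X m \<ominus> X n) \<le> C / (1 - q) * q ^ n" if "n \<le> m" for m n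
  proof -
    define k where "k = m - n"
    have k: "m = n + k" using that by (simp add: k_def)
    have "C / (1 - q) * (q ^ n - q ^ (n + k)) \<le> C / (1 - q) * q ^ n"
      using q C by (intro mult_left_mono) auto
    then show ?thesis using dist[of n k] k by simp
  qed
  have lim: "(\<lambda>n. C / (1 - q) * q ^ n) \<longlonglongrightarrow> 0"
    using q by (intro tendsto_mult_right_zero LIMSEQ_realpow_zero) auto
  have "\<exists>N. \<forall>m\<ge>N. \<forall>n\<ge>N. hnorm V (X m \<ominus> X n) < e" if e: "0 < e" for e
  proof -
    obtain N where N: "\<And>n. n \<ge> N \<Longrightarrow> C / (1 - q) * q ^ n < e"
      using order_tendstoD(2)[OF lim e] unfolding eventually_sequentially by blast
    have "hnorm V (X m \<ominus> X n) < e" if "m \<ge> N" "n \<ge> N" for m n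
    proof (cases "n \<le> m")
      case True
      then show ?thesis using dist'[of n m] N[of n] that by linarith
    next
      case False
      then show ?thesis
        using dist'[of m n] N[of m] that hnorm_minus_commute[OF X X, of m n] by simp
    qed
    then show ?thesis by blast
  qed
  then have "\<exists>L\<in>carrier V. (\<lambda>n. hnorm V (X n \<ominus> L)) \<longlonglongrightarrow> 0"
    by (intro complete X)
  then obtain L where L: "L \<in> carrier V" "(\<lambda>n. hnorm V (X n \<ominus> L)) \<longlonglongrightarrow> 0"
    by blast
  have "hnorm V (X 0 \<ominus> L) \<le> C / (1 - q) + hnorm V (X n \<ominus> L)" for n
    using hnorm_diff_triangle[OF X X L(1), of 0 n] dist'[of 0 n] hnorm_minus_commute[OF X X, of 0 n]
    by simp
  then have "hnorm V (X 0 \<ominus> L) \<le> C / (1 - q) + 0"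
    by (intro LIMSEQ_le_const[OF tendsto_add[OF tendsto_const L(2)]] exI[of _ 0] allI impI)
  with L show ?thesis by auto
qed

lemma two_Re_ip_le_weighted:
  fixes d :: real
  assumes "x \<in> carrier V" "y \<in> carrier V" "0 < d"
  shows "2 * Re (ip V x y) \<le> d * (hnorm V x)\<^sup>2 + (hnorm V y)\<^sup>2 / d"
proof -
  have "0 \<le> (d * hnorm V x - hnorm V y)\<^sup>2 / d"
    using assms by simp
  also have "\<dots> = d * (hnorm V x)\<^sup>2 + (hnorm V y)\<^sup>2 / d - 2 * (hnorm V x * hnorm V y)"
    using assms by (simp add: power2_diff field_simps power2_eq_square)
  finally show ?thesis
    using Re_ip_le[OF assms(1,2)] by linarith
qed

text \<open>
  Write \<open>D = \<Sum> Q\<^sub>i\<close> and \<open>E(x) = \<langle>D x, x\<rangle> = \<Sum> \<parallel>Q\<^sub>i x\<parallel>\<^sup>2\<close>.  The hypothesis says \<open>D\<^sup>2 \<ge> \<mu> D\<close>.  As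
  \<open>0 \<le> D \<le> d\<close>, the map \<open>T = 1 - D/d\<close> satisfies
  \<open>E(T x) = E(x) - 2 \<parallel>D x\<parallel>\<^sup>2 / d + E(D x) / d\<^sup>2 \<le> E(x) - \<parallel>D x\<parallel>\<^sup>2 / d \<le> (1 - \<mu>/d) E(x)\<close>.
  Hence the energy along the orbit of \<open>v\<close> decays geometrically; since one step has length
  \<open>\<parallel>D x\<parallel>/d \<le> \<surd>(E(x)/d)\<close>, the orbit converges.  Its limit is in the kernel of \<open>D\<close>, so it is zero,
  and the length of \<open>v\<close> is at most the distance travelled.  The constant depends only on \<open>\<mu>\<close> and
  \<open>d\<close>, as is needed for a Kazhdan constant that serves all representations.
\<close>

theorem norm_le_of_laplacian_gap:
  fixes I :: "'i set" and Q :: "'i \<Rightarrow> 'h \<Rightarrow> 'h" and \<mu> :: real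
  assumes I: "finite I" "I \<noteq> {}" and Q: "\<And>i. i \<in> I \<Longrightarrow> projection (Q i)"
    and \<mu>: "0 < \<mu>" "\<mu> \<le> card I"
    and gap: "\<And>x. x \<in> carrier V \<Longrightarrow>
        \<mu> * (\<Sum>i\<in>I. (hnorm V (Q i x))\<^sup>2) \<le> (hnorm V (\<Oplus>i\<in>I. Q i x))\<^sup>2"
    and ker: "\<And>x. x \<in> carrier V \<Longrightarrow> (\<And>i. i \<in> I \<Longrightarrow> Q i x = \<zero>) \<Longrightarrow> x = \<zero>"
    and v: "v \<in> carrier V"
  shows "hnorm V v \<le> sqrt (\<Sum>i\<in>I. (hnorm V (Q i v))\<^sup>2) / (1 - sqrt (1 - \<mu> / card I))"
proof -
  define d where "d = real (card I)"
  have d: "0 < d" using I by (simp add: d_def card_gt_0_iff)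
  have d1: "1 \<le> d" using I by (simp add: d_def Suc_le_eq card_gt_0_iff)
  define D where "D x = (\<Oplus>i\<in>I. Q i x)" for x
  define E where "E x = (\<Sum>i\<in>I. (hnorm V (Q i x))\<^sup>2)" for x
  define T where "T x = x \<ominus> of_real (1 / d) \<odot>\<^bsub>V\<^esub> D x" for x
  note Qm = projection_mem[OF Q]
  have Dm: "D x \<in> carrier V" if "x \<in> carrier V" for x
    unfolding D_def using Qm that by (intro finsum_closed) auto
  have Tm: "T x \<in> carrier V" if "x \<in> carrier V" for x
    using that Dm by (simp add: T_def)
  have ipD: "ip V (D x) y = (\<Sum>i\<in>I. ip V (Q i x) y)" if "x \<in> carrier V" "y \<in> carrier V" for x y
    unfolding D_def using Qm that I by (intro ip_finsum_left) auto
  have adj: "ip V (D x) y = ip V x (D y)" if "x \<in> carrier V" "y \<in> carrier V" for x y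
  proof -
    have "ip V x (D y) = cnj (\<Sum>i\<in>I. ip V (Q i y) x)"
      using ip_cnj[of "D y" x] Dm ipD that by simp
    also have "\<dots> = (\<Sum>i\<in>I. ip V (Q i x) y)"
      using that by (simp add: projection_adj[OF Q] Qm flip: ip_cnj)
    finally show ?thesis using ipD that by simp
  qed
  have E: "E x = Re (ip V (D x) x)" if "x \<in> carrier V" for x
    using that by (simp add: ipD E_def projection_ip_self[OF Q])
  have E_le: "E x \<le> d * (hnorm V x)\<^sup>2" if "x \<in> carrier V" for x
  proof -
    have "E x \<le> (\<Sum>i\<in>I. (hnorm V x)\<^sup>2)"
      unfolding E_def using that Qm projection_norm_le[OF Q]
      by (intro sum_mono power_mono) (auto simp: hnorm_ge_0)
    then show ?thesis by (simp add: d_def)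
  qed
  have D_le: "(hnorm V (D x))\<^sup>2 \<le> d * E x" if x: "x \<in> carrier V" for x
  proof -
    \<comment> \<open>\<open>D\<^sup>2 \<le> d D\<close>: apply \<open>2 Re \<langle>Q\<^sub>i x, D x\<rangle> \<le> d \<parallel>Q\<^sub>i x\<parallel>\<^sup>2 + \<parallel>D x\<parallel>\<^sup>2 / d\<close> to each of the \<open>d\<close> summands.\<close>
    have "2 * (hnorm V (D x))\<^sup>2 = (\<Sum>i\<in>I. 2 * Re (ip V (Q i x) (D x)))"
      using x Dm[OF x] by (simp add: hnorm_sq ipD sum_distrib_left)
    also have "\<dots> \<le> (\<Sum>i\<in>I. d * (hnorm V (Q i x))\<^sup>2 + (hnorm V (D x))\<^sup>2 / d)"
      using x Dm[OF x] Qm d by (intro sum_mono two_Re_ip_le_weighted) auto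
    also have "\<dots> = d * E x + (hnorm V (D x))\<^sup>2"
      using d by (simp add: sum.distrib E_def sum_distrib_left d_def)
    finally show ?thesis by simp
  qed
  define q where "q = sqrt (1 - \<mu> / d)"
  have q2: "q\<^sup>2 = 1 - \<mu> / d" and q: "0 \<le> q" "q < 1"
    using \<mu> d by (auto simp: q_def d_def field_simps)
  have E_T: "E (T x) \<le> q\<^sup>2 * E x" if x: "x \<in> carrier V" for x
  proof -
    let ?y = "of_real (1 / d) \<odot>\<^bsub>V\<^esub> D x"
    have y: "?y \<in> carrier V" using Dm[OF x] by simp
    have "ip V (D (T x)) (T x) = ip V (D x) x - ip V (D x) ?y - ip V (D ?y) x + ip V (D ?y) ?y"
      using x y Dm by (simp add: T_def adj ip_diff_left ip_diff_right)
    moreover have "ip V (D x) ?y = of_real ((hnorm V (D x))\<^sup>2 / d)"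
      using Dm[OF x] by (simp add: ip_smult_right ip_self)
    moreover have "ip V (D ?y) x = of_real ((hnorm V (D x))\<^sup>2 / d)"
      using Dm[OF x] x y by (simp add: adj ip_smult_left ip_self)
    moreover have "Re (ip V (D ?y) ?y) \<le> (hnorm V (D x))\<^sup>2 / d"
    proof -
      have "Re (ip V (D ?y) ?y) \<le> d * (hnorm V ?y)\<^sup>2"
        using E_le[OF y] E[OF y] by simp
      also have "\<dots> = (hnorm V (D x))\<^sup>2 / d"
        using Dm[OF x] d by (simp add: hnorm_smult norm_divide power_divide power2_eq_square)
      finally show ?thesis .
    qed
    ultimately have "E (T x) \<le> E x - (hnorm V (D x))\<^sup>2 / d"
      using E[OF x] E[OF Tm[OF x]] by simp
    also have "\<dots> \<le> E x - \<mu> * E x / d"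
      using gap[OF x] d by (simp add: E_def D_def divide_right_mono)
    finally show ?thesis by (simp add: q2 algebra_simps)
  qed
  define X where "X n = (T ^^ n) v" for n
  have X: "X n \<in> carrier V" for n
    by (induction n) (auto simp: X_def v Tm)
  have E_X: "E (X n) \<le> (q\<^sup>2) ^ n * E v" for n
  proof (induction n)
    case (Suc n)
    have "E (X (Suc n)) \<le> q\<^sup>2 * E (X n)" using E_T[OF X[of n]] by (simp add: X_def)
    also have "\<dots> \<le> q\<^sup>2 * ((q\<^sup>2) ^ n * E v)" using Suc by (intro mult_left_mono) auto
    finally show ?case by simp
  qed (simp add: X_def)
  have E0: "0 \<le> E x" for x by (simp add: E_def sum_nonneg)
  have D_X: "hnorm V (D (X n)) \<le> sqrt (d * E v) * q ^ n" for n
  proof (rule power2_le_imp_le)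
    have "(hnorm V (D (X n)))\<^sup>2 \<le> d * ((q\<^sup>2) ^ n * E v)"
      using D_le[OF X[of n]] E_X[of n] d by (meson mult_left_mono order_trans less_imp_le)
    then show "(hnorm V (D (X n)))\<^sup>2 \<le> (sqrt (d * E v) * q ^ n)\<^sup>2"
      using d E0[of v] by (simp add: power_mult_distrib mult_ac flip: power_mult)
  qed (use q d E0 in simp)
  have step: "hnorm V (X (Suc n) \<ominus> X n) \<le> sqrt (E v) * q ^ n" for n
  proof -
    let ?y = "of_real (1 / d) \<odot>\<^bsub>V\<^esub> D (X n)"
    have y: "?y \<in> carrier V" using Dm[OF X] by simp
    have "X n \<ominus> X (Suc n) = ?y"
      using X[of n] y by (intro ip_eqI) (auto simp: X_def T_def ip_diff_left)
    then have "hnorm V (X (Suc n) \<ominus> X n) = hnorm V (D (X n)) / d"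
      using hnorm_minus_commute[OF X X, of "Suc n" n] Dm[OF X] d by (simp add: hnorm_smult norm_divide)
    also have "\<dots> \<le> sqrt (d * E v) * q ^ n / d"
      using D_X d by (intro divide_right_mono) auto
    also have "\<dots> = (sqrt (E v) * q ^ n) / sqrt d"
      using d by (simp add: real_sqrt_mult field_simps)
    also have "\<dots> \<le> sqrt (E v) * q ^ n"
    proof -
      have "0 \<le> sqrt (E v) * q ^ n" using q E0[of v] by simp
      then show ?thesis using d1 by (simp add: divide_le_eq mult_le_cancel_left1)
    qed
    finally show ?thesis .
  qed
  obtain L where L: "L \<in> carrier V" and lim: "(\<lambda>n. hnorm V (X n \<ominus> L)) \<longlonglongrightarrow> 0"
    and close: "hnorm V (X 0 \<ominus> L) \<le> sqrt (E v) / (1 - q)"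
    using geometric_steps_converge[OF X q step] by blast
  \<comment> \<open>\<open>D\<close> is self-adjoint, so \<open>\<langle>D L, D L\<rangle> = \<langle>D X\<^sub>n, D L\<rangle> - \<langle>X\<^sub>n - L, D (D L)\<rangle>\<close>, and both terms tend to \<open>0\<close>.\<close>
  have "hnorm V (D L) = 0"
  proof -
    have bound: "(hnorm V (D L))\<^sup>2 \<le> hnorm V (X n \<ominus> L) * hnorm V (D (D L)) + hnorm V (D (X n)) * hnorm V (D L)" for n
    proof -
      have "ip V (D L) (D L) = ip V (D (X n)) (D L) - ip V (X n \<ominus> L) (D (D L))"
        using X L Dm by (simp add: adj ip_diff_left)
      moreover have "Re (ip V (D (X n)) (D L)) \<le> hnorm V (D (X n)) * hnorm V (D L)"
        using X L Dm by (intro Re_ip_le) auto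
      moreover have "- Re (ip V (X n \<ominus> L) (D (D L))) \<le> hnorm V (X n \<ominus> L) * hnorm V (D (D L))"
        using cauchy_schwarz[of "X n \<ominus> L" "D (D L)"] abs_Re_le_cmod[of "ip V (X n \<ominus> L) (D (D L))"] X L Dm
        by (simp add: abs_le_iff)
      ultimately show ?thesis using L Dm by (simp add: hnorm_sq)
    qed
    have "(\<lambda>n. sqrt (d * E v) * q ^ n) \<longlonglongrightarrow> 0"
      using q by (intro tendsto_mult_right_zero LIMSEQ_realpow_zero) auto
    then have DX0: "(\<lambda>n. hnorm V (D (X n))) \<longlonglongrightarrow> 0"
      by (rule real_tendsto_sandwich[OF _ _ tendsto_const, rotated 2])
        (use D_X hnorm_ge_0[OF Dm[OF X]] in auto)
    have "(\<lambda>n. hnorm V (X n \<ominus> L) * hnorm V (D (D L)) + hnorm V (D (X n)) * hnorm V (D L))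
        \<longlonglongrightarrow> 0 * hnorm V (D (D L)) + 0 * hnorm V (D L)"
      by (intro tendsto_intros lim DX0)
    then have "(hnorm V (D L))\<^sup>2 \<le> 0 * hnorm V (D (D L)) + 0 * hnorm V (D L)"
      using bound by (intro LIMSEQ_le_const) auto
    then show ?thesis by simp
  qed
  then have "D L = \<zero>" using hnorm_eq_0D Dm L by blast
  then have "E L = 0" using E L by (simp add: ip_zero_left)
  then have "Q i L = \<zero>" if "i \<in> I" for i
    using that I L Qm unfolding E_def
    by (subst (asm) sum_nonneg_eq_0_iff) (auto intro: hnorm_eq_0D)
  then have "L = \<zero>" using ker L by blast
  then have "X 0 \<ominus> L = v" using v by (simp add: X_def a_minus_def)
  then show ?thesis using close by (simp add: E_def q_def d_def)
qed

text \<open>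
  Expand the square of the norm of the sum.  Each of the \<open>n(n - 1)\<close> off-diagonal terms costs at
  most \<open>\<epsilon>/2\<close> times the sum of two of the squared norms, so every squared norm is charged \<open>(n - 1) \<epsilon>\<close> in total.
\<close>

lemma sum_norm_lower_bound:
  fixes \<epsilon> :: real
  assumes I: "finite I" and y: "\<And>i. i \<in> I \<Longrightarrow> y i \<in> carrier V"
    and pair: "\<And>i j. \<lbrakk>i \<in> I; j \<in> I; i \<noteq> j\<rbrakk> \<Longrightarrow>
        2 * Re (ip V (y i) (y j)) \<ge> - \<epsilon> * ((hnorm V (y i))\<^sup>2 + (hnorm V (y j))\<^sup>2)"
  shows "(1 - (real (card I) - 1) * \<epsilon>) * (\<Sum>i\<in>I. (hnorm V (y i))\<^sup>2) \<le> (hnorm V (\<Oplus>i\<in>I. y i))\<^sup>2"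
proof -
  define e where "e i = (hnorm V (y i))\<^sup>2" for i
  define E where "E = (\<Sum>i\<in>I. e i)"
  define s where "s = (\<Oplus>i\<in>I. y i)"
  have s: "s \<in> carrier V" unfolding s_def using y by (intro finsum_closed) auto
  have ips: "ip V s z = (\<Sum>i\<in>I. ip V (y i) z)" if "z \<in> carrier V" for z
    unfolding s_def using I y that by (intro ip_finsum_left) auto
  have row: "2 * Re (ip V (y i) s) \<ge> 2 * e i - \<epsilon> * ((real (card I) - 1) * e i + (E - e i))" if i: "i \<in> I" for i
  proof -
    have card_n: "real (card (I - {i})) = real (card I) - 1"
      using I i card_gt_0_iff[of I] by (subst card_Diff_singleton) (auto simp: of_nat_diff)
    have "- \<epsilon> * (\<Sum>j\<in>I - {i}. e i + e j) \<le> (\<Sum>j\<in>I - {i}. 2 * Re (ip V (y j) (y i)))"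
      unfolding sum_distrib_left using pair[of _ i] i by (intro sum_mono) (auto simp: e_def add.commute)
    also have "(\<Sum>j\<in>I - {i}. e i + e j) = (real (card I) - 1) * e i + (E - e i)"
      using I i card_n by (simp add: sum.distrib sum_diff1 E_def)
    also have "(\<Sum>j\<in>I - {i}. 2 * Re (ip V (y j) (y i))) = 2 * Re (ip V s (y i)) - 2 * e i"
      using I i y by (simp add: ips sum_diff1 sum_distrib_left e_def hnorm_sq)
    finally show ?thesis
      using Re_ip_commute[OF s y[OF i]] by simp
  qed
  have "2 * (hnorm V s)\<^sup>2 = (\<Sum>i\<in>I. 2 * Re (ip V (y i) s))"
    using s by (simp add: hnorm_sq ips sum_distrib_left)
  also have "\<dots> \<ge> (\<Sum>i\<in>I. 2 * e i - \<epsilon> * ((real (card I) - 1) * e i + (E - e i)))"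
    by (intro sum_mono row)
  also have "(\<Sum>i\<in>I. 2 * e i - \<epsilon> * ((real (card I) - 1) * e i + (E - e i)))
      = 2 * E - \<epsilon> * ((real (card I) - 1) * E + (real (card I) * E - E))"
    by (simp add: sum.distrib sum_subtractf E_def flip: sum_distrib_left)
  finally show ?thesis
    by (simp add: s_def E_def e_def algebra_simps)
qed

text \<open>
  An upper bound for the cosine between the ranges of \<open>P\<close> and \<open>Q\<close> becomes a lower bound for the
  inner product of the complementary components.  In operator terms: \<open>B = P + Q\<close> satisfies
  \<open>B \<le> 1 + \<epsilon>\<close>, hence \<open>S = (1 - P) + (1 - Q) = 2 - B \<ge> 1 - \<epsilon>\<close>, hence \<open>S\<^sup>2 \<ge> (1 - \<epsilon>) S\<close>; the claim
  is this inequality with \<open>S\<^sup>2\<close> expanded.  The proof does it for a single vector, with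
  \<open>n = \<parallel>v\<parallel>\<^sup>2\<close>, \<open>s = \<langle>B v, v\<rangle>\<close> and \<open>s + 2c = \<parallel>B v\<parallel>\<^sup>2\<close>.
\<close>

lemma complement_pair_lower_bound:
  fixes \<epsilon> :: real
  assumes P: "projection P" and Q: "projection Q" and v: "v \<in> carrier V" and \<epsilon>: "0 \<le> \<epsilon>" "\<epsilon> \<le> 1"
    and angle: "2 * Re (ip V (P v) (Q v)) \<le> \<epsilon> * ((hnorm V (P v))\<^sup>2 + (hnorm V (Q v))\<^sup>2)"
  shows "2 * Re (ip V (v \<ominus> P v) (v \<ominus> Q v))
           \<ge> - \<epsilon> * ((hnorm V (v \<ominus> P v))\<^sup>2 + (hnorm V (v \<ominus> Q v))\<^sup>2)"
proof -
  define n where "n = (hnorm V v)\<^sup>2"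
  define s where "s = (hnorm V (P v))\<^sup>2 + (hnorm V (Q v))\<^sup>2"
  define c where "c = Re (ip V (P v) (Q v))"
  note mem = projection_mem[OF P v] projection_mem[OF Q v]
  note P' = projection_ip_self[OF P v] and Q' = projection_ip_self[OF Q v]
  have P'': "(hnorm V (v \<ominus> P v))\<^sup>2 = n - (hnorm V (P v))\<^sup>2"
    using mem v P' Re_ip_commute[OF v mem(1)]
    by (simp add: n_def hnorm_sq ip_diff_left ip_diff_right)
  have Q'': "(hnorm V (v \<ominus> Q v))\<^sup>2 = n - (hnorm V (Q v))\<^sup>2"
    using mem v Q' Re_ip_commute[OF v mem(2)]
    by (simp add: n_def hnorm_sq ip_diff_left ip_diff_right)
  have B: "(hnorm V (P v \<oplus> Q v))\<^sup>2 = s + 2 * c"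
    using mem Re_ip_commute[OF mem] by (simp add: s_def c_def hnorm_sq ip_add_left ip_add_right)
  have "s = Re (ip V (P v \<oplus> Q v) v)"
    using mem v P' Q' by (simp add: s_def ip_add_left)
  also have "\<dots> \<le> hnorm V (P v \<oplus> Q v) * hnorm V v"
    using mem v by (intro Re_ip_le) auto
  finally have "s\<^sup>2 \<le> (hnorm V (P v \<oplus> Q v) * hnorm V v)\<^sup>2"
    by (intro power_mono) (auto simp: s_def)
  then have sB: "s\<^sup>2 \<le> (s + 2 * c) * n"
    by (simp add: power_mult_distrib B n_def)
  have s0: "0 \<le> s" and n0: "0 \<le> n" by (simp_all add: s_def n_def)
  have cs: "2 * c \<le> \<epsilon> * s" using angle by (simp add: c_def s_def)
  have "s\<^sup>2 \<le> (1 + \<epsilon>) * s * n"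
    using sB mult_right_mono[OF cs n0] by (simp add: algebra_simps)
  then have sn: "s \<le> (1 + \<epsilon>) * n"
    using s0 n0 \<epsilon> mult_right_le_imp_le[of s s "(1 + \<epsilon>) * n"]
    by (cases "s = 0") (auto simp: power2_eq_square mult_ac)
  have "0 \<le> (2 + 2 * \<epsilon>) * n - (2 + \<epsilon>) * s + 2 * c"
  proof (cases "n = 0")
    case True
    then have "hnorm V v = 0" by (simp add: n_def)
    then have "v = \<zero>" using hnorm_eq_0D v by blast
    then have "ip V (P v) (Q v) = 0"
      using projection_adj[OF P, of \<zero> "Q v"] mem projection_mem[OF P] by (simp add: ip_zero_left)
    then show ?thesis using True sn s0 by (simp add: c_def)
  next
    case False
    \<comment> \<open>This is \<open>(2 - B)(1 + \<epsilon> - B) \<ge> 0\<close>, with \<open>\<langle>B v, v\<rangle>\<^sup>2 / \<parallel>v\<parallel>\<^sup>2\<close> in place of \<open>\<parallel>B v\<parallel>\<^sup>2\<close>.\<close>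
    have "(2 * n - s) * ((1 + \<epsilon>) * n - s) \<ge> 0"
      using sn n0 \<epsilon> mult_right_mono[of "1 + \<epsilon>" 2 n] by (intro mult_nonneg_nonneg) auto
    then have "0 \<le> ((2 + 2 * \<epsilon>) * n - (2 + \<epsilon>) * s + 2 * c) * n"
      using sB by (simp add: algebra_simps power2_eq_square)
    then show ?thesis using False n0 by (simp add: zero_le_mult_iff)
  qed
  moreover have "Re (ip V (v \<ominus> P v) (v \<ominus> Q v)) = n - s + c"
    using mem v P' Q' Re_ip_commute[OF v mem(2)]
    by (simp add: n_def s_def c_def hnorm_sq ip_diff_left ip_diff_right)
  ultimately show ?thesis
    unfolding P'' Q'' s_def by (simp add: algebra_simps)
qed

end

section \<open>Commutators in groups of nilpotency class two\<close>

lemma commutator_closed: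
  assumes "group G" "a \<in> carrier G" "b \<in> carrier G"
  shows "commutator G a b \<in> carrier G"
proof -
  interpret group G by fact
  show ?thesis using assms by (simp add: commutator_def)
qed

text \<open>
  Relators that are commutators are read as commutation relations.
\<close>

lemma (in group) commutator_eq_one_iff:
  assumes "a \<in> carrier G" "b \<in> carrier G"
  shows "commutator G a b = \<one> \<longleftrightarrow> a \<otimes> b = b \<otimes> a"
proof -
  have "commutator G a b = (a \<otimes> b) \<otimes> inv (b \<otimes> a)"
    using assms by (simp add: commutator_def inv_mult_group m_assoc)
  then show ?thesis
    using assms inv_equality[of "a \<otimes> b" "inv (b \<otimes> a)"] by (auto simp: r_inv)
qed

lemma (in group) inv_commutator:
  assumes "a \<in> carrier G" "b \<in> carrier G"
  shows "inv (commutator G a b) = commutator G b a"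
  using assms by (simp add: commutator_def inv_mult_group m_assoc)

lemma (in group) inv_commutes:
  assumes "x \<otimes> y = y \<otimes> x" "x \<in> carrier G" "y \<in> carrier G"
  shows "inv x \<otimes> y = y \<otimes> inv x"
  using assms by (metis inv_closed inv_solve_left inv_solve_right m_assoc m_closed)

lemma hom_commutator:
  assumes "group G" "group H" "h \<in> hom G H" "a \<in> carrier G" "b \<in> carrier G"
  shows "h (commutator G a b) = commutator H (h a) (h b)"
proof -
  interpret group_hom G H h
    using assms by (simp add: group_hom_def group_hom_axioms_def)
  show ?thesis using assms by (simp add: commutator_def)
qed

context group
begin

lemma pow_commutes:
  assumes "x \<otimes> y = y \<otimes> x" "x \<in> carrier G" "y \<in> carrier G"
  shows "x [^] (m::nat) \<otimes> y [^] (n::nat) = y [^] n \<otimes> x [^] m"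
  using group_commutes_pow[of y "x [^] m" n] group_commutes_pow[OF assms, of m] assms by simp

lemma pow_cong_of_torsion:
  assumes x: "x \<in> carrier G" "x [^] (p::nat) = \<one>" and mn: "[m = n] (mod p)"
  shows "x [^] m = x [^] n"
proof -
  have "x [^] k = x [^] (k mod p)" for k
  proof -
    have "x [^] k = x [^] (p * (k div p) + k mod p)" by simp
    also have "\<dots> = x [^] (k mod p)"
      using x by (simp only: nat_pow_mult[symmetric] nat_pow_pow[symmetric]) simp
    finally show ?thesis .
  qed
  from this[of m] this[of n] mn show ?thesis by (simp add: cong_def)
qed

text \<open>
  The Heisenberg relation \<open>a b = b a c\<close> with \<open>c\<close> central: moving \<open>a\<^sup>k\<close> past \<open>b\<^sup>l\<close> produces one \<open>c\<close>
  for each of the \<open>k l\<close> exchanges.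
\<close>

lemma class2_pow_commute:
  assumes ab: "a \<in> carrier G" "b \<in> carrier G"
    and ca: "commutator G a b \<otimes> a = a \<otimes> commutator G a b"
    and cb: "commutator G a b \<otimes> b = b \<otimes> commutator G a b"
  shows "a [^] (k::nat) \<otimes> b [^] (l::nat) = b [^] l \<otimes> a [^] k \<otimes> commutator G a b [^] (k * l)"
proof -
  define c where "c = commutator G a b"
  have c: "c \<in> carrier G" using ab by (simp add: c_def commutator_def)
  have ca: "c \<otimes> a = a \<otimes> c" and cb: "c \<otimes> b = b \<otimes> c" using ca cb by (simp_all add: c_def)
  note ac = ab c
  have cpa: "c [^] n \<otimes> a = a \<otimes> c [^] n" for n :: nat
    using group_commutes_pow[OF ca] ac by simp
  have cpb: "c [^] n \<otimes> b = b \<otimes> c [^] n" for n :: nat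
    using group_commutes_pow[OF cb] ac by simp
  have "c \<otimes> b \<otimes> a = a \<otimes> b"
    using ab by (simp add: c_def commutator_def m_assoc)
  then have 1: "a \<otimes> b = b \<otimes> a \<otimes> c"
    using ac ca cb by (simp add: m_assoc)
  have 2: "a [^] k \<otimes> b = b \<otimes> a [^] k \<otimes> c [^] k" for k :: nat
  proof (induction k)
    case (Suc k)
    have "a [^] Suc k \<otimes> b = a [^] k \<otimes> (a \<otimes> b)"
      using ac by (simp add: m_assoc)
    also have "\<dots> = (a [^] k \<otimes> b) \<otimes> a \<otimes> c"
      using ac by (simp add: 1 m_assoc)
    also have "\<dots> = b \<otimes> a [^] k \<otimes> (c [^] k \<otimes> a) \<otimes> c"
      using ac by (simp add: Suc m_assoc)
    also have "\<dots> = b \<otimes> a [^] Suc k \<otimes> c [^] Suc k"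
      unfolding cpa using ac by (simp add: m_assoc)
    finally show ?case .
  qed (use ac in simp)
  have "a [^] k \<otimes> b [^] l = b [^] l \<otimes> a [^] k \<otimes> c [^] (k * l)"
  proof (induction l)
    case (Suc l)
    have "a [^] k \<otimes> b [^] Suc l = (a [^] k \<otimes> b [^] l) \<otimes> b"
      using ac by (simp add: m_assoc)
    also have "\<dots> = b [^] l \<otimes> a [^] k \<otimes> (c [^] (k * l) \<otimes> b)"
      using ac by (simp add: Suc m_assoc)
    also have "\<dots> = b [^] l \<otimes> (a [^] k \<otimes> b) \<otimes> c [^] (k * l)"
      unfolding cpb using ac by (simp add: m_assoc)
    also have "\<dots> = b [^] Suc l \<otimes> a [^] k \<otimes> (c [^] k \<otimes> c [^] (k * l))"
      unfolding 2 using ac by (simp add: m_assoc)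
    also have "c [^] k \<otimes> c [^] (k * l) = c [^] (k * Suc l)"
      using ac by (simp add: nat_pow_mult)
    finally show ?case .
  qed (use ac in simp)
  then show ?thesis by (simp add: c_def)
qed

lemma commutator_pow_pow:
  assumes ab: "a \<in> carrier G" "b \<in> carrier G"
    and ca: "commutator G a b \<otimes> a = a \<otimes> commutator G a b"
    and cb: "commutator G a b \<otimes> b = b \<otimes> commutator G a b"
  shows "commutator G (a [^] (k::nat)) (b [^] (l::nat)) = commutator G a b [^] (k * l)"
proof -
  define c where "c = commutator G a b"
  have c: "c \<in> carrier G" using ab by (simp add: c_def commutator_def)
  have "c [^] (k * l) \<otimes> a [^] k = a [^] k \<otimes> c [^] (k * l)"
    using ca ab c by (intro pow_commutes) (simp_all add: c_def)
  moreover have "c [^] (k * l) \<otimes> b [^] l = b [^] l \<otimes> c [^] (k * l)"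
    using cb ab c by (intro pow_commutes) (simp_all add: c_def)
  ultimately have "a [^] k \<otimes> b [^] l = c [^] (k * l) \<otimes> b [^] l \<otimes> a [^] k"
    using class2_pow_commute[OF assms, of k l] ab c by (simp add: m_assoc c_def)
  then have "commutator G (a [^] k) (b [^] l)
      = c [^] (k * l) \<otimes> b [^] l \<otimes> a [^] k \<otimes> inv (a [^] k) \<otimes> inv (b [^] l)"
    by (simp add: commutator_def)
  then show ?thesis
    using ab c by (simp add: m_assoc c_def)
qed

text \<open>
  The commutator inherits the exponent of \<open>b\<close>, as \<open>[a, b]\<^sup>p = [a, b\<^sup>p]\<close>.
\<close>

lemma commutator_pow_eq_one:
  assumes "a \<in> carrier G" "b \<in> carrier G"
    and "commutator G a b \<otimes> a = a \<otimes> commutator G a b"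
    and "commutator G a b \<otimes> b = b \<otimes> commutator G a b"
    and "b [^] (p::nat) = \<one>"
  shows "commutator G a b [^] p = \<one>"
  using commutator_pow_pow[OF assms(1-4), of 1 p] assms by (simp add: commutator_def)

end

section \<open>Averages over cyclic subgroups in a unitary representation\<close>

lemma sum_cyclic_shift:
  fixes f :: "nat \<Rightarrow> 'a::comm_monoid_add"
  assumes "f p = f 0"
  shows "(\<Sum>k<p. f (Suc k)) = (\<Sum>k<p. f k)"
proof (cases p)
  case (Suc m)
  have "(\<Sum>k<Suc m. f (Suc k)) = f 0 + (\<Sum>k<m. f (Suc k))"
    using assms by (simp add: Suc add.commute)
  also have "\<dots> = (\<Sum>k<Suc m. f k)"
    by (rule sum.lessThan_Suc_shift[symmetric])
  finally show ?thesis by (simp add: Suc)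
qed simp

locale unitary_rep = complex_hilbert_space V + G: group G
  for V :: "'h hilbert" (structure) and G :: "('g, 'b) monoid_scheme" +
  fixes \<rho> :: "'g \<Rightarrow> 'h \<Rightarrow> 'h"
  assumes rep: "unitary_representation G V \<rho>"
begin

lemma act: "group_action G (carrier V) \<rho>"
  using rep by (simp add: unitary_representation_def)

lemma act_mem [simp]: "g \<in> carrier G \<Longrightarrow> x \<in> carrier V \<Longrightarrow> \<rho> g x \<in> carrier V"
  using group_action.element_image[OF act] by blast

lemma act_mult: "\<lbrakk>g \<in> carrier G; h \<in> carrier G; x \<in> carrier V\<rbrakk> \<Longrightarrow> \<rho> (g \<otimes>\<^bsub>G\<^esub> h) x = \<rho> g (\<rho> h x)"
  using group_action.composition_rule[OF act] by blast

lemma act_one [simp]: "x \<in> carrier V \<Longrightarrow> \<rho> \<one>\<^bsub>G\<^esub> x = x"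
  using group_action.id_eq_one[OF act] by (metis restrict_apply')

lemma act_ip: "\<lbrakk>g \<in> carrier G; x \<in> carrier V; y \<in> carrier V\<rbrakk> \<Longrightarrow> ip V (\<rho> g x) (\<rho> g y) = ip V x y"
  using rep by (simp add: unitary_representation_def)

lemma act_adj: "\<lbrakk>g \<in> carrier G; x \<in> carrier V; y \<in> carrier V\<rbrakk> \<Longrightarrow> ip V (\<rho> g x) y = ip V x (\<rho> (inv\<^bsub>G\<^esub> g) y)"
  using act_ip[of g x "\<rho> (inv\<^bsub>G\<^esub> g) y"] by (simp flip: act_mult)

text \<open>
  If \<open>g\<^sup>p = 1\<close>, this is the projection onto the vectors fixed by \<open>g\<close>.  The sum runs over the
  exponents \<open>0, \<dots>, p - 1\<close>, so the elements of the cyclic group are repeated if the order of \<open>g\<close> is a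
  proper divisor of \<open>p\<close>.
\<close>

definition avg :: "nat \<Rightarrow> 'g \<Rightarrow> 'h \<Rightarrow> 'h" where
  "avg p g v = of_real (1 / real p) \<odot>\<^bsub>V\<^esub> (\<Oplus>\<^bsub>V\<^esub>k\<in>{..<p}. \<rho> (g [^]\<^bsub>G\<^esub> k) v)"

lemma avg_mem [simp]: "g \<in> carrier G \<Longrightarrow> v \<in> carrier V \<Longrightarrow> avg p g v \<in> carrier V"
  unfolding avg_def by (intro smult_mem finsum_closed) auto

lemma ip_avg_left:
  assumes "g \<in> carrier G" "v \<in> carrier V" "y \<in> carrier V"
  shows "ip V (avg p g v) y = (\<Sum>k<p. ip V (\<rho> (g [^]\<^bsub>G\<^esub> k) v) y) / of_nat p"
proof -
  have "(\<Oplus>\<^bsub>V\<^esub>k\<in>{..<p}. \<rho> (g [^]\<^bsub>G\<^esub> k) v) \<in> carrier V"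
    using assms by (intro finsum_closed) auto
  then show ?thesis
    unfolding avg_def using assms by (simp add: ip_smult_left ip_finsum_left)
qed

lemma act_avg:
  assumes g: "g \<in> carrier G" "g [^]\<^bsub>G\<^esub> p = \<one>\<^bsub>G\<^esub>" and v: "v \<in> carrier V"
  shows "\<rho> g (avg p g v) = avg p g v"
proof (rule ip_eqI)
  fix y assume y: "y \<in> carrier V"
  have "ip V (\<rho> g (avg p g v)) y = (\<Sum>k<p. ip V (\<rho> (g [^]\<^bsub>G\<^esub> k) v) (\<rho> (inv\<^bsub>G\<^esub> g) y)) / of_nat p"
    using g v y by (simp add: act_adj[of g "avg p g v"] ip_avg_left)
  also have "(\<lambda>k. ip V (\<rho> (g [^]\<^bsub>G\<^esub> k) v) (\<rho> (inv\<^bsub>G\<^esub> g) y)) = (\<lambda>k. ip V (\<rho> (g [^]\<^bsub>G\<^esub> Suc k) v) y)"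
  proof
    fix k :: nat
    show "ip V (\<rho> (g [^]\<^bsub>G\<^esub> k) v) (\<rho> (inv\<^bsub>G\<^esub> g) y) = ip V (\<rho> (g [^]\<^bsub>G\<^esub> Suc k) v) y"
    proof -
      have "\<rho> g (\<rho> (g [^]\<^bsub>G\<^esub> k) v) = \<rho> (g [^]\<^bsub>G\<^esub> Suc k) v"
        using g v by (subst G.nat_pow_Suc2) (simp_all add: act_mult del: G.nat_pow_Suc)
      then show ?thesis using act_adj[of g "\<rho> (g [^]\<^bsub>G\<^esub> k) v" y] g v y by (simp del: G.nat_pow_Suc)
    qed
  qed
  also have "(\<Sum>k<p. ip V (\<rho> (g [^]\<^bsub>G\<^esub> Suc k) v) y) = (\<Sum>k<p. ip V (\<rho> (g [^]\<^bsub>G\<^esub> k) v) y)"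
    by (rule sum_cyclic_shift) (simp add: g)
  finally show "ip V (\<rho> g (avg p g v)) y = ip V (avg p g v) y"
    using g v y by (simp add: ip_avg_left)
qed (use g v in auto)

lemma act_pow_fixed:
  assumes "g \<in> carrier G" "v \<in> carrier V" "\<rho> g v = v"
  shows "\<rho> (g [^]\<^bsub>G\<^esub> (k::nat)) v = v"
  by (induction k) (use assms in \<open>simp_all add: act_mult\<close>)

lemma avg_fixed:
  assumes "0 < p" "g \<in> carrier G" "v \<in> carrier V" "\<rho> g v = v"
  shows "avg p g v = v"
  by (rule ip_eqI) (use assms act_pow_fixed[OF assms(2-4)] in \<open>simp_all add: ip_avg_left\<close>)

text \<open>
  Averaging does not change the inner product with a fixed vector.  Applied to averages on either
  side, this shows that averaging is self-adjoint.
\<close>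

lemma avg_adj_half:
  assumes p: "0 < p" and g: "g \<in> carrier G" "g [^]\<^bsub>G\<^esub> p = \<one>\<^bsub>G\<^esub>" and v: "v \<in> carrier V" "w \<in> carrier V"
    and w: "\<rho> g w = w"
  shows "ip V (avg p g v) w = ip V v w"
proof -
  have "ip V (\<rho> (g [^]\<^bsub>G\<^esub> k) v) w = ip V v w" for k :: nat
    using act_ip[of "g [^]\<^bsub>G\<^esub> k" v w] act_pow_fixed[OF g(1) v(2) w] g v by simp
  then show ?thesis using p g v by (simp add: ip_avg_left)
qed

lemma projection_avg:
  assumes p: "0 < p" and g: "g \<in> carrier G" "g [^]\<^bsub>G\<^esub> p = \<one>\<^bsub>G\<^esub>"
  shows "projection (avg p g)"
proof -
  have "ip V (avg p g x) y = ip V x (avg p g y)" if "x \<in> carrier V" "y \<in> carrier V" for x y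
  proof -
    have "ip V (avg p g x) (avg p g y) = ip V x (avg p g y)"
      using p g that by (intro avg_adj_half act_avg) auto
    moreover have "ip V (avg p g y) (avg p g x) = ip V y (avg p g x)"
      using p g that by (intro avg_adj_half act_avg) auto
    ultimately show ?thesis
      using that g by (metis ip_cnj avg_mem)
  qed
  then show ?thesis
    using p g by (auto simp: projection_def intro: avg_fixed act_avg)
qed

text \<open>
  The condition asks \<open>P\<close> to commute with \<open>g\<close> on the orbit of the single vector \<open>v\<close> only: projections
  that commute with \<open>g\<close> merely on a subspace have to be covered.
\<close>

lemma avg_commutes_projection:
  assumes P: "projection P" and g: "g \<in> carrier G" and v: "v \<in> carrier V"
    and comm: "\<And>k::nat. \<rho> (g [^]\<^bsub>G\<^esub> k) (P v) = P (\<rho> (g [^]\<^bsub>G\<^esub> k) v)"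
  shows "avg p g (P v) = P (avg p g v)"
  by (rule ip_eqI)
    (use assms in \<open>simp_all add: projection_mem[OF P] projection_adj[OF P] ip_avg_left\<close>)

lemma act_avg_commute:
  assumes gh: "g \<in> carrier G" "h \<in> carrier G" "g \<otimes>\<^bsub>G\<^esub> h = h \<otimes>\<^bsub>G\<^esub> g" and v: "v \<in> carrier V"
  shows "\<rho> h (avg p g v) = avg p g (\<rho> h v)"
proof (rule ip_eqI)
  fix y assume y: "y \<in> carrier V"
  have "\<rho> h (\<rho> (g [^]\<^bsub>G\<^esub> k) v) = \<rho> (g [^]\<^bsub>G\<^esub> k) (\<rho> h v)" for k :: nat
    using G.group_commutes_pow[OF gh(3), of k] gh v by (simp flip: act_mult)
  then have "ip V (\<rho> (g [^]\<^bsub>G\<^esub> k) v) (\<rho> (inv\<^bsub>G\<^esub> h) y) = ip V (\<rho> (g [^]\<^bsub>G\<^esub> k) (\<rho> h v)) y" for k :: nat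
    using act_adj[of h "\<rho> (g [^]\<^bsub>G\<^esub> k) v" y] gh v y by simp
  then show "ip V (\<rho> h (avg p g v)) y = ip V (avg p g (\<rho> h v)) y"
    using gh v y by (simp add: act_adj[of h "avg p g v"] ip_avg_left)
qed (use gh v in auto)

text \<open>
  For the projection \<open>1 - P\<close> one has \<open>\<parallel>v - P v\<parallel>\<^sup>2 = \<langle>v - P v, v\<rangle>\<close>, the mean of the numbers
  \<open>\<langle>v - g\<^sup>k v, v\<rangle>\<close>.
\<close>

lemma hnorm_diff_avg_le:
  assumes p: "0 < p" and g: "g \<in> carrier G" "g [^]\<^bsub>G\<^esub> p = \<one>\<^bsub>G\<^esub>" and v: "v \<in> carrier V"
    and small: "\<And>k. k < p \<Longrightarrow> hnorm V (\<rho> (g [^]\<^bsub>G\<^esub> k) v \<ominus> v) \<le> \<epsilon> * hnorm V v"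
  shows "(hnorm V (v \<ominus> avg p g v))\<^sup>2 \<le> \<epsilon> * (hnorm V v)\<^sup>2"
proof -
  have "(hnorm V (v \<ominus> avg p g v))\<^sup>2 = Re (ip V (v \<ominus> avg p g v) v)"
    using projection_ip_self[OF projection_complement[OF projection_avg[OF p g]] v] by simp
  also have "ip V (v \<ominus> avg p g v) v = (\<Sum>k<p. ip V v v - ip V (\<rho> (g [^]\<^bsub>G\<^esub> k) v) v) / of_nat p"
    using p g v by (simp add: ip_diff_left ip_avg_left sum_subtractf diff_divide_distrib)
  also have "Re \<dots> = (\<Sum>k<p. Re (ip V (v \<ominus> \<rho> (g [^]\<^bsub>G\<^esub> k) v) v)) / p"
    using g v by (simp add: ip_diff_left sum_subtractf)
  also have "\<dots> \<le> (\<Sum>k<p. \<epsilon> * (hnorm V v)\<^sup>2) / p"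
  proof (intro divide_right_mono sum_mono)
    fix k assume "k \<in> {..<p}"
    then have "hnorm V (v \<ominus> \<rho> (g [^]\<^bsub>G\<^esub> k) v) \<le> \<epsilon> * hnorm V v"
      using small[of k] hnorm_minus_commute[of v "\<rho> (g [^]\<^bsub>G\<^esub> k) v"] g v by simp
    then have "hnorm V (v \<ominus> \<rho> (g [^]\<^bsub>G\<^esub> k) v) * hnorm V v \<le> \<epsilon> * hnorm V v * hnorm V v"
      using hnorm_ge_0[OF v] by (rule mult_right_mono)
    moreover have "Re (ip V (v \<ominus> \<rho> (g [^]\<^bsub>G\<^esub> k) v) v) \<le> hnorm V (v \<ominus> \<rho> (g [^]\<^bsub>G\<^esub> k) v) * hnorm V v"
      using g v by (intro Re_ip_le) auto
    ultimately show "Re (ip V (v \<ominus> \<rho> (g [^]\<^bsub>G\<^esub> k) v) v) \<le> \<epsilon> * (hnorm V v)\<^sup>2"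
      by (simp add: power2_eq_square)
  qed auto
  also have "\<dots> = \<epsilon> * (hnorm V v)\<^sup>2" using p by simp
  finally show ?thesis .
qed

end

section \<open>The angle in representations of the Heisenberg group\<close>

context unitary_rep
begin

text \<open>
  Let \<open>A\<close>, \<open>B\<close> and \<open>R\<close> be the projections onto the vectors fixed by \<open>a\<close>, \<open>b\<close> and \<open>c = [a, b]\<close>.  As
  \<open>c\<close> commutes with \<open>a\<close> and \<open>b\<close>, the projection \<open>R\<close> commutes with \<open>A\<close> and \<open>B\<close>, and the two sides of
  the inequality split along \<open>v = u + w\<close> with \<open>u = R v\<close>.  On \<open>u\<close> the operators \<open>a\<close> and \<open>b\<close> commute, so
  \<open>\<langle>(1 - A) u, (1 - B) u\<rangle> = \<parallel>(1 - A)(1 - B) u\<parallel>\<^sup>2 \<ge> 0\<close>.  For \<open>w\<close> put \<open>z = B w\<close>.  The relation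
  \<open>a\<^sup>s b\<^sup>t = b\<^sup>t a\<^sup>s c\<^sup>s\<^sup>t\<close> and \<open>b z = z\<close> give \<open>\<langle>a\<^sup>s z, z\<rangle> = \<langle>a\<^sup>s c\<^sup>s\<^sup>t z, z\<rangle>\<close> for all \<open>t\<close>.  If \<open>p\<close>
  does not divide \<open>s\<close>, then \<open>s t\<close> runs through all residues, and averaging over them gives
  \<open>\<langle>a\<^sup>s z, z\<rangle> = \<langle>a\<^sup>s R z, z\<rangle> = 0\<close>.  Only \<open>s = 0\<close> contributes to \<open>\<langle>A z, z\<rangle>\<close>, so
  \<open>\<parallel>A B w\<parallel>\<^sup>2 = \<parallel>B w\<parallel>\<^sup>2 / p\<close>; this is the angle between the two ranges.
\<close>

lemma heisenberg_pair_bound: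
  fixes a b :: 'g and p :: nat
  defines "c \<equiv> commutator G a b"
  assumes p: "prime p" and ab: "a \<in> carrier G" "b \<in> carrier G"
    and ap: "a [^]\<^bsub>G\<^esub> p = \<one>\<^bsub>G\<^esub>" and bp: "b [^]\<^bsub>G\<^esub> p = \<one>\<^bsub>G\<^esub>"
    and ca: "c \<otimes>\<^bsub>G\<^esub> a = a \<otimes>\<^bsub>G\<^esub> c" and cb: "c \<otimes>\<^bsub>G\<^esub> b = b \<otimes>\<^bsub>G\<^esub> c"
    and v: "v \<in> carrier V"
  shows "2 * Re (ip V (v \<ominus> avg p a v) (v \<ominus> avg p b v))
           \<ge> - (1 / sqrt p) * ((hnorm V (v \<ominus> avg p a v))\<^sup>2 + (hnorm V (v \<ominus> avg p b v))\<^sup>2)"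
proof -
  have p0: "0 < p" and p1: "1 < p" using p prime_gt_0_nat prime_gt_1_nat by auto
  have c: "c \<in> carrier G" using ab by (simp add: c_def commutator_def)
  have cp: "c [^]\<^bsub>G\<^esub> p = \<one>\<^bsub>G\<^esub>"
    using G.commutator_pow_eq_one[OF ab _ _ bp] ca cb by (simp add: c_def)
  define A where "A = avg p a"
  define B where "B = avg p b"
  define R where "R = avg p c"
  have A: "projection A" unfolding A_def by (rule projection_avg[OF p0 ab(1) ap])
  have B: "projection B" unfolding B_def by (rule projection_avg[OF p0 ab(2) bp])
  have R: "projection R" unfolding R_def by (rule projection_avg[OF p0 c cp])
  have Am [simp]: "A x \<in> carrier V" and Bm [simp]: "B x \<in> carrier V" and Rm [simp]: "R x \<in> carrier V"
    if "x \<in> carrier V" for x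
    using that A B R by (auto intro: projection_mem)
  have AR: "A (R x) = R (A x)" if x: "x \<in> carrier V" for x
    unfolding A_def
  proof (rule avg_commutes_projection[OF R ab(1) x])
    fix k :: nat
    show "\<rho> (a [^]\<^bsub>G\<^esub> k) (R x) = R (\<rho> (a [^]\<^bsub>G\<^esub> k) x)"
      unfolding R_def using G.group_commutes_pow[OF ca[symmetric], of k] ab c x by (intro act_avg_commute) simp_all
  qed
  have BR: "B (R x) = R (B x)" if x: "x \<in> carrier V" for x
    unfolding B_def
  proof (rule avg_commutes_projection[OF R ab(2) x])
    fix k :: nat
    show "\<rho> (b [^]\<^bsub>G\<^esub> k) (R x) = R (\<rho> (b [^]\<^bsub>G\<^esub> k) x)"
      unfolding R_def using G.group_commutes_pow[OF cb[symmetric], of k] ab c x by (intro act_avg_commute) simp_all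
  qed
  have heis: "\<rho> (a [^]\<^bsub>G\<^esub> k) (\<rho> (b [^]\<^bsub>G\<^esub> l) x) = \<rho> (b [^]\<^bsub>G\<^esub> l) (\<rho> (a [^]\<^bsub>G\<^esub> k) (\<rho> (c [^]\<^bsub>G\<^esub> (k * l)) x))"
    if "x \<in> carrier V" for x and k l :: nat
    using G.class2_pow_commute[OF ab, of k l] ca cb ab c that
    by (simp add: G.m_assoc flip: act_mult c_def)

  define u where "u = R v"
  define w where "w = v \<ominus> u"
  have u: "u \<in> carrier V" and w: "w \<in> carrier V" using v by (simp_all add: u_def w_def)
  have Rdiff: "R (x \<ominus> y) = R x \<ominus> R y" if "x \<in> carrier V" "y \<in> carrier V" for x y
    using that R by (intro ip_eqI) (auto simp: projection_adj[OF R] ip_diff_left)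
  have Adiff: "A (x \<ominus> y) = A x \<ominus> A y" if "x \<in> carrier V" "y \<in> carrier V" for x y
    using that by (intro ip_eqI) (auto simp: projection_adj[OF A] ip_diff_left)
  have Bdiff: "B (x \<ominus> y) = B x \<ominus> B y" if "x \<in> carrier V" "y \<in> carrier V" for x y
    using that by (intro ip_eqI) (auto simp: projection_adj[OF B] ip_diff_left)
  have Ru: "R u = u" using v projection_idem[OF R] by (simp add: u_def)
  have Rw: "R w = \<zero>"
    using v Ru u by (simp add: w_def Rdiff) (simp add: u_def a_minus_def r_neg)
  have cu: "\<rho> c u = u" unfolding u_def R_def by (rule act_avg[OF c cp v])
  have ip_split: "ip V (x \<oplus> x') (y \<oplus> y') = ip V x y + ip V x' y'"
    if "x \<in> carrier V" "x' \<in> carrier V" "y \<in> carrier V" "y' \<in> carrier V"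
      "R x = x" "R x' = \<zero>" "R y = y" "R y' = \<zero>" for x x' y y'
  proof -
    have "ip V x y' = 0"
      using that projection_adj[OF R, of x y'] by (simp add: ip_zero_right)
    moreover have "ip V x' y = 0"
      using that projection_adj[OF R, of x' y] by (simp add: ip_zero_left)
    ultimately show ?thesis using that by (simp add: ip_add_left ip_add_right)
  qed
  have QA: "v \<ominus> A v = (u \<ominus> A u) \<oplus> (w \<ominus> A w)"
    using u w v by (intro ip_eqI) (auto simp: ip_add_left ip_diff_left Adiff w_def)
  have QB: "v \<ominus> B v = (u \<ominus> B u) \<oplus> (w \<ominus> B w)"
    using u w v by (intro ip_eqI) (auto simp: ip_add_left ip_diff_left Bdiff w_def)
  have AB_zero: "A \<zero> = \<zero>" "B \<zero> = \<zero>"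
    by (auto intro!: ip_eqI simp: projection_adj[OF A] projection_adj[OF B] ip_zero_left)
  have RQ: "R (u \<ominus> A u) = u \<ominus> A u" "R (u \<ominus> B u) = u \<ominus> B u"
    "R (w \<ominus> A w) = \<zero>" "R (w \<ominus> B w) = \<zero>"
    using u w by (simp_all add: Rdiff Ru Rw AB_zero flip: AR BR)
      (simp_all add: a_minus_def)
  note Q_mem = minus_closed[OF u Am[OF u]] minus_closed[OF w Am[OF w]]
    minus_closed[OF u Bm[OF u]] minus_closed[OF w Bm[OF w]]
  have ip_v: "ip V (v \<ominus> A v) (v \<ominus> B v) = ip V (u \<ominus> A u) (u \<ominus> B u) + ip V (w \<ominus> A w) (w \<ominus> B w)"
    unfolding QA QB using RQ by (intro ip_split Q_mem)
  have norm_A: "(hnorm V (v \<ominus> A v))\<^sup>2 = (hnorm V (u \<ominus> A u))\<^sup>2 + (hnorm V (w \<ominus> A w))\<^sup>2"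
    unfolding QA using RQ Q_mem by (simp add: hnorm_sq ip_split)
  have norm_B: "(hnorm V (v \<ominus> B v))\<^sup>2 = (hnorm V (u \<ominus> B u))\<^sup>2 + (hnorm V (w \<ominus> B w))\<^sup>2"
    unfolding QB using RQ Q_mem by (simp add: hnorm_sq ip_split)

  \<comment> \<open>The component fixed by the centre: \<open>A\<close> and \<open>B\<close> commute on \<open>u\<close>, since \<open>c u = u\<close>.\<close>
  have "A (B u) = B (A u)"
    unfolding A_def
  proof (rule avg_commutes_projection[OF B ab(1) u])
    fix k :: nat
    show "\<rho> (a [^]\<^bsub>G\<^esub> k) (B u) = B (\<rho> (a [^]\<^bsub>G\<^esub> k) u)"
    proof (rule ip_eqI)
      fix y assume y: "y \<in> carrier V"
      have "ip V (\<rho> (a [^]\<^bsub>G\<^esub> k) (B u)) y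
          = (\<Sum>l<p. ip V (\<rho> (a [^]\<^bsub>G\<^esub> k) (\<rho> (b [^]\<^bsub>G\<^esub> l) u)) y) / of_nat p"
        using ab u y by (simp add: act_adj[of "a [^]\<^bsub>G\<^esub> k"] B_def ip_avg_left)
      also have "\<dots> = ip V (B (\<rho> (a [^]\<^bsub>G\<^esub> k) u)) y"
        using ab u y act_pow_fixed[OF c u cu] by (simp add: heis B_def ip_avg_left)
      finally show "ip V (\<rho> (a [^]\<^bsub>G\<^esub> k) (B u)) y = ip V (B (\<rho> (a [^]\<^bsub>G\<^esub> k) u)) y" .
    qed (use ab u in auto)
  qed
  then have AB: "A (B u) = B (A u)" "A (B (A u)) = B (A u)"
    using u by (metis, metis projection_idem[OF A] Bm)
  define y where "y = u \<ominus> A u \<ominus> (B u \<ominus> B (A u))"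
  have "ip V (u \<ominus> A u) (u \<ominus> B u) = ip V y y"
    using u AB by (simp add: y_def ip_diff_left ip_diff_right projection_adj[OF A] projection_adj[OF B]
        projection_idem[OF A] projection_idem[OF B])
  then have pos: "0 \<le> Re (ip V (u \<ominus> A u) (u \<ominus> B u))"
    using u by (simp add: y_def ip_nonneg)

  \<comment> \<open>The component without vectors fixed by the centre.\<close>
  define z where "z = B w"
  have z: "z \<in> carrier V" using w by (simp add: z_def)
  have Rz: "R z = \<zero>" using w by (simp add: z_def Rw AB_zero flip: BR)
  have bz: "\<rho> b z = z" unfolding z_def B_def by (rule act_avg[OF ab(2) bp w])
  have orth: "ip V (\<rho> (a [^]\<^bsub>G\<^esub> s) z) z = 0" if s: "0 < s" "s < p" for s :: nat
  proof -
    have "coprime s p"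
      using p s by (metis coprime_commute prime_imp_coprime nat_dvd_not_less)
    \<comment> \<open>With \<open>t\<close> inverse to \<open>s\<close> modulo \<open>p\<close>, the exponent \<open>t k\<close> of \<open>b\<close> produces \<open>c\<^sup>k\<close>, for any \<open>k\<close>.\<close>
    then obtain t where t: "[s * t = 1] (mod p)"
      using cong_solve_coprime_nat by auto
    have "ip V (\<rho> (c [^]\<^bsub>G\<^esub> k) z) (\<rho> (inv\<^bsub>G\<^esub> (a [^]\<^bsub>G\<^esub> s)) z) = ip V (\<rho> (a [^]\<^bsub>G\<^esub> s) z) z" for k :: nat
    proof -
      have "[s * (t * k) = k] (mod p)"
        using cong_scalar_right[OF t, of k] by (simp add: mult.assoc)
      then have ck: "c [^]\<^bsub>G\<^esub> (s * (t * k)) = c [^]\<^bsub>G\<^esub> k"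
        by (rule G.pow_cong_of_torsion[OF c cp])
      have "ip V (\<rho> (a [^]\<^bsub>G\<^esub> s) z) z = ip V (\<rho> (a [^]\<^bsub>G\<^esub> s) (\<rho> (b [^]\<^bsub>G\<^esub> (t * k)) z)) z"
        using act_pow_fixed[OF ab(2) z bz] by simp
      also have "\<dots> = ip V (\<rho> (b [^]\<^bsub>G\<^esub> (t * k)) (\<rho> (a [^]\<^bsub>G\<^esub> s) (\<rho> (c [^]\<^bsub>G\<^esub> k) z))) (\<rho> (b [^]\<^bsub>G\<^esub> (t * k)) z)"
        unfolding heis[OF z] ck by (simp only: act_pow_fixed[OF ab(2) z bz])
      also have "\<dots> = ip V (\<rho> (a [^]\<^bsub>G\<^esub> s) (\<rho> (c [^]\<^bsub>G\<^esub> k) z)) z"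
        using ab c z by (intro act_ip) auto
      also have "\<dots> = ip V (\<rho> (c [^]\<^bsub>G\<^esub> k) z) (\<rho> (inv\<^bsub>G\<^esub> (a [^]\<^bsub>G\<^esub> s)) z)"
        using ab c z by (intro act_adj) auto
      finally show ?thesis by simp
    qed
    then have "ip V (R z) (\<rho> (inv\<^bsub>G\<^esub> (a [^]\<^bsub>G\<^esub> s)) z) = ip V (\<rho> (a [^]\<^bsub>G\<^esub> s) z) z"
      using c ab z p0 by (simp add: R_def ip_avg_left)
    then show ?thesis using ab z by (simp add: Rz ip_zero_left)
  qed
  have "ip V (A z) z = (\<Sum>s<p. ip V (\<rho> (a [^]\<^bsub>G\<^esub> s) z) z) / of_nat p"
    unfolding A_def using ab z by (simp add: ip_avg_left)
  also have "(\<Sum>s<p. ip V (\<rho> (a [^]\<^bsub>G\<^esub> s) z) z) = (\<Sum>s\<in>{0::nat}. ip V (\<rho> (a [^]\<^bsub>G\<^esub> s) z) z)"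
    using p0 orth by (intro sum.mono_neutral_right) auto
  finally have "Re (ip V (A z) z) = (hnorm V z)\<^sup>2 / p"
    using z by (simp add: hnorm_sq)
  then have "(hnorm V (A z))\<^sup>2 = (hnorm V z)\<^sup>2 / p"
    using projection_ip_self[OF A z] by simp
  then have Az: "hnorm V (A z) = hnorm V z / sqrt p"
    using z by (metis real_sqrt_divide real_sqrt_unique hnorm_ge_0 Am)
  have "Re (ip V (A w) (B w)) = Re (ip V (A w) (A z))"
    using w z by (metis z_def projection_adj[OF A] projection_idem[OF A] Am)
  also have "\<dots> \<le> hnorm V (A w) * (hnorm V z / sqrt p)"
    using Re_ip_le[of "A w" "A z"] w z Az by simp
  finally have "2 * Re (ip V (A w) (B w)) \<le> (1 / sqrt p) * (2 * (hnorm V (A w) * hnorm V (B w)))"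
    by (simp add: z_def)
  also have "\<dots> \<le> (1 / sqrt p) * ((hnorm V (A w))\<^sup>2 + (hnorm V (B w))\<^sup>2)"
    using sum_squares_bound[of "hnorm V (A w)" "hnorm V (B w)"]
    by (intro mult_left_mono) (simp_all add: mult.assoc)
  finally have "2 * Re (ip V (w \<ominus> A w) (w \<ominus> B w))
      \<ge> - (1 / sqrt p) * ((hnorm V (w \<ominus> A w))\<^sup>2 + (hnorm V (w \<ominus> B w))\<^sup>2)"
    using p1 by (intro complement_pair_lower_bound[OF A B w]) auto
  moreover have "0 \<le> (1 / sqrt p) * ((hnorm V (u \<ominus> A u))\<^sup>2 + (hnorm V (u \<ominus> B u))\<^sup>2)"
    by simp
  ultimately show ?thesis
    using pos unfolding A_def[symmetric] B_def[symmetric] ip_v norm_A norm_B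
    by (simp only: mult_minus_left plus_complex.simps distrib_left)
qed

end

section \<open>Property (T) for groups generated by pairwise Heisenberg generators\<close>

text \<open>
  Each pair of generators generates a quotient of the Heisenberg group modulo \<open>p\<close>.
\<close>

locale class2_torsion_generated = group G for G (structure) +
  fixes p :: nat and I :: "nat set" and a :: "nat \<Rightarrow> 'a"
  assumes gen_mem: "i \<in> I \<Longrightarrow> a i \<in> carrier G"
    and gen_pow: "i \<in> I \<Longrightarrow> a i [^] p = \<one>"
    and gen_central: "\<lbrakk>i \<in> I; j \<in> I; i \<noteq> j; k \<in> {i, j}\<rbrakk> \<Longrightarrow>
      commutator G (a i) (a j) \<otimes> a k = a k \<otimes> commutator G (a i) (a j)"
    and gen_generate: "generate G (a ` I) = carrier G"
begin

text \<open>
  By \<open>heisenberg_pair_bound\<close> and \<open>sum_norm_lower_bound\<close> the Laplacian has the gap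
  \<open>\<mu> = 1 - (d - 1)/\<surd>p\<close>.  The Kazhdan set consists of the powers of the generators.  With
  \<open>\<eta> = 1 - \<surd>(1 - \<mu>/d)\<close>, the reciprocal of the constant in \<open>norm_le_of_laplacian_gap\<close>, a vector that
  all of these elements move by at most \<open>\<epsilon> \<parallel>v\<parallel>\<close> has energy at most \<open>d \<epsilon> \<parallel>v\<parallel>\<^sup>2\<close>, so that
  \<open>\<parallel>v\<parallel> \<le> \<surd>(d \<epsilon>) \<parallel>v\<parallel> / \<eta>\<close>.  The choice of \<open>\<epsilon>\<close> makes the factor equal to \<open>1/2\<close>.
\<close>

theorem property_T:
  assumes p: "prime p" and I: "finite I" "I \<noteq> {}" and large: "(card I - 1)\<^sup>2 < p"
  shows "property_T G"
proof -
  define d where "d = real (card I)"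
  have d1: "1 \<le> d" using I by (simp add: d_def Suc_le_eq card_gt_0_iff)
  have p0: "0 < p" using p prime_gt_0_nat by auto
  define \<mu> where "\<mu> = 1 - (d - 1) * (1 / sqrt p)"
  have "(d - 1)\<^sup>2 < p"
  proof -
    have "d - 1 = real (card I - 1)" using d1 by (simp add: d_def)
    then show ?thesis using large by (metis of_nat_less_iff of_nat_power)
  qed
  then have "d - 1 < sqrt p" by (rule real_less_rsqrt)
  then have "0 < \<mu>" using p0 by (simp add: \<mu>_def field_simps)
  moreover have "0 \<le> (d - 1) * (1 / sqrt p)" using d1 by simp
  then have "\<mu> \<le> d" using d1 by (simp only: \<mu>_def)
  ultimately have \<mu>: "0 < \<mu>" "\<mu> \<le> d" by simp_all
  define \<eta> where "\<eta> = 1 - sqrt (1 - \<mu> / d)"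
  have \<eta>: "0 < \<eta>" using \<mu> d1 by (simp add: \<eta>_def)
  define \<epsilon> where "\<epsilon> = \<eta>\<^sup>2 / (4 * d)"
  have \<epsilon>: "0 < \<epsilon>" using \<eta> d1 by (simp add: \<epsilon>_def)
  define S where "S = (\<lambda>(i, k). a i [^] k) ` (I \<times> {..<p})"
  have S: "finite S" "S \<subseteq> carrier G" using I gen_mem by (auto simp: S_def)
  have "kazhdan_pair TYPE('a \<Rightarrow> complex) G S \<epsilon>"
    unfolding kazhdan_pair_def
  proof (intro allI impI ballI)
    fix V :: "('a \<Rightarrow> complex) hilbert" and \<rho> v
    assume V: "complex_hilbert_space V" and rep: "unitary_representation G V \<rho>"
      and noinv: "\<not> has_nonzero_invariant G V \<rho>" and v: "v \<in> carrier V" "v \<noteq> \<zero>\<^bsub>V\<^esub>"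
    interpret V: unitary_rep V G \<rho>
      using V rep group_axioms by (simp add: unitary_rep_def unitary_rep_axioms_def)
    define Q where "Q i x = x \<ominus>\<^bsub>V\<^esub> V.avg p (a i) x" for i x
    have Q: "V.projection (Q i)" if "i \<in> I" for i
      unfolding Q_def using that p0 gen_mem gen_pow
      by (intro V.projection_complement V.projection_avg)
    show "\<exists>s\<in>S. hnorm V (\<rho> s v \<ominus>\<^bsub>V\<^esub> v) > \<epsilon> * hnorm V v"
    proof (rule ccontr)
      assume "\<not> (\<exists>s\<in>S. hnorm V (\<rho> s v \<ominus>\<^bsub>V\<^esub> v) > \<epsilon> * hnorm V v)"
      then have small: "hnorm V (\<rho> (a i [^] k) v \<ominus>\<^bsub>V\<^esub> v) \<le> \<epsilon> * hnorm V v" if "i \<in> I" "k < p" for i k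
        using that by (force simp: S_def)
      have "(\<Sum>i\<in>I. (hnorm V (Q i v))\<^sup>2) \<le> (\<Sum>i\<in>I. \<epsilon> * (hnorm V v)\<^sup>2)"
        unfolding Q_def using p0 gen_mem gen_pow v small
        by (intro sum_mono V.hnorm_diff_avg_le) auto
      also have "\<dots> = (\<eta> * hnorm V v / 2)\<^sup>2"
        using d1 by (simp add: d_def[symmetric] \<epsilon>_def power_mult_distrib power_divide)
      finally have "sqrt (\<Sum>i\<in>I. (hnorm V (Q i v))\<^sup>2) \<le> \<eta> * hnorm V v / 2"
        using \<eta> V.hnorm_ge_0[OF v(1)] by (intro real_le_lsqrt) auto
      moreover have "hnorm V v \<le> sqrt (\<Sum>i\<in>I. (hnorm V (Q i v))\<^sup>2) / \<eta>"
        unfolding \<eta>_def d_def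
      proof (rule V.norm_le_of_laplacian_gap[OF I Q])
        show "0 < \<mu>" "\<mu> \<le> real (card I)" using \<mu> by (simp_all add: d_def)
        show "\<mu> * (\<Sum>i\<in>I. (hnorm V (Q i x))\<^sup>2) \<le> (hnorm V (\<Oplus>\<^bsub>V\<^esub>i\<in>I. Q i x))\<^sup>2"
          if x: "x \<in> carrier V" for x
          unfolding \<mu>_def d_def
        proof (rule V.sum_norm_lower_bound[OF I(1)])
          fix i j assume "i \<in> I" "j \<in> I" "i \<noteq> j"
          then show "2 * Re (ip V (Q i x) (Q j x)) \<ge>
              - (1 / sqrt p) * ((hnorm V (Q i x))\<^sup>2 + (hnorm V (Q j x))\<^sup>2)"
            unfolding Q_def using p gen_mem gen_pow gen_central x
            by (intro V.heisenberg_pair_bound) auto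
        qed (use Q x V.projection_mem in auto)
        show "x = \<zero>\<^bsub>V\<^esub>" if x: "x \<in> carrier V" and Q0: "\<And>i. i \<in> I \<Longrightarrow> Q i x = \<zero>\<^bsub>V\<^esub>" for x
        proof -
          have fixed: "\<rho> (a i) x = x" if i: "i \<in> I" for i
          proof -
            have "x \<ominus>\<^bsub>V\<^esub> V.avg p (a i) x = \<zero>\<^bsub>V\<^esub>"
              using Q0[OF i] by (simp only: Q_def)
            then have "x = V.avg p (a i) x"
              by (rule V.minus_eq_zeroD[OF x V.avg_mem[OF gen_mem[OF i] x]])
            then show ?thesis
              using V.act_avg[OF gen_mem[OF i] gen_pow[OF i] x] by simp
          qed
          have "\<rho> g x = x" if "g \<in> generate G (a ` I)" for g
            using that
          proof (induction rule: generate.induct)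
            case (inv h)
            then obtain i where i: "h = a i" "i \<in> I" by auto
            then have "\<rho> (inv h) (\<rho> h x) = x"
              using x gen_mem by (simp flip: V.act_mult)
            then show ?case using i fixed by simp
          next
            case (eng h1 h2)
            then show ?case
              using x by (simp add: V.act_mult gen_generate)
          qed (use x fixed in auto)
          then show ?thesis
            using noinv x unfolding has_nonzero_invariant_def gen_generate by blast
        qed
        show "v \<in> carrier V" by (rule v(1))
      qed
      ultimately have "hnorm V v \<le> (\<eta> * hnorm V v / 2) / \<eta>"
        using \<eta> by (meson divide_right_mono less_imp_le order_trans)
      then have "hnorm V v \<le> 0" using \<eta> by simp
      then show False
        using v V.hnorm_eq_0D[OF v(1)] V.hnorm_ge_0[OF v(1)] by simp
    qed
  qed
  with S \<epsilon> show ?thesis unfolding property_T_def by blast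
qed

end

section \<open>Homomorphisms out of presented groups\<close>

lemma hom_eqI_generate:
  assumes "group G" "group H" "f \<in> hom G H" "g \<in> hom G H" "S \<subseteq> carrier G"
    and eq: "\<And>s. s \<in> S \<Longrightarrow> f s = g s" and x: "x \<in> generate G S"
  shows "f x = g x"
proof -
  interpret f: group_hom G H f using assms by (simp add: group_hom_def group_hom_axioms_def)
  interpret g: group_hom G H g using assms by (simp add: group_hom_def group_hom_axioms_def)
  have "generate G S \<subseteq> carrier G" using assms f.G.generate_incl by blast
  with x show ?thesis
    by (induction x rule: generate.induct) (use assms(5) eq in \<open>auto simp: subset_iff\<close>)
qed

text \<open>
  On each side the composite of the two homomorphisms fixes the generators, so it is the identity.
\<close>

lemma iso_of_inverse_on_generators:
  assumes G: "group G" "S \<subseteq> carrier G" "generate G S = carrier G"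
    and H: "group H" "T \<subseteq> carrier H" "generate H T = carrier H"
    and f: "f \<in> hom G H" "\<And>s. s \<in> S \<Longrightarrow> g (f s) = s"
    and g: "g \<in> hom H G" "\<And>t. t \<in> T \<Longrightarrow> f (g t) = t"
  shows "G \<cong> H"
proof -
  have id: "(\<lambda>x. x) \<in> hom K K" for K :: "('c, 'd) monoid_scheme" by (simp add: hom_def)
  have "(\<lambda>x. g (f x)) \<in> hom G G" "(\<lambda>y. f (g y)) \<in> hom H H"
    using hom_compose[OF f(1) g(1)] hom_compose[OF g(1) f(1)] by (simp_all add: comp_def)
  then have "g (f x) = x" "f (g y) = y" if "x \<in> carrier G" "y \<in> carrier H" for x y
    using hom_eqI_generate[OF G(1) G(1) _ _ G(2), of "\<lambda>x. g (f x)" "\<lambda>x. x" x]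
      hom_eqI_generate[OF H(1) H(1) _ _ H(2), of "\<lambda>y. f (g y)" "\<lambda>y. y" y]
      f(2) g(2) G(3) H(3) that id by (auto simp: hom_def)
  moreover have "\<exists>x. x \<in> carrier G" "\<exists>y. y \<in> carrier H"
    using G(1) H(1) group.is_monoid monoid.one_closed by blast+
  ultimately have "bij_betw f (carrier G) (carrier H)"
    using f(1) g(1) by (intro bij_betw_byWitness[where f' = g]) (auto simp: hom_def)
  then show ?thesis
    using f(1) by (auto simp: is_iso_def iso_def)
qed

text \<open>
  The homomorphism of the free group that extends \<open>\<phi>\<close>.  It is defined on all words, reduced or not,
  so that induction on words applies.
\<close>

definition eval_word :: "('g, 'b) monoid_scheme \<Rightarrow> ('x \<Rightarrow> 'g) \<Rightarrow> 'x fword \<Rightarrow> 'g" where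
  "eval_word H \<phi> w =
    foldr (\<lambda>a h. (if snd a then \<phi> (fst a) else inv\<^bsub>H\<^esub> (\<phi> (fst a))) \<otimes>\<^bsub>H\<^esub> h) w \<one>\<^bsub>H\<^esub>"

lemma eval_word_simps [simp]:
  "eval_word H \<phi> [] = \<one>\<^bsub>H\<^esub>"
  "eval_word H \<phi> (a # w) =
    (if snd a then \<phi> (fst a) else inv\<^bsub>H\<^esub> (\<phi> (fst a))) \<otimes>\<^bsub>H\<^esub> eval_word H \<phi> w"
  by (simp_all add: eval_word_def)

lemma eval_word_closed:
  assumes "group H" "\<phi> \<in> X \<rightarrow> carrier H" "fst ` set w \<subseteq> X"
  shows "eval_word H \<phi> w \<in> carrier H"
proof -
  interpret group H by fact
  show ?thesis using assms(2,3) by (induction w) auto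
qed

text \<open>
  A cancelled pair of letters contributes \<open>h h\<^sup>-\<^sup>1\<close>; this is the only point at which reduction of words
  enters.
\<close>

lemma eval_word_push:
  assumes "group H" "\<phi> \<in> X \<rightarrow> carrier H" "fst ` set (a # w) \<subseteq> X"
  shows "eval_word H \<phi> (push a w) = eval_word H \<phi> (a # w)"
proof (cases "\<exists>v. w = letter_inv a # v")
  case True
  interpret group H by fact
  from True obtain v where w: "w = letter_inv a # v" by blast
  obtain x b where a: "a = (x, b)" by (cases a)
  show ?thesis
    using assms(2,3) eval_word_closed[OF assms(1,2), of v]
    by (cases b) (auto simp: w a m_assoc[symmetric] Pi_iff)
next
  case False
  then show ?thesis by (cases w) auto
qed

lemma hom_eval_word:
  assumes H: "group H" "\<phi> \<in> X \<rightarrow> carrier H"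
  shows "eval_word H \<phi> \<in> hom (free_group X) H"
proof (rule homI)
  fix u v assume u: "u \<in> carrier (free_group X)" and v: "v \<in> carrier (free_group X)"
  interpret group H by fact
  have v': "fst ` set v \<subseteq> X" and u': "fst ` set u \<subseteq> X" using u v by (auto simp: free_group_def)
  from u' have "eval_word H \<phi> (foldr push u v) = eval_word H \<phi> u \<otimes>\<^bsub>H\<^esub> eval_word H \<phi> v"
  proof (induction u)
    case (Cons a u)
    have uv: "fst ` set (foldr push u v) \<subseteq> X"
      using letters_foldr_push[of u v] v' Cons.prems by (simp add: subset_iff image_iff) blast
    have "eval_word H \<phi> (foldr push (a # u) v) = eval_word H \<phi> (a # foldr push u v)"
      using eval_word_push[OF H, of a "foldr push u v"] uv Cons.prems by simp
    then show ?case
      using Cons eval_word_closed[OF H v'] eval_word_closed[OF H, of u] H(2)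
      by (auto simp: m_assoc Pi_iff)
  qed (use eval_word_closed[OF H v'] in simp)
  then show "eval_word H \<phi> (u \<otimes>\<^bsub>free_group X\<^esub> v) = eval_word H \<phi> u \<otimes>\<^bsub>H\<^esub> eval_word H \<phi> v"
    by (simp add: free_group_def)
qed (use eval_word_closed[OF H] in \<open>auto simp: free_group_def\<close>)

lemma letter_in_free_group: "x \<in> X \<Longrightarrow> [(x, b)] \<in> carrier (free_group X)"
  by (simp add: free_group_def)

lemma inv_letter_free_group:
  assumes "x \<in> X"
  shows "inv\<^bsub>free_group X\<^esub> [(x, True)] = [(x, False)]"
proof -
  interpret group "free_group X" by (rule group_free_group)
  show ?thesis
    by (rule inv_equality) (use assms in \<open>auto simp: letter_in_free_group\<close>, simp add: free_group_def)
qed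

lemma generate_free_group: "generate (free_group X) ((\<lambda>x. [(x, True)]) ` X) = carrier (free_group X)"
proof
  interpret group "free_group X" by (rule group_free_group)
  show "generate (free_group X) ((\<lambda>x. [(x, True)]) ` X) \<subseteq> carrier (free_group X)"
    by (rule generate_incl) (auto simp: letter_in_free_group)
  show "carrier (free_group X) \<subseteq> generate (free_group X) ((\<lambda>x. [(x, True)]) ` X)"
  proof
    fix w assume "w \<in> carrier (free_group X)"
    then have w: "freely_reduced w" "fst ` set w \<subseteq> X" by (auto simp: free_group_def)
    then show "w \<in> generate (free_group X) ((\<lambda>x. [(x, True)]) ` X)"
    proof (induction w)
      case Nil
      then show ?case using generate.one[of "free_group X"] by (simp add: free_group_def)
    next
      case (Cons a w)
      obtain x b where a: "a = (x, b)" by (cases a)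
      have x: "x \<in> X" using Cons.prems a by simp
      have "push a w = a # w" using Cons.prems(1) by (cases w) auto
      then have "a # w = [a] \<otimes>\<^bsub>free_group X\<^esub> w"
        by (simp add: free_group_def)
      moreover have "[a] \<in> generate (free_group X) ((\<lambda>x. [(x, True)]) ` X)"
        using generate.incl[of "[(x, True)]" "(\<lambda>x. [(x, True)]) ` X" "free_group X"]
          generate.inv[of "[(x, True)]" "(\<lambda>x. [(x, True)]) ` X" "free_group X"] x
        by (cases b) (auto simp: a inv_letter_free_group)
      moreover have "w \<in> generate (free_group X) ((\<lambda>x. [(x, True)]) ` X)"
        using Cons.prems freely_reduced_ConsD[of a w] by (intro Cons.IH) auto
      ultimately show ?case by (simp add: generate.eng)
    qed
  qed
qed

lemma normal_normal_closure:
  assumes "group G" "A \<subseteq> carrier G"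
  shows "normal_closure G A \<lhd> G"
proof -
  interpret group G by fact
  have "carrier G \<in> {N. N \<lhd> G \<and> A \<subseteq> N}"
    using assms normal_self by auto
  then have ne: "{N. N \<lhd> G \<and> A \<subseteq> N} \<noteq> {}" by blast
  have "subgroup (normal_closure G A) G"
    unfolding normal_closure_def
    using ne by (intro subgroups_Inter) (auto intro: normal_imp_subgroup)
  moreover have "x \<otimes>\<^bsub>G\<^esub> h \<otimes>\<^bsub>G\<^esub> inv\<^bsub>G\<^esub> x \<in> normal_closure G A"
    if "x \<in> carrier G" "h \<in> normal_closure G A" for x h
    using that by (auto simp: normal_closure_def normal.inv_op_closed2)
  ultimately show ?thesis by (simp add: normal_inv_iff)
qed

locale presentation =
  fixes X :: "'x set" and Rel :: "'x fword set"
  assumes Rel: "Rel \<subseteq> carrier (free_group X)"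
begin

definition word_class :: "'x fword \<Rightarrow> 'x fword set" where
  "word_class w = normal_closure (free_group X) Rel #>\<^bsub>free_group X\<^esub> w"

definition gen :: "'x \<Rightarrow> 'x fword set" where
  "gen x = word_class [(x, True)]"

lemma normal: "normal_closure (free_group X) Rel \<lhd> free_group X"
  using normal_normal_closure[OF group_free_group Rel] .

lemma group_presented: "group (presented_group X Rel)"
  unfolding presented_group_def by (rule normal.factorgroup_is_group[OF normal])

lemma hom_word_class: "word_class \<in> hom (free_group X) (presented_group X Rel)"
  unfolding presented_group_def word_class_def[abs_def] by (rule normal.r_coset_hom_Mod[OF normal])

interpretation word_class: group_hom "free_group X" "presented_group X Rel" word_class
  using group_presented hom_word_class group_free_group by (simp add: group_hom_def group_hom_axioms_def)

lemma word_class_relator: "r \<in> Rel \<Longrightarrow> word_class r = \<one>\<^bsub>presented_group X Rel\<^esub>"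
proof -
  assume "r \<in> Rel"
  then have "r \<in> normal_closure (free_group X) Rel" by (auto simp: normal_closure_def)
  moreover have "subgroup (normal_closure (free_group X) Rel) (free_group X)"
    using normal by (rule normal_imp_subgroup)
  ultimately show ?thesis
    by (simp add: word_class_def presented_group_def group_free_group group.coset_join2
        subgroup.mem_carrier)
qed

lemma gen_mem: "x \<in> X \<Longrightarrow> gen x \<in> carrier (presented_group X Rel)"
  by (simp add: gen_def letter_in_free_group)

lemma generate_gen: "generate (presented_group X Rel) (gen ` X) = carrier (presented_group X Rel)"
proof -
  have "gen ` X = word_class ` (\<lambda>x. [(x, True)]) ` X"
    by (auto simp: gen_def)
  moreover have "(\<lambda>x. [(x, True)]) ` X \<subseteq> carrier (free_group X)"
    by (auto simp: letter_in_free_group)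
  ultimately have "generate (presented_group X Rel) (gen ` X) = word_class ` carrier (free_group X)"
    using word_class.generate_img generate_free_group by metis
  also have "\<dots> = carrier (presented_group X Rel)"
    by (simp add: presented_group_def carrier_FactGroup word_class_def[abs_def])
  finally show ?thesis .
qed

theorem universal_property:
  assumes H: "group H" "\<phi> \<in> X \<rightarrow> carrier H" and rel: "\<And>r. r \<in> Rel \<Longrightarrow> eval_word H \<phi> r = \<one>\<^bsub>H\<^esub>"
  shows "\<exists>f \<in> hom (presented_group X Rel) H. \<forall>x\<in>X. f (gen x) = \<phi> x"
proof -
  interpret eval: group_hom "free_group X" H "eval_word H \<phi>"
    using H hom_eval_word[OF H] group_free_group by (simp add: group_hom_def group_hom_axioms_def)
  have "normal_closure (free_group X) Rel \<subseteq> kernel (free_group X) H (eval_word H \<phi>)"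
    unfolding normal_closure_def using eval.normal_kernel Rel rel
    by (intro Inter_lower) (auto simp: kernel_def)
  then obtain f where f: "f \<in> hom (presented_group X Rel) H"
      "\<And>w. w \<in> carrier (free_group X) \<Longrightarrow> f (word_class w) = eval_word H \<phi> w"
    using eval.FactGroup_universal_kernel[OF normal] unfolding presented_group_def word_class_def by metis
  have "f (gen x) = \<phi> x" if "x \<in> X" for x
    using f(2)[OF letter_in_free_group[OF that]] that H(2) monoid.r_one[OF group.is_monoid[OF H(1)], of "\<phi> x"]
    by (auto simp: gen_def Pi_iff)
  with f(1) show ?thesis by blast
qed

end

section \<open>The Kac-Moody-Steinberg group of a complete graph over a prime field\<close>

context class2_torsion_generated
begin

lemma gen_pow_central:
  assumes "i \<in> I" "j \<in> I" "i \<noteq> j" "k \<in> {i, j}"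
  shows "commutator G (a i [^] (r::nat)) (a j [^] (s::nat)) \<otimes> a k [^] (t::nat)
    = a k [^] t \<otimes> commutator G (a i [^] r) (a j [^] s)"
proof -
  have "commutator G (a i [^] r) (a j [^] s) = commutator G (a i) (a j) [^] (r * s)"
    using assms gen_mem gen_central by (intro commutator_pow_pow) auto
  then show ?thesis
    using assms gen_mem gen_central[OF assms] commutator_closed[OF is_group]
    by (auto intro!: pow_commutes)
qed

lemma gen_commutator_bilinear:
  assumes "i \<in> I" "j \<in> I" "i \<noteq> j" and rs: "[r * s = m] (mod p)"
  shows "commutator G (a i [^] (r::nat)) (a j [^] (s::nat)) = commutator G (a i) (a j [^] (m::nat))"
proof -
  let ?c = "commutator G (a i) (a j)"
  have c: "?c \<in> carrier G" using assms gen_mem commutator_closed[OF is_group] by simp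
  have "?c [^] p = \<one>"
    using assms gen_mem gen_central gen_pow by (intro commutator_pow_eq_one) auto
  then have "?c [^] (r * s) = ?c [^] m"
    using c rs by (intro pow_cong_of_torsion)
  moreover have "commutator G (a i [^] r) (a j [^] s) = ?c [^] (r * s)"
    using assms gen_mem gen_central by (intro commutator_pow_pow) auto
  moreover have "commutator G (a i [^] (1::nat)) (a j [^] m) = ?c [^] (1 * m)"
    using assms gen_mem gen_central by (intro commutator_pow_pow) auto
  ultimately show ?thesis using assms gen_mem by simp
qed

end

lemma presentation_kms: "presentation ({1..d} \<times> carrier R) (kms_relators d E R)"
  if R: "ring R"
proof -
  let ?X = "{1..d} \<times> carrier R"
  interpret R: ring R by fact
  interpret F: group "free_group ?X" by (rule group_free_group)
  have x: "kms_gen i r \<in> carrier (free_group ?X)" if "i \<in> {1..d}" "r \<in> carrier R" for i r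
    using that by (simp add: kms_gen_def letter_in_free_group)
  show ?thesis
    by standard
      (auto simp: kms_relators_def Let_def commutator_closed[OF F.is_group] x
        simp del: atLeastAtMost_iff One_nat_def)
qed

lemma kms_relators_cases [consumes 1, case_names add comm bilinear central]:
  fixes R (structure) and d :: nat
  defines "F \<equiv> free_group ({1..d} \<times> carrier R)"
  assumes w: "w \<in> kms_relators d E R"
  obtains
    i r s where "i \<in> {1..d}" "r \<in> carrier R" "s \<in> carrier R"
      "w = kms_gen i r \<otimes>\<^bsub>F\<^esub> kms_gen i s \<otimes>\<^bsub>F\<^esub> inv\<^bsub>F\<^esub> (kms_gen i (r \<oplus> s))"
  | i j r s where "i \<in> {1..d}" "j \<in> {1..d}" "{i, j} \<notin> E" "r \<in> carrier R" "s \<in> carrier R"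
      "w = commutator F (kms_gen i r) (kms_gen j s)"
  | i j r s where "i \<in> {1..d}" "j \<in> {1..d}" "{i, j} \<in> E" "r \<in> carrier R" "s \<in> carrier R"
      "w = commutator F (kms_gen i r) (kms_gen j s) \<otimes>\<^bsub>F\<^esub>
        inv\<^bsub>F\<^esub> (commutator F (kms_gen i \<one>) (kms_gen j (r \<otimes> s)))"
  | i j k r s t where "i \<in> {1..d}" "j \<in> {1..d}" "{i, j} \<in> E" "k \<in> {i, j}"
      "r \<in> carrier R" "s \<in> carrier R" "t \<in> carrier R"
      "w = commutator F (commutator F (kms_gen i r) (kms_gen j s)) (kms_gen k t)"
  using w unfolding kms_relators_def Let_def F_def[symmetric]
proof (elim UnE CollectE exE conjE, goal_cases)
  case 1
  then show ?case by (elim that(1)[rotated 3])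
next
  case 2
  then show ?case by (elim that(2)[rotated 5])
next
  case 3
  then show ?case by (elim that(3)[rotated 5])
next
  case 4
  then show ?case by (elim that(4)[rotated 7])
qed

lemma complete_graph_edges_iff:
  "i \<in> {1..d} \<Longrightarrow> j \<in> {1..d} \<Longrightarrow> {i, j} \<in> complete_graph_edges d \<longleftrightarrow> i \<noteq> j"
  by (auto simp: complete_graph_edges_def card_2_iff' card_insert_if)

text \<open>
  From here on the set of vertices \<open>{1..d}\<close> is part of the terms that denote groups; it has to keep
  this form under simplification.
\<close>

declare One_nat_def [simp del]

lemma residues_prime: "prime p \<Longrightarrow> residues (int p)"
  using prime_gt_1_nat[of p] by (simp add: residues_def)

locale kms_prime_field =
  fixes p d :: nat
  assumes p: "prime p"
begin

abbreviation "Fp \<equiv> residue_ring (int p)"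

abbreviation "kms_letters \<equiv> {1..d} \<times> carrier Fp"

interpretation Fp: residues "int p" Fp
  by (rule residues_prime[OF p]) simp

lemma Fp_carrier: "r \<in> carrier Fp \<longleftrightarrow> 0 \<le> r \<and> r < int p"
  by (auto simp: Fp.res_carrier_eq)

interpretation K: presentation kms_letters "kms_relators d (complete_graph_edges d) Fp"
  by (rule presentation_kms) (rule Fp.ring_axioms)

abbreviation "kms \<equiv> kms_group d (complete_graph_edges d) Fp"

lemma kms_presented: "kms = presented_group kms_letters (kms_relators d (complete_graph_edges d) Fp)"
  by (simp add: kms_group_def)

interpretation kms: group kms
  unfolding kms_presented by (rule K.group_presented)

definition root_elt :: "nat \<Rightarrow> int \<Rightarrow> (nat \<times> int) fword set" where
  "root_elt i r = K.gen (i, r)"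

interpretation F: group "free_group kms_letters"
  by (rule group_free_group)

interpretation q: group_hom "free_group kms_letters" kms K.word_class
  using kms.is_group K.hom_word_class group_free_group
  unfolding kms_presented by (simp add: group_hom_def group_hom_axioms_def)

lemma gen_in_F: "i \<in> {1..d} \<Longrightarrow> r \<in> carrier Fp \<Longrightarrow> kms_gen i r \<in> carrier (free_group kms_letters)"
  by (simp add: kms_gen_def letter_in_free_group)

lemma word_class_kms_gen: "K.word_class (kms_gen i r) = root_elt i r"
  by (simp add: root_elt_def K.gen_def kms_gen_def)

lemma root_mem: "i \<in> {1..d} \<Longrightarrow> r \<in> carrier Fp \<Longrightarrow> root_elt i r \<in> carrier kms"
  using q.hom_closed[OF gen_in_F] by (simp add: word_class_kms_gen)

lemma word_class_commutator:
  "u \<in> carrier (free_group kms_letters) \<Longrightarrow> v \<in> carrier (free_group kms_letters) \<Longrightarrow>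
    K.word_class (commutator (free_group kms_letters) u v) = commutator kms (K.word_class u) (K.word_class v)"
  using hom_commutator[OF group_free_group kms.is_group q.homh] .

lemma relator_trivial: "w \<in> kms_relators d (complete_graph_edges d) Fp \<Longrightarrow> K.word_class w = \<one>\<^bsub>kms\<^esub>"
  unfolding kms_presented by (rule K.word_class_relator)

lemma root_add:
  assumes "i \<in> {1..d}" "r \<in> carrier Fp" "s \<in> carrier Fp"
  shows "root_elt i r \<otimes>\<^bsub>kms\<^esub> root_elt i s = root_elt i (r \<oplus>\<^bsub>Fp\<^esub> s)"
proof -
  let ?F = "free_group kms_letters"
  have "kms_gen i r \<otimes>\<^bsub>?F\<^esub> kms_gen i s \<otimes>\<^bsub>?F\<^esub> inv\<^bsub>?F\<^esub> kms_gen i (r \<oplus>\<^bsub>Fp\<^esub> s)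
      \<in> kms_relators d (complete_graph_edges d) Fp"
    using assms unfolding kms_relators_def Let_def by blast
  from relator_trivial[OF this]
  have "root_elt i r \<otimes>\<^bsub>kms\<^esub> root_elt i s \<otimes>\<^bsub>kms\<^esub> inv\<^bsub>kms\<^esub> root_elt i (r \<oplus>\<^bsub>Fp\<^esub> s) = \<one>\<^bsub>kms\<^esub>"
    using assms gen_in_F by (simp add: word_class_kms_gen flip: kms_presented)
  then show ?thesis
    using assms root_mem by (metis kms.inv_equality kms.inv_inv kms.inv_closed kms.m_closed Fp.add.m_closed)
qed

lemma root_central:
  assumes "i \<in> {1..d}" "j \<in> {1..d}" "i \<noteq> j" "k \<in> {i, j}"
    "r \<in> carrier Fp" "s \<in> carrier Fp" "t \<in> carrier Fp"
  shows "commutator kms (root_elt i r) (root_elt j s) \<otimes>\<^bsub>kms\<^esub> root_elt k t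
    = root_elt k t \<otimes>\<^bsub>kms\<^esub> commutator kms (root_elt i r) (root_elt j s)"
proof -
  let ?F = "free_group kms_letters"
  have "{i, j} \<in> complete_graph_edges d" using assms complete_graph_edges_iff by blast
  then have "commutator ?F (commutator ?F (kms_gen i r) (kms_gen j s)) (kms_gen k t)
      \<in> kms_relators d (complete_graph_edges d) Fp"
    using assms unfolding kms_relators_def Let_def by blast
  from relator_trivial[OF this] show ?thesis
    using assms gen_in_F root_mem
    by (auto simp: word_class_kms_gen word_class_commutator kms.commutator_eq_one_iff
        commutator_closed[OF group_free_group] commutator_closed[OF kms.is_group])
qed

lemma root_pow:
  assumes i: "i \<in> {1..d}"
  shows "root_elt i 1 [^]\<^bsub>kms\<^esub> (n::nat) = root_elt i (int n mod int p)"
proof (induction n)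
  case 0
  have 0: "0 \<in> carrier Fp" using p prime_gt_0_nat[OF p] by (simp add: Fp_carrier)
  \<comment> \<open>An idempotent of a group is trivial.\<close>
  have "root_elt i 0 \<otimes>\<^bsub>kms\<^esub> root_elt i 0 = root_elt i 0"
    using root_add[OF i 0 0] by (simp add: Fp.res_add_eq)
  then have "root_elt i 0 = \<one>\<^bsub>kms\<^esub>"
    using root_mem[OF i 0] by simp
  then show ?case by simp
next
  case (Suc n)
  have "int n mod int p \<in> carrier Fp" "1 \<in> carrier Fp"
    using prime_gt_1_nat[OF p] by (simp_all add: Fp_carrier)
  then show ?case
    using Suc root_add[OF i, of "int n mod int p" 1] by (simp add: Fp.res_add_eq mod_simps add.commute)
qed

lemma root_eq_pow:
  assumes "i \<in> {1..d}" "r \<in> carrier Fp"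
  shows "root_elt i r = root_elt i 1 [^]\<^bsub>kms\<^esub> nat r"
  using root_pow[OF assms(1), of "nat r"] assms(2) by (simp add: Fp_carrier)

lemma one_Fp: "1 \<in> carrier Fp"
  using prime_gt_1_nat[OF p] by (simp add: Fp_carrier)

text \<open>
  Over a prime field the elements \<open>x\<^sub>i(1)\<close> suffice as generators, since \<open>x\<^sub>i(r)\<close> is the \<open>r\<close>-th power
  of \<open>x\<^sub>i(1)\<close>.
\<close>

theorem class2_torsion_generated: "class2_torsion_generated kms p {1..d} (\<lambda>i. root_elt i 1)"
proof (unfold_locales, goal_cases)
  case (1 i)
  then show ?case using root_mem one_Fp by blast
next
  case (2 i)
  then show ?case using root_pow[of i p] root_pow[of i 0] by simp
next
  case (3 i j k)
  then show ?case using root_central one_Fp by blast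
next
  case 4
  have "K.gen ` kms_letters \<subseteq> generate kms ((\<lambda>i. root_elt i 1) ` {1..d})"
  proof clarify
    fix i :: nat and r assume i: "i \<in> {1..d}" and r: "r \<in> carrier Fp"
    have "root_elt i 1 [^]\<^bsub>kms\<^esub> n \<in> generate kms ((\<lambda>i. root_elt i 1) ` {1..d})" for n :: nat
    proof (induction n)
      case (Suc n)
      have "root_elt i 1 \<in> generate kms ((\<lambda>i. root_elt i 1) ` {1..d})"
        using i by (intro generate.incl) blast
      then show ?case using generate.eng[OF Suc] by simp
    qed (simp add: generate.one)
    then show "K.gen (i, r) \<in> generate kms ((\<lambda>i. root_elt i 1) ` {1..d})"
      using root_eq_pow[OF i r] by (simp add: root_elt_def)
  qed
  moreover have "subgroup (generate kms ((\<lambda>i. root_elt i 1) ` {1..d})) kms"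
    using root_mem one_Fp by (intro kms.generate_is_subgroup) blast
  ultimately have "generate kms (K.gen ` kms_letters) \<subseteq> generate kms ((\<lambda>i. root_elt i 1) ` {1..d})"
    by (intro kms.generate_subgroup_incl)
  moreover have "generate kms ((\<lambda>i. root_elt i 1) ` {1..d}) \<subseteq> carrier kms"
    using root_mem one_Fp by (intro kms.generate_incl) blast
  ultimately show ?case
    using K.generate_gen by (simp add: kms_presented)
qed


end

section \<open>A presentation with one generator per vertex\<close>

text \<open>
  Only the pairs with \<open>i < j\<close> are used: as \<open>[a\<^sub>j, a\<^sub>i]\<close> is the inverse of \<open>[a\<^sub>i, a\<^sub>j]\<close>, the other order
  would add nothing.  Counting both orders would double the cubic term of the Golod-Shafarevich
  polynomial, which then fails to be negative for \<open>d = 6\<close>.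
\<close>

definition vertex_relators :: "nat \<Rightarrow> nat \<Rightarrow> nat fword set" where
  "vertex_relators d p =
    (let F = free_group {1..d}; x = (\<lambda>i. [(i, True)]) in
      {x i [^]\<^bsub>F\<^esub> p | i. i \<in> {1..d}}
    \<union> {commutator F (commutator F (x i) (x j)) (x k) | i j k.
         i \<in> {1..d} \<and> j \<in> {1..d} \<and> i < j \<and> k \<in> {i, j}})"

lemma presentation_vertex_relators: "presentation {1..d} (vertex_relators d p)"
proof -
  interpret F: group "free_group {1..d}" by (rule group_free_group)
  show ?thesis
    by standard
      (auto simp: vertex_relators_def Let_def commutator_closed[OF group_free_group] letter_in_free_group)
qed

lemma vertex_presentation_class2_torsion_generated:
  "class2_torsion_generated (presented_group {1..d} (vertex_relators d p)) p {1..d}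
     (presentation.gen {1..d} (vertex_relators d p))"
proof -
  interpret P: presentation "{1..d}" "vertex_relators d p" by (rule presentation_vertex_relators)
  let ?F = "free_group {1..d}" and ?G = "presented_group {1..d} (vertex_relators d p)"
  interpret G: group ?G by (rule P.group_presented)
  interpret w: group_hom ?F ?G P.word_class
    using G.is_group P.hom_word_class group_free_group by (simp add: group_hom_def group_hom_axioms_def)
  have x: "[(i, True)] \<in> carrier ?F" if "i \<in> {1..d}" for i
    using that by (rule letter_in_free_group)
  have comm: "P.word_class (commutator ?F u v) = commutator ?G (P.word_class u) (P.word_class v)"
    if "u \<in> carrier ?F" "v \<in> carrier ?F" for u v
    using hom_commutator[OF group_free_group G.is_group P.hom_word_class that] .
  have central: "commutator ?G (P.gen i) (P.gen j) \<otimes>\<^bsub>?G\<^esub> P.gen k = P.gen k \<otimes>\<^bsub>?G\<^esub> commutator ?G (P.gen i) (P.gen j)"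
    if ij: "i \<in> {1..d}" "j \<in> {1..d}" "i < j" and k: "k \<in> {i, j}" for i j k
  proof -
    have kd: "k \<in> {1..d}" using that by blast
    have "commutator ?F (commutator ?F [(i, True)] [(j, True)]) [(k, True)] \<in> vertex_relators d p"
      using that unfolding vertex_relators_def Let_def by blast
    from P.word_class_relator[OF this] show ?thesis
      using x[OF ij(1)] x[OF ij(2)] x[OF kd] P.gen_mem[OF ij(1)] P.gen_mem[OF ij(2)] P.gen_mem[OF kd]
      by (simp add: comm P.gen_def G.commutator_eq_one_iff commutator_closed[OF group_free_group]
          commutator_closed[OF G.is_group])
  qed
  show ?thesis
  proof (unfold_locales, goal_cases)
    case (1 i)
    then show ?case by (rule P.gen_mem)
  next
    case (2 i)
    have "[(i, True)] [^]\<^bsub>?F\<^esub> p \<in> vertex_relators d p"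
      using 2 unfolding vertex_relators_def Let_def by blast
    from P.word_class_relator[OF this] show ?case
      using x[OF 2] by (simp add: w.hom_nat_pow P.gen_def)
  next
    case (3 i j k)
    have kd: "k \<in> {1..d}" using 3 by blast
    show ?case
    proof (cases "i < j")
      case True
      then show ?thesis using central 3 by blast
    next
      case False
      then have "commutator ?G (P.gen j) (P.gen i) \<otimes>\<^bsub>?G\<^esub> P.gen k = P.gen k \<otimes>\<^bsub>?G\<^esub> commutator ?G (P.gen j) (P.gen i)"
        using central[of j i k] 3 by auto
      then have "inv\<^bsub>?G\<^esub> (commutator ?G (P.gen j) (P.gen i)) \<otimes>\<^bsub>?G\<^esub> P.gen k
          = P.gen k \<otimes>\<^bsub>?G\<^esub> inv\<^bsub>?G\<^esub> (commutator ?G (P.gen j) (P.gen i))"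
        using 3 kd P.gen_mem commutator_closed[OF G.is_group] by (intro G.inv_commutes) auto
      then show ?thesis using G.inv_commutator 3 P.gen_mem by metis
    qed
  next
    case 4
    show ?case by (rule P.generate_gen)
  qed
qed

text \<open>
  The homomorphisms \<open>a\<^sub>i \<mapsto> x\<^sub>i(1)\<close> and \<open>x\<^sub>i(r) \<mapsto> a\<^sub>i\<^sup>r\<close> are inverse to each other.  That the second one
  respects the relations is the content of \<open>gen_pow_central\<close> and \<open>gen_commutator_bilinear\<close>; exponents
  matter only modulo \<open>p\<close>.
\<close>

theorem vertex_presentation_iso_kms:
  assumes p: "prime p"
  shows "presented_group {1..d} (vertex_relators d p)
    \<cong> kms_group d (complete_graph_edges d) (residue_ring (int p))"
proof -
  let ?R = "residue_ring (int p)"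
  interpret kms: kms_prime_field p d by unfold_locales (rule p)
  interpret R: residues "int p" ?R by (rule residues_prime[OF p]) simp
  let ?X = "{1..d} \<times> carrier ?R" and ?Rel = "kms_relators d (complete_graph_edges d) ?R"
  let ?G = "presented_group {1..d} (vertex_relators d p)" and ?H = "kms_group d (complete_graph_edges d) ?R"
  interpret P: presentation "{1..d}" "vertex_relators d p" by (rule presentation_vertex_relators)
  interpret K: presentation ?X ?Rel by (rule presentation_kms) (rule R.ring_axioms)
  let ?a = "P.gen" and ?b = "\<lambda>i. kms.root_elt i 1"
  interpret G: class2_torsion_generated ?G p "{1..d}" ?a by (rule vertex_presentation_class2_torsion_generated)
  interpret H: class2_torsion_generated ?H p "{1..d}" ?b by (rule kms.class2_torsion_generated)
  have H_eq: "?H = presented_group ?X ?Rel" by (simp add: kms_group_def)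

  have "\<exists>f\<in>hom ?G ?H. \<forall>i\<in>{1..d}. f (?a i) = ?b i"
  proof (rule P.universal_property[OF H.is_group])
    show "?b \<in> {1..d} \<rightarrow> carrier ?H" using H.gen_mem by blast
    fix r assume r: "r \<in> vertex_relators d p"
    interpret e: group_hom "free_group {1..d}" ?H "eval_word ?H ?b"
      using hom_eval_word[OF H.is_group, of ?b "{1..d}"] H.gen_mem group_free_group H.is_group
      by (auto simp: group_hom_def group_hom_axioms_def Pi_iff)
    have x: "[(i, True)] \<in> carrier (free_group {1..d})" and ex: "eval_word ?H ?b [(i, True)] = ?b i"
      if "i \<in> {1..d}" for i
      using that H.gen_mem[OF that] by (simp_all add: letter_in_free_group)
    note comm = hom_commutator[OF group_free_group H.is_group e.homh]
      commutator_closed[OF group_free_group] commutator_closed[OF H.is_group]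
    from r consider (pow) i where "i \<in> {1..d}" "r = [(i, True)] [^]\<^bsub>free_group {1..d}\<^esub> p"
      | (comm) i j k where "i \<in> {1..d}" "j \<in> {1..d}" "i < j" "k \<in> {i, j}"
          "r = commutator (free_group {1..d}) (commutator (free_group {1..d}) [(i, True)] [(j, True)]) [(k, True)]"
      unfolding vertex_relators_def Let_def by blast
    then show "eval_word ?H ?b r = \<one>\<^bsub>?H\<^esub>"
    proof cases
      case pow
      then show ?thesis
        using x[OF pow(1)] ex[OF pow(1)] H.gen_pow by (simp only: e.hom_nat_pow)
    next
      case comm
      then have kd: "k \<in> {1..d}" by blast
      show ?thesis
        using comm kd x ex H.gen_central[of i j k] H.gen_mem
        by (simp only: \<open>r = _\<close> hom_commutator[OF group_free_group H.is_group e.homh]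
            commutator_closed[OF group_free_group] commutator_closed[OF H.is_group] H.commutator_eq_one_iff)
    qed
  qed
  then obtain f where f: "f \<in> hom ?G ?H" "\<And>i. i \<in> {1..d} \<Longrightarrow> f (?a i) = ?b i" by blast

  let ?\<phi> = "\<lambda>(i, r). ?a i [^]\<^bsub>?G\<^esub> nat r"
  have \<phi>: "?\<phi> \<in> ?X \<rightarrow> carrier ?G" using G.gen_mem by auto
  have "\<exists>g\<in>hom ?H ?G. \<forall>x\<in>?X. g (K.gen x) = ?\<phi> x"
    unfolding H_eq
  proof (rule K.universal_property[OF G.is_group \<phi>])
    fix w assume w: "w \<in> ?Rel"
    let ?F = "free_group ?X" and ?e = "eval_word ?G ?\<phi>"
    interpret e: group_hom ?F ?G ?e
      using hom_eval_word[OF G.is_group \<phi>] group_free_group G.is_group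
      by (auto simp: group_hom_def group_hom_axioms_def)
    have x: "kms_gen i r \<in> carrier ?F" and ex: "?e (kms_gen i r) = ?a i [^]\<^bsub>?G\<^esub> nat r"
      if "i \<in> {1..d}" "r \<in> carrier ?R" for i r
      using that G.gen_mem[OF that(1)] by (simp_all add: kms_gen_def letter_in_free_group)
    have cc: "commutator ?F u v \<in> carrier ?F" if "u \<in> carrier ?F" "v \<in> carrier ?F" for u v
      using commutator_closed[OF group_free_group that] .
    have ec: "?e (commutator ?F u v) = commutator ?G (?e u) (?e v)" if "u \<in> carrier ?F" "v \<in> carrier ?F" for u v
      using hom_commutator[OF group_free_group G.is_group e.homh that] .
    have am: "?a i [^]\<^bsub>?G\<^esub> n \<in> carrier ?G" if "i \<in> {1..d}" for i and n :: nat
      using G.gen_mem[OF that] by simp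
    have R1: "\<one>\<^bsub>?R\<^esub> \<in> carrier ?R" and Rmult: "r \<otimes>\<^bsub>?R\<^esub> s \<in> carrier ?R" and Radd: "r \<oplus>\<^bsub>?R\<^esub> s \<in> carrier ?R"
      if "r \<in> carrier ?R" "s \<in> carrier ?R" for r s
      using that by simp_all
    from w show "?e w = \<one>\<^bsub>?G\<^esub>"
    proof (cases rule: kms_relators_cases)
      case (add i r s)
      have "[nat r + nat s = nat (r \<oplus>\<^bsub>?R\<^esub> s)] (mod p)"
        using add by (auto simp: R.res_add_eq R.res_carrier_eq cong_def nat_mod_distrib nat_add_distrib)
      then have "?a i [^]\<^bsub>?G\<^esub> (nat r + nat s) = ?a i [^]\<^bsub>?G\<^esub> nat (r \<oplus>\<^bsub>?R\<^esub> s)"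
        using add G.gen_mem G.gen_pow by (intro G.pow_cong_of_torsion) auto
      then have "?a i [^]\<^bsub>?G\<^esub> nat r \<otimes>\<^bsub>?G\<^esub> ?a i [^]\<^bsub>?G\<^esub> nat s = ?a i [^]\<^bsub>?G\<^esub> nat (r \<oplus>\<^bsub>?R\<^esub> s)"
        using add G.gen_mem by (simp add: G.nat_pow_mult)
      then show ?thesis
        using add x Radd ex am by simp
    next
      case (comm i j r s)
      then have "i = j" using complete_graph_edges_iff by blast
      with comm show ?thesis
        using x ex am G.gen_mem by (simp add: ec G.commutator_eq_one_iff G.nat_pow_comm)
    next
      case (bilinear i j r s)
      then have "i \<noteq> j" using complete_graph_edges_iff by blast
      have "[nat r * nat s = nat (r \<otimes>\<^bsub>?R\<^esub> s)] (mod p)"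
        using bilinear by (auto simp: R.res_mult_eq R.res_carrier_eq cong_def nat_mod_distrib nat_mult_distrib)
      then have "commutator ?G (?a i [^]\<^bsub>?G\<^esub> nat r) (?a j [^]\<^bsub>?G\<^esub> nat s)
          = commutator ?G (?a i) (?a j [^]\<^bsub>?G\<^esub> nat (r \<otimes>\<^bsub>?R\<^esub> s))"
        using bilinear \<open>i \<noteq> j\<close> by (intro G.gen_commutator_bilinear)
      moreover have "?a i [^]\<^bsub>?G\<^esub> nat \<one>\<^bsub>?R\<^esub> = ?a i"
        using G.gen_mem[OF bilinear(1)] by (simp add: R.res_one_eq)
      ultimately show ?thesis
        using bilinear x Rmult R1 ex am G.gen_mem commutator_closed[OF G.is_group]
        by (simp add: ec cc)
    next
      case (central i j k r s t)
      then have "i \<noteq> j" and kd: "k \<in> {1..d}" using complete_graph_edges_iff by blast+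
      have *: "commutator ?G (?a i [^]\<^bsub>?G\<^esub> nat r) (?a j [^]\<^bsub>?G\<^esub> nat s) \<otimes>\<^bsub>?G\<^esub> ?a k [^]\<^bsub>?G\<^esub> nat t
        = ?a k [^]\<^bsub>?G\<^esub> nat t \<otimes>\<^bsub>?G\<^esub> commutator ?G (?a i [^]\<^bsub>?G\<^esub> nat r) (?a j [^]\<^bsub>?G\<^esub> nat s)"
        by (rule G.gen_pow_central) (use central \<open>i \<noteq> j\<close> in auto)
      have "?e w = commutator ?G (commutator ?G (?a i [^]\<^bsub>?G\<^esub> nat r) (?a j [^]\<^bsub>?G\<^esub> nat s)) (?a k [^]\<^bsub>?G\<^esub> nat t)"
        using central(1,2,5-8) kd x ex by (simp only: ec cc)
      also have "\<dots> = \<one>\<^bsub>?G\<^esub>"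
        using central(1,2) kd am commutator_closed[OF G.is_group] *
        by (subst G.commutator_eq_one_iff) blast+
      finally show ?thesis .
    qed
  qed
  then obtain g where g: "g \<in> hom ?H ?G" "\<And>x. x \<in> ?X \<Longrightarrow> g (K.gen x) = ?\<phi> x" by blast
  have gb: "g (?b i) = ?a i" if "i \<in> {1..d}" for i
    using g(2)[of "(i, 1)"] that kms.one_Fp G.gen_mem[OF that] by (simp add: kms.root_elt_def)
  show ?thesis
    by (rule iso_of_inverse_on_generators[OF G.is_group _ G.gen_generate H.is_group _ H.gen_generate f(1) _ g(1)])
      (use G.gen_mem H.gen_mem f(2) gb in auto)
qed

section \<open>Noncommutative power series\<close>

text \<open>
  The left derivative.  Together with the constant term it turns the Cauchy product into a
  recursion on words, \<open>(f g)(x w) = f(1) g(x w) + (\<partial>\<^sub>x f \<cdot> g)(w)\<close>, which replaces the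
  rearrangement of double sums in the proof of associativity.
\<close>

definition word_deriv :: "'x \<Rightarrow> ('x list \<Rightarrow> 'k) \<Rightarrow> 'x list \<Rightarrow> 'k" where
  "word_deriv x f = (\<lambda>w. f (x # w))"

locale nc_series = ring R for R (structure) + fixes X :: "'x set"
begin

abbreviation A :: "('x list \<Rightarrow> 'a) ring" where "A \<equiv> nc_power_series X R"

lemma mem_A_iff:
  "f \<in> carrier A \<longleftrightarrow> (\<forall>w\<in>lists X. f w \<in> carrier R) \<and> (\<forall>w. w \<notin> lists X \<longrightarrow> f w = \<zero>)"
  unfolding nc_power_series_def by (simp only: partial_object.simps mem_Collect_eq)

lemma coeff_mem [simp]: "f \<in> carrier A \<Longrightarrow> f w \<in> carrier R"
  unfolding mem_A_iff by (metis zero_closed)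

lemma coeff_outside: "f \<in> carrier A \<Longrightarrow> w \<notin> lists X \<Longrightarrow> f w = \<zero>"
  unfolding mem_A_iff by blast

lemma seriesI: "(\<And>w. f w \<in> carrier R) \<Longrightarrow> (\<And>w. w \<notin> lists X \<Longrightarrow> f w = \<zero>) \<Longrightarrow> f \<in> carrier A"
  unfolding mem_A_iff by blast

lemma zero_A: "\<zero>\<^bsub>A\<^esub> = (\<lambda>w. \<zero>)"
  and one_A: "\<one>\<^bsub>A\<^esub> = (\<lambda>w. if w = [] then \<one> else \<zero>)"
  and add_A: "f \<oplus>\<^bsub>A\<^esub> g = (\<lambda>w. f w \<oplus> g w)"
  and mult_A: "f \<otimes>\<^bsub>A\<^esub> g = (\<lambda>w. \<Oplus>k\<in>{..length w}. f (take k w) \<otimes> g (drop k w))"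
  by (simp_all only: nc_power_series_def ring.simps monoid.simps)

lemma word_deriv_mem [simp]: "f \<in> carrier A \<Longrightarrow> word_deriv x f \<in> carrier A"
  by (rule seriesI) (auto simp: word_deriv_def intro: coeff_outside)

lemma zero_mem [simp]: "\<zero>\<^bsub>A\<^esub> \<in> carrier A"
  by (rule seriesI) (auto simp: zero_A)

lemma one_mem [simp]: "\<one>\<^bsub>A\<^esub> \<in> carrier A"
  by (rule seriesI) (auto simp: one_A)

lemma add_mem [simp]: "f \<in> carrier A \<Longrightarrow> g \<in> carrier A \<Longrightarrow> f \<oplus>\<^bsub>A\<^esub> g \<in> carrier A"
  by (rule seriesI) (auto simp: add_A coeff_outside)

lemma mult_mem [simp]:
  assumes f: "f \<in> carrier A" and g: "g \<in> carrier A"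
  shows "f \<otimes>\<^bsub>A\<^esub> g \<in> carrier A"
proof (rule seriesI)
  show "(f \<otimes>\<^bsub>A\<^esub> g) w \<in> carrier R" for w
    unfolding mult_A using f g by (intro finsum_closed) auto
  fix w assume w: "w \<notin> lists X"
  have "f (take k w) \<otimes> g (drop k w) = \<zero>" for k
  proof (cases "take k w \<in> lists X")
    case True
    then have "drop k w \<notin> lists X"
      using w append_take_drop_id[of k w] by (metis append_in_lists_conv)
    then show ?thesis using f g by (simp add: coeff_outside)
  qed (use f g in \<open>simp add: coeff_outside\<close>)
  then show "(f \<otimes>\<^bsub>A\<^esub> g) w = \<zero>"
    unfolding mult_A by simp
qed

lemma mult_Nil: "f \<in> carrier A \<Longrightarrow> g \<in> carrier A \<Longrightarrow> (f \<otimes>\<^bsub>A\<^esub> g) [] = f [] \<otimes> g []"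
  by (simp add: mult_A)

lemma mult_Cons:
  assumes f: "f \<in> carrier A" and g: "g \<in> carrier A"
  shows "(f \<otimes>\<^bsub>A\<^esub> g) (x # w) = f [] \<otimes> g (x # w) \<oplus> (word_deriv x f \<otimes>\<^bsub>A\<^esub> g) w"
proof -
  let ?t = "\<lambda>k. f (take k (x # w)) \<otimes> g (drop k (x # w))"
  have "?t \<in> {..Suc (length w)} \<rightarrow> carrier R" using f g by auto
  then have "finsum R ?t {..Suc (length w)} = finsum R (\<lambda>k. ?t (Suc k)) {..length w} \<oplus> ?t 0"
    by (rule finsum_Suc2)
  moreover have "finsum R (\<lambda>k. ?t (Suc k)) {..length w} = (word_deriv x f \<otimes>\<^bsub>A\<^esub> g) w"
    by (simp add: mult_A word_deriv_def)
  ultimately show ?thesis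
    using f g mult_mem[OF word_deriv_mem[OF f] g] by (simp add: mult_A[of f g] a_comm)
qed

text \<open>
  The case that occurs for the derivative of a product,
  \<open>\<partial>\<^sub>x (f g) = f(1) \<partial>\<^sub>x g + \<partial>\<^sub>x f \<cdot> g\<close>.
\<close>

lemma mult_linear_left:
  assumes "c \<in> carrier R" "g \<in> carrier A" "h \<in> carrier A" "k \<in> carrier A"
  shows "((\<lambda>w. c \<otimes> g w \<oplus> h w) \<otimes>\<^bsub>A\<^esub> k) w = c \<otimes> (g \<otimes>\<^bsub>A\<^esub> k) w \<oplus> (h \<otimes>\<^bsub>A\<^esub> k) w"
proof -
  have "((\<lambda>w. c \<otimes> g w \<oplus> h w) \<otimes>\<^bsub>A\<^esub> k) w = (\<Oplus>i\<in>{..length w}.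
      c \<otimes> (g (take i w) \<otimes> k (drop i w)) \<oplus> h (take i w) \<otimes> k (drop i w))"
    unfolding mult_A using assms by (intro finsum_cong') (auto simp: l_distr m_assoc)
  also have "\<dots> = (\<Oplus>i\<in>{..length w}. c \<otimes> (g (take i w) \<otimes> k (drop i w)))
      \<oplus> (\<Oplus>i\<in>{..length w}. h (take i w) \<otimes> k (drop i w))"
    using assms by (intro finsum_addf) auto
  also have "(\<Oplus>i\<in>{..length w}. c \<otimes> (g (take i w) \<otimes> k (drop i w)))
      = c \<otimes> (\<Oplus>i\<in>{..length w}. g (take i w) \<otimes> k (drop i w))"
    using assms by (intro finsum_rdistr[symmetric]) auto
  finally show ?thesis by (simp add: mult_A)
qed

lemma mult_assoc_coeff:
  assumes "f \<in> carrier A" "g \<in> carrier A" "h \<in> carrier A"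
  shows "((f \<otimes>\<^bsub>A\<^esub> g) \<otimes>\<^bsub>A\<^esub> h) w = (f \<otimes>\<^bsub>A\<^esub> (g \<otimes>\<^bsub>A\<^esub> h)) w"
  using assms
proof (induction w arbitrary: f)
  case Nil
  then show ?case by (simp add: mult_Nil m_assoc)
next
  case (Cons x w)
  let ?D = "word_deriv x"
  have D: "?D (f \<otimes>\<^bsub>A\<^esub> g) = (\<lambda>w. f [] \<otimes> ?D g w \<oplus> (?D f \<otimes>\<^bsub>A\<^esub> g) w)"
    using Cons.prems mult_Cons by (auto simp: word_deriv_def)
  have "((f \<otimes>\<^bsub>A\<^esub> g) \<otimes>\<^bsub>A\<^esub> h) (x # w)
      = (f [] \<otimes> g []) \<otimes> h (x # w) \<oplus> (?D (f \<otimes>\<^bsub>A\<^esub> g) \<otimes>\<^bsub>A\<^esub> h) w"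
    using Cons.prems by (simp add: mult_Cons mult_Nil)
  also have "(?D (f \<otimes>\<^bsub>A\<^esub> g) \<otimes>\<^bsub>A\<^esub> h) w = f [] \<otimes> (?D g \<otimes>\<^bsub>A\<^esub> h) w \<oplus> ((?D f \<otimes>\<^bsub>A\<^esub> g) \<otimes>\<^bsub>A\<^esub> h) w"
    unfolding D using Cons.prems by (intro mult_linear_left) auto
  also have "((?D f \<otimes>\<^bsub>A\<^esub> g) \<otimes>\<^bsub>A\<^esub> h) w = (?D f \<otimes>\<^bsub>A\<^esub> (g \<otimes>\<^bsub>A\<^esub> h)) w"
    using Cons.prems by (intro Cons.IH) auto
  also have "(f [] \<otimes> g []) \<otimes> h (x # w) \<oplus> (f [] \<otimes> (?D g \<otimes>\<^bsub>A\<^esub> h) w \<oplus> (?D f \<otimes>\<^bsub>A\<^esub> (g \<otimes>\<^bsub>A\<^esub> h)) w)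
      = f [] \<otimes> (g \<otimes>\<^bsub>A\<^esub> h) (x # w) \<oplus> (?D f \<otimes>\<^bsub>A\<^esub> (g \<otimes>\<^bsub>A\<^esub> h)) w"
    using Cons.prems by (simp add: mult_Cons[of g h] m_assoc r_distr a_assoc)
  also have "\<dots> = (f \<otimes>\<^bsub>A\<^esub> (g \<otimes>\<^bsub>A\<^esub> h)) (x # w)"
    using Cons.prems by (simp add: mult_Cons[of f "g \<otimes>\<^bsub>A\<^esub> h"])
  finally show ?case .
qed

lemma mult_one_left_coeff: "f \<in> carrier A \<Longrightarrow> (\<one>\<^bsub>A\<^esub> \<otimes>\<^bsub>A\<^esub> f) w = f w"
proof (induction w)
  case (Cons x w)
  have "(word_deriv x \<one>\<^bsub>A\<^esub> \<otimes>\<^bsub>A\<^esub> f) w = \<zero>"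
    using Cons.prems by (simp add: mult_A word_deriv_def one_A)
  then show ?case using Cons.prems by (simp add: mult_Cons) (simp add: one_A)
qed (simp add: mult_Nil, simp add: one_A)

lemma mult_one_right_coeff: "f \<in> carrier A \<Longrightarrow> (f \<otimes>\<^bsub>A\<^esub> \<one>\<^bsub>A\<^esub>) w = f w"
proof (induction w arbitrary: f)
  case (Cons x w)
  have "(f \<otimes>\<^bsub>A\<^esub> \<one>\<^bsub>A\<^esub>) (x # w) = f [] \<otimes> \<one>\<^bsub>A\<^esub> (x # w) \<oplus> word_deriv x f w"
    using Cons by (simp add: mult_Cons)
  then show ?case using Cons.prems by (simp add: one_A word_deriv_def)
qed (simp add: mult_Nil, simp add: one_A)

theorem ring_A: "ring A"
proof (rule ringI)
  show "abelian_group A"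
  proof (rule abelian_groupI)
    fix f assume f: "f \<in> carrier A"
    then show "\<exists>g\<in>carrier A. g \<oplus>\<^bsub>A\<^esub> f = \<zero>\<^bsub>A\<^esub>"
      by (intro bexI[of _ "\<lambda>w. \<ominus> f w"] seriesI) (auto simp: add_A zero_A l_neg coeff_outside)
  qed ((simp; fail) | (simp add: add_A zero_A a_ac fun_eq_iff; fail))+
  show "monoid A"
    by (rule monoidI)
      (auto simp: fun_eq_iff mult_assoc_coeff mult_one_left_coeff mult_one_right_coeff)
  fix f g h assume fgh: "f \<in> carrier A" "g \<in> carrier A" "h \<in> carrier A"
  show "(f \<oplus>\<^bsub>A\<^esub> g) \<otimes>\<^bsub>A\<^esub> h = f \<otimes>\<^bsub>A\<^esub> h \<oplus>\<^bsub>A\<^esub> g \<otimes>\<^bsub>A\<^esub> h"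
    using mult_linear_left[of \<one> f g h] fgh by (simp add: add_A fun_eq_iff)
  show "h \<otimes>\<^bsub>A\<^esub> (f \<oplus>\<^bsub>A\<^esub> g) = h \<otimes>\<^bsub>A\<^esub> f \<oplus>\<^bsub>A\<^esub> h \<otimes>\<^bsub>A\<^esub> g"
  proof
    fix w
    have "(h \<otimes>\<^bsub>A\<^esub> (f \<oplus>\<^bsub>A\<^esub> g)) w = (\<Oplus>i\<in>{..length w}.
        h (take i w) \<otimes> f (drop i w) \<oplus> h (take i w) \<otimes> g (drop i w))"
      unfolding mult_A add_A using fgh by (intro finsum_cong') (auto simp: r_distr)
    then show "(h \<otimes>\<^bsub>A\<^esub> (f \<oplus>\<^bsub>A\<^esub> g)) w = (h \<otimes>\<^bsub>A\<^esub> f \<oplus>\<^bsub>A\<^esub> h \<otimes>\<^bsub>A\<^esub> g) w"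
      using fgh by (simp add: mult_A add_A finsum_addf)
  qed
qed

sublocale A: ring A
  by (rule ring_A)

lemma minus_A: "f \<in> carrier A \<Longrightarrow> g \<in> carrier A \<Longrightarrow> f \<ominus>\<^bsub>A\<^esub> g = (\<lambda>w. f w \<ominus> g w)"
proof -
  assume f: "f \<in> carrier A" and g: "g \<in> carrier A"
  have m: "(\<lambda>w. \<ominus> g w) \<in> carrier A"
    using g by (intro seriesI) (auto simp: coeff_outside)
  have "(\<lambda>w. \<ominus> g w) \<oplus>\<^bsub>A\<^esub> g = \<zero>\<^bsub>A\<^esub>"
    using g by (auto simp: add_A zero_A l_neg)
  then have "\<ominus>\<^bsub>A\<^esub> g = (\<lambda>w. \<ominus> g w)"
    using g m by (intro A.minus_equality)
  then show ?thesis by (simp add: A.minus_eq minus_eq add_A)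
qed

text \<open>
  The \<open>n\<close>-th power of the augmentation ideal of a power series ring in finitely many variables.
\<close>

definition order_ge :: "nat \<Rightarrow> ('x list \<Rightarrow> 'a) set" where
  "order_ge n = {f \<in> carrier A. \<forall>w. length w < n \<longrightarrow> f w = \<zero>}"

lemma order_ge_mem: "f \<in> order_ge n \<Longrightarrow> f \<in> carrier A"
  by (simp add: order_ge_def)

lemma order_ge_0: "order_ge 0 = carrier A"
  by (simp add: order_ge_def)

lemma order_ge_minus:
  assumes "f \<in> order_ge n" "g \<in> order_ge n"
  shows "f \<ominus>\<^bsub>A\<^esub> g \<in> order_ge n"
proof -
  have "f \<ominus>\<^bsub>A\<^esub> g \<in> carrier A" using assms order_ge_mem by blast
  then show ?thesis
    using assms unfolding order_ge_def by (auto simp: minus_A minus_eq)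
qed

lemma order_ge_mult:
  assumes f: "f \<in> order_ge m" and g: "g \<in> order_ge n"
  shows "f \<otimes>\<^bsub>A\<^esub> g \<in> order_ge (m + n)"
proof -
  note fg = order_ge_mem[OF f] order_ge_mem[OF g]
  have "(f \<otimes>\<^bsub>A\<^esub> g) w = \<zero>" if w: "length w < m + n" for w
  proof -
    have "f (take k w) \<otimes> g (drop k w) = \<zero>" if "k \<le> length w" for k
    proof (cases "k < m")
      case True
      then have "f (take k w) = \<zero>" using f that by (auto simp: order_ge_def)
      then show ?thesis using fg by simp
    next
      case False
      then have "length (drop k w) < n" using w that by simp
      then have "g (drop k w) = \<zero>" using g by (auto simp: order_ge_def)
      then show ?thesis using fg by simp
    qed
    then have "(\<Oplus>k\<in>{..length w}. f (take k w) \<otimes> g (drop k w)) = (\<Oplus>k\<in>{..length w}. \<zero>)"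
      by (intro finsum_cong') auto
    then show ?thesis by (simp add: mult_A)
  qed
  then show ?thesis using fg by (simp add: order_ge_def)
qed

text \<open>
  With \<open>u = a - 1\<close> and \<open>v = b - 1\<close> one has \<open>a b - b a = u v - v u\<close>, hence
  \<open>[a, b] - 1 = (u v - v u) a\<^sup>-\<^sup>1 b\<^sup>-\<^sup>1\<close>.
\<close>

lemma commutator_order:
  assumes a: "a \<in> Units A" "a \<ominus>\<^bsub>A\<^esub> \<one>\<^bsub>A\<^esub> \<in> order_ge m"
    and b: "b \<in> Units A" "b \<ominus>\<^bsub>A\<^esub> \<one>\<^bsub>A\<^esub> \<in> order_ge n"
  shows "commutator (units_of A) a b \<ominus>\<^bsub>A\<^esub> \<one>\<^bsub>A\<^esub> \<in> order_ge (m + n)"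
proof -
  define u where "u = a \<ominus>\<^bsub>A\<^esub> \<one>\<^bsub>A\<^esub>"
  define v where "v = b \<ominus>\<^bsub>A\<^esub> \<one>\<^bsub>A\<^esub>"
  define z where "z = inv\<^bsub>A\<^esub> a \<otimes>\<^bsub>A\<^esub> inv\<^bsub>A\<^esub> b"
  note ab = A.Units_closed[OF a(1)] A.Units_closed[OF b(1)]
    A.Units_inv_closed[OF a(1)] A.Units_inv_closed[OF b(1)]
  have z: "z \<in> carrier A" using ab by (simp add: z_def)
  have uv: "u \<in> carrier A" "v \<in> carrier A" using ab by (simp_all add: u_def v_def)
  have baz: "b \<otimes>\<^bsub>A\<^esub> a \<otimes>\<^bsub>A\<^esub> z = \<one>\<^bsub>A\<^esub>"
  proof -
    have "b \<otimes>\<^bsub>A\<^esub> a \<otimes>\<^bsub>A\<^esub> z = b \<otimes>\<^bsub>A\<^esub> (a \<otimes>\<^bsub>A\<^esub> inv\<^bsub>A\<^esub> a) \<otimes>\<^bsub>A\<^esub> inv\<^bsub>A\<^esub> b"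
      using ab by (simp add: z_def A.m_assoc)
    then show ?thesis using a b ab by simp
  qed
  have "commutator (units_of A) a b = a \<otimes>\<^bsub>A\<^esub> b \<otimes>\<^bsub>A\<^esub> z"
    using a b ab by (simp add: commutator_def units_of_mult A.units_of_inv z_def A.m_assoc)
  then have "commutator (units_of A) a b \<ominus>\<^bsub>A\<^esub> \<one>\<^bsub>A\<^esub> = (a \<otimes>\<^bsub>A\<^esub> b \<ominus>\<^bsub>A\<^esub> b \<otimes>\<^bsub>A\<^esub> a) \<otimes>\<^bsub>A\<^esub> z"
    using ab z baz by (simp add: A.minus_eq A.l_distr A.l_minus)
  also have "a \<otimes>\<^bsub>A\<^esub> b \<ominus>\<^bsub>A\<^esub> b \<otimes>\<^bsub>A\<^esub> a = u \<otimes>\<^bsub>A\<^esub> v \<ominus>\<^bsub>A\<^esub> v \<otimes>\<^bsub>A\<^esub> u"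
  proof -
    have "a = u \<oplus>\<^bsub>A\<^esub> \<one>\<^bsub>A\<^esub>" "b = v \<oplus>\<^bsub>A\<^esub> \<one>\<^bsub>A\<^esub>"
      using ab by (simp_all add: u_def v_def A.minus_eq A.a_assoc A.l_neg)
    moreover have "(u \<oplus>\<^bsub>A\<^esub> \<one>\<^bsub>A\<^esub>) \<otimes>\<^bsub>A\<^esub> (v \<oplus>\<^bsub>A\<^esub> \<one>\<^bsub>A\<^esub>) \<ominus>\<^bsub>A\<^esub> (v \<oplus>\<^bsub>A\<^esub> \<one>\<^bsub>A\<^esub>) \<otimes>\<^bsub>A\<^esub> (u \<oplus>\<^bsub>A\<^esub> \<one>\<^bsub>A\<^esub>)
        = u \<otimes>\<^bsub>A\<^esub> v \<ominus>\<^bsub>A\<^esub> v \<otimes>\<^bsub>A\<^esub> u"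
      using uv by (simp add: A.l_distr A.r_distr) algebra
    ultimately show ?thesis by simp
  qed
  also have "(u \<otimes>\<^bsub>A\<^esub> v \<ominus>\<^bsub>A\<^esub> v \<otimes>\<^bsub>A\<^esub> u) \<otimes>\<^bsub>A\<^esub> z \<in> order_ge ((m + n) + 0)"
  proof (rule order_ge_mult)
    have "u \<otimes>\<^bsub>A\<^esub> v \<in> order_ge (m + n)" "v \<otimes>\<^bsub>A\<^esub> u \<in> order_ge (n + m)"
      using a b by (auto intro!: order_ge_mult simp: u_def v_def)
    then show "u \<otimes>\<^bsub>A\<^esub> v \<ominus>\<^bsub>A\<^esub> v \<otimes>\<^bsub>A\<^esub> u \<in> order_ge (m + n)"
      by (simp add: order_ge_minus add.commute)
    show "z \<in> order_ge 0" using z by (simp add: order_ge_0)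
  qed
  finally show ?thesis by simp
qed

lemma var_mem: "x \<in> X \<Longrightarrow> nc_var R x \<in> carrier A"
  by (rule seriesI) (auto simp: nc_var_def)

lemma one_plus_var_mult_Cons:
  assumes x: "x \<in> X" and g: "g \<in> carrier A"
  shows "((\<one>\<^bsub>A\<^esub> \<oplus>\<^bsub>A\<^esub> nc_var R x) \<otimes>\<^bsub>A\<^esub> g) (y # w) = g (y # w) \<oplus> (if y = x then g w else \<zero>)"
proof -
  have "word_deriv y (\<one>\<^bsub>A\<^esub> \<oplus>\<^bsub>A\<^esub> nc_var R x) = (if y = x then \<one>\<^bsub>A\<^esub> else \<zero>\<^bsub>A\<^esub>)"
    by (auto simp: word_deriv_def add_A one_A zero_A nc_var_def fun_eq_iff)
  moreover have "(\<one>\<^bsub>A\<^esub> \<oplus>\<^bsub>A\<^esub> nc_var R x) [] = \<one>"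
    by (simp add: add_A one_A nc_var_def)
  moreover have "\<zero>\<^bsub>A\<^esub> \<otimes>\<^bsub>A\<^esub> g = \<zero>\<^bsub>A\<^esub>" using g by simp
  ultimately show ?thesis
    using x g var_mem[OF x] by (simp add: mult_Cons) (simp add: zero_A)
qed

lemma one_plus_var_mult_Nil:
  assumes x: "x \<in> X" and g: "g \<in> carrier A"
  shows "((\<one>\<^bsub>A\<^esub> \<oplus>\<^bsub>A\<^esub> nc_var R x) \<otimes>\<^bsub>A\<^esub> g) [] = g []"
  using x g var_mem[OF x] by (simp add: mult_Nil) (simp add: add_A one_A nc_var_def)

text \<open>
  The inverse is the geometric series: \<open>x\<^sup>n\<close> has the coefficient \<open>(-1)\<^sup>n\<close>.
\<close>

lemma one_plus_var_unit:
  assumes x: "x \<in> X"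
  shows "\<one>\<^bsub>A\<^esub> \<oplus>\<^bsub>A\<^esub> nc_var R x \<in> Units A"
proof -
  let ?y = "\<one>\<^bsub>A\<^esub> \<oplus>\<^bsub>A\<^esub> nc_var R x"
  define z where "z w = (if set w \<subseteq> {x} then (\<ominus> \<one>) [^] length w else \<zero>)" for w
  have z: "z \<in> carrier A"
    using x by (intro seriesI) (auto simp: z_def in_lists_conv_set)
  have y: "?y \<in> carrier A" using var_mem[OF x] by simp
  have yz: "?y \<otimes>\<^bsub>A\<^esub> z = \<one>\<^bsub>A\<^esub>"
  proof
    fix w show "(?y \<otimes>\<^bsub>A\<^esub> z) w = \<one>\<^bsub>A\<^esub> w"
    proof (cases w)
      case Nil
      then show ?thesis using one_plus_var_mult_Nil[OF x z] by (simp add: one_A z_def)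
    next
      case (Cons y w)
      then show ?thesis using one_plus_var_mult_Cons[OF x z] by (auto simp: one_A z_def r_minus l_neg)
    qed
  qed
  moreover have "(z \<otimes>\<^bsub>A\<^esub> ?y) w = \<one>\<^bsub>A\<^esub> w" for w
  proof (induction w)
    case Nil
    show ?case using z y by (simp add: mult_Nil) (simp add: z_def add_A one_A nc_var_def)
  next
    case (Cons u w)
    have zy: "(\<zero>\<^bsub>A\<^esub> \<otimes>\<^bsub>A\<^esub> ?y) w = \<zero>"
      by (subst A.l_null[OF y]) (simp add: zero_A)
    have "word_deriv u z = (\<lambda>w. (if u = x then \<ominus> \<one> else \<zero>) \<otimes> z w \<oplus> \<zero>\<^bsub>A\<^esub> w)"
      using z by (auto simp: fun_eq_iff word_deriv_def z_def zero_A r_minus l_minus)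
    then have "(word_deriv u z \<otimes>\<^bsub>A\<^esub> ?y) w = (if u = x then \<ominus> \<one> else \<zero>) \<otimes> \<one>\<^bsub>A\<^esub> w"
      using mult_linear_left[of "if u = x then \<ominus> \<one> else \<zero>" z "\<zero>\<^bsub>A\<^esub>" ?y w] z y Cons zy
      by (simp split del: if_split) simp
    moreover have "z [] = \<one>" by (simp add: z_def)
    ultimately show ?case
      using z y by (simp add: mult_Cons) (auto simp: add_A one_A nc_var_def r_neg)
  qed
  then have "z \<otimes>\<^bsub>A\<^esub> ?y = \<one>\<^bsub>A\<^esub>" by (simp add: fun_eq_iff)
  ultimately show ?thesis
    using y z by (auto simp: Units_def)
qed

lemma var_order: "x \<in> X \<Longrightarrow> (\<one>\<^bsub>A\<^esub> \<oplus>\<^bsub>A\<^esub> nc_var R x) \<ominus>\<^bsub>A\<^esub> \<one>\<^bsub>A\<^esub> \<in> order_ge 1"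
proof -
  assume x: "x \<in> X"
  have "(\<one>\<^bsub>A\<^esub> \<oplus>\<^bsub>A\<^esub> nc_var R x) \<ominus>\<^bsub>A\<^esub> \<one>\<^bsub>A\<^esub> = nc_var R x"
    using var_mem[OF x] by (simp add: A.minus_eq A.a_ac A.r_neg)
  then show ?thesis using var_mem[OF x] by (auto simp: order_ge_def nc_var_def)
qed

text \<open>
  Binomial coefficients on the powers of the one variable \<open>x\<close>: the recursion for multiplication by
  \<open>1 + x\<close> is Pascal's rule.
\<close>

lemma one_plus_var_pow_coeff:
  assumes x: "x \<in> X"
  shows "((\<one>\<^bsub>A\<^esub> \<oplus>\<^bsub>A\<^esub> nc_var R x) [^]\<^bsub>A\<^esub> (n::nat)) w
    = (if set w \<subseteq> {x} then [(n choose length w)] \<cdot> \<one> else \<zero>)"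
proof (induction n arbitrary: w)
  case 0
  show ?case by (cases w) (simp_all add: one_A)
next
  case (Suc n)
  let ?y = "\<one>\<^bsub>A\<^esub> \<oplus>\<^bsub>A\<^esub> nc_var R x"
  have y: "?y \<in> carrier A" using var_mem[OF x] by simp
  have g: "?y [^]\<^bsub>A\<^esub> n \<in> carrier A" using y by simp
  have pow: "?y [^]\<^bsub>A\<^esub> Suc n = ?y \<otimes>\<^bsub>A\<^esub> ?y [^]\<^bsub>A\<^esub> n"
    using A.nat_pow_Suc2[OF y] .
  show ?case
  proof (cases w)
    case Nil
    then show ?thesis unfolding pow using one_plus_var_mult_Nil[OF x g] Suc.IH[of "[]"] by simp
  next
    case (Cons u w)
    then show ?thesis
      unfolding pow Cons using one_plus_var_mult_Cons[OF x g, of u w] Suc.IH[of "u # w"] Suc.IH[of w]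
      by (auto simp: add.nat_pow_mult a_comm)
  qed
qed

end

section \<open>The degree of the relators\<close>

context nc_series
begin

abbreviation one_plus_var :: "'x \<Rightarrow> 'x list \<Rightarrow> 'a" where
  "one_plus_var x \<equiv> \<one>\<^bsub>A\<^esub> \<oplus>\<^bsub>A\<^esub> nc_var R x"

text \<open>
  The Magnus embedding is the homomorphism to the group of units that sends \<open>x\<close> to \<open>1 + x\<close>.
\<close>

lemma magnus_eq_eval_word:
  "fst ` set w \<subseteq> X \<Longrightarrow> magnus X R w = eval_word (units_of A) one_plus_var w"
proof (induction w)
  case (Cons a w)
  then have "one_plus_var (fst a) \<in> Units A" by (intro one_plus_var_unit) auto
  then show ?case
    using Cons by (simp add: magnus_def magnus_letter_def Let_def units_of_mult A.units_of_inv)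
qed (simp add: magnus_def units_of_one)

lemma hom_magnus: "eval_word (units_of A) one_plus_var \<in> hom (free_group X) (units_of A)"
  using one_plus_var_unit by (intro hom_eval_word A.units_group) (auto simp: units_of_carrier)

definition magnus_order_ge :: "nat \<Rightarrow> 'x fword \<Rightarrow> bool" where
  "magnus_order_ge n f \<longleftrightarrow> f \<in> carrier (free_group X) \<and> magnus X R f \<ominus>\<^bsub>A\<^esub> \<one>\<^bsub>A\<^esub> \<in> order_ge n"

lemma magnus_order_ge_iff:
  "magnus_order_ge n f \<longleftrightarrow>
    f \<in> carrier (free_group X) \<and> eval_word (units_of A) one_plus_var f \<ominus>\<^bsub>A\<^esub> \<one>\<^bsub>A\<^esub> \<in> order_ge n"
  using magnus_eq_eval_word by (auto simp: magnus_order_ge_def free_group_def)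

lemma magnus_order_ge_letter: "x \<in> X \<Longrightarrow> magnus_order_ge 1 [(x, True)]"
  using var_order[of x] var_mem[of x]
  by (simp add: magnus_order_ge_iff letter_in_free_group units_of_one units_of_mult)

lemma magnus_order_ge_commutator:
  assumes f: "magnus_order_ge m f" and g: "magnus_order_ge n g"
  shows "magnus_order_ge (m + n) (commutator (free_group X) f g)"
proof -
  have fg: "f \<in> carrier (free_group X)" "g \<in> carrier (free_group X)"
    using f g by (simp_all add: magnus_order_ge_def)
  have "eval_word (units_of A) one_plus_var h \<in> Units A" if "h \<in> carrier (free_group X)" for h
    using hom_in_carrier[OF hom_magnus that] by (simp add: units_of_carrier)
  then show ?thesis
    using f g fg commutator_closed[OF group_free_group fg]
    by (simp add: magnus_order_ge_iff commutator_order
        hom_commutator[OF group_free_group A.units_group hom_magnus fg])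
qed

lemma magnus_pow:
  assumes x: "x \<in> X"
  shows "eval_word (units_of A) one_plus_var ([(x, True)] [^]\<^bsub>free_group X\<^esub> (n::nat))
    = one_plus_var x [^]\<^bsub>A\<^esub> n"
proof -
  interpret h: group_hom "free_group X" "units_of A" "eval_word (units_of A) one_plus_var"
    using hom_magnus group_free_group A.units_group by (simp add: group_hom_def group_hom_axioms_def)
  have "u [^]\<^bsub>units_of A\<^esub> n = u [^]\<^bsub>A\<^esub> n" if "u \<in> Units A" for u
    by (induction n) (simp_all add: units_of_mult units_of_one)
  moreover have "eval_word (units_of A) one_plus_var [(x, True)] = one_plus_var x"
    using var_mem[OF x] by (simp add: units_of_mult units_of_one)
  ultimately show ?thesis
    using h.hom_nat_pow[OF letter_in_free_group[OF x, of True], of n] one_plus_var_unit[OF x] by simp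
qed

end

lemma nc_series_residue_ring:
  assumes "prime p"
  shows "nc_series (residue_ring (int p))"
proof -
  interpret residues "int p" "residue_ring (int p)" by (rule residues_prime[OF assms]) simp
  show ?thesis by (simp add: nc_series_def ring_axioms)
qed

lemma le_zassenhaus_degree:
  assumes p: "prime p" and f: "nc_series.magnus_order_ge (residue_ring (int p)) X n f"
  shows "enat n \<le> zassenhaus_degree p X f"
proof -
  interpret nc_series "residue_ring (int p)" X by (rule nc_series_residue_ring[OF p])
  show ?thesis
    using f unfolding zassenhaus_degree_def Let_def magnus_order_ge_def order_ge_def
    by (intro INF_greatest) (auto simp: not_less)
qed

text \<open>
  The binomial coefficients \<open>p choose k\<close> with \<open>0 < k < p\<close> vanish modulo \<open>p\<close>.
\<close>

lemma magnus_order_ge_prime_pow: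
  assumes p: "prime p" and x: "x \<in> X"
  shows "nc_series.magnus_order_ge (residue_ring (int p)) X p ([(x, True)] [^]\<^bsub>free_group X\<^esub> p)"
proof -
  let ?K = "residue_ring (int p)"
  interpret K: residues "int p" ?K by (rule residues_prime[OF p]) simp
  interpret nc_series ?K X by (rule nc_series_residue_ring[OF p])
  interpret F: group "free_group X" by (rule group_free_group)
  have y: "one_plus_var x \<in> carrier A" using one_plus_var_unit[OF x] by (rule A.Units_closed)
  have mult_one: "[n] \<cdot>\<^bsub>?K\<^esub> \<one>\<^bsub>?K\<^esub> = int n mod int p" for n :: nat
    by (induction n) (simp_all add: K.res_add_eq K.res_zero_eq K.res_one_eq mod_simps add.commute)
  have coeff: "(one_plus_var x [^]\<^bsub>A\<^esub> p) w = \<one>\<^bsub>A\<^esub> w" if w: "length w < p" for w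
  proof (cases "w = []")
    case True
    have "\<one>\<^bsub>A\<^esub> w = int 1 mod int p" using True prime_gt_1_nat[OF p] by (simp add: one_A K.res_one_eq)
    then show ?thesis
      using True by (simp only: one_plus_var_pow_coeff[OF x] mult_one) simp
  next
    case False
    then have "p dvd (p choose length w)"
      using w p prime_gt_0_nat[OF p] by (intro dvd_choose_prime) auto
    then have "int (p choose length w) mod int p = 0" by (simp flip: of_nat_mod)
    moreover have "\<one>\<^bsub>A\<^esub> w = 0" using False by (simp add: one_A K.res_zero_eq)
    ultimately show ?thesis
      by (simp only: one_plus_var_pow_coeff[OF x] mult_one K.res_zero_eq) simp
  qed
  moreover have "one_plus_var x [^]\<^bsub>A\<^esub> p \<ominus>\<^bsub>A\<^esub> \<one>\<^bsub>A\<^esub> \<in> carrier A"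
    using y by simp
  ultimately have "one_plus_var x [^]\<^bsub>A\<^esub> p \<ominus>\<^bsub>A\<^esub> \<one>\<^bsub>A\<^esub> \<in> order_ge p"
    using y by (simp add: order_ge_def minus_A K.r_neg K.minus_eq)
  then show ?thesis
    using letter_in_free_group[OF x] by (simp add: magnus_order_ge_iff magnus_pow[OF x])
qed

section \<open>The Golod-Shafarevich inequality\<close>

text \<open>
  It suffices to bound degrees from below, because \<open>t < 1\<close>: a relator of higher degree contributes
  less to the series, and a relator of infinite degree contributes nothing.
\<close>

lemma golod_shafarevich_presentationI:
  fixes t :: real and m :: "'x fword \<Rightarrow> nat"
  assumes X: "finite X" and Rel: "Rel \<subseteq> carrier (free_group X)" "finite Rel"
    and deg: "\<And>f. f \<in> Rel \<Longrightarrow> enat (m f) \<le> zassenhaus_degree p X f"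
    and t: "0 < t" "t < 1" and neg: "1 - real (card X) * t + (\<Sum>f\<in>Rel. t ^ m f) < 0"
  shows "golod_shafarevich_presentation p X Rel"
proof -
  let ?r = "relators_of_degree p X Rel"
  let ?s = "\<lambda>i. real (card (?r (Suc i))) * t ^ Suc i"
  define dg where "dg f = the_enat (zassenhaus_degree p X f)" for f
  have r_sub: "?r i \<subseteq> Rel" and r_fin: "finite (?r i)" for i
    using finite_subset[of "?r i" Rel] Rel(2) by (auto simp: relators_of_degree_def)
  have dg: "dg f = i" if "f \<in> ?r i" for f i
    using that by (simp add: relators_of_degree_def dg_def)
  define N where "N = Max (insert 0 (dg ` Rel))"
  have zero: "?s i = 0" if "i \<notin> {..<N}" for i
  proof -
    have "?r (Suc i) = {}"
    proof (rule ccontr)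
      assume "?r (Suc i) \<noteq> {}"
      then obtain f where f: "f \<in> ?r (Suc i)" by blast
      then have "Suc i \<in> insert 0 (dg ` Rel)" using dg[OF f] r_sub by force
      then have "Suc i \<le> N" unfolding N_def using Rel(2) by (intro Max_ge) auto
      then show False using that by simp
    qed
    then show ?thesis by simp
  qed
  have "suminf ?s = (\<Sum>i<N. ?s i)"
    using zero by (intro suminf_finite) auto
  also have "\<dots> = (\<Sum>i<N. \<Sum>f\<in>?r (Suc i). t ^ dg f)"
    by (intro sum.cong refl) (simp add: dg)
  also have "\<dots> = (\<Sum>f\<in>(\<Union>i<N. ?r (Suc i)). t ^ dg f)"
    using r_fin by (intro sum.UNION_disjoint[symmetric]) (auto simp: relators_of_degree_def)
  also have "\<dots> \<le> (\<Sum>f\<in>(\<Union>i<N. ?r (Suc i)). t ^ m f)"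
  proof (intro sum_mono power_decreasing)
    fix f assume "f \<in> (\<Union>i<N. ?r (Suc i))"
    then obtain i where f: "f \<in> ?r (Suc i)" by blast
    then show "m f \<le> dg f"
      using deg[of f] dg[OF f] by (simp add: relators_of_degree_def)
  qed (use t in auto)
  also have "\<dots> \<le> (\<Sum>f\<in>Rel. t ^ m f)"
    using r_sub t Rel(2) by (intro sum_mono2) auto
  finally have "1 - real (card X) * t + suminf ?s < 0" using neg by simp
  moreover have "summable ?s"
    using zero by (intro summable_finite[of "{..<N}"]) auto
  ultimately show ?thesis
    unfolding golod_shafarevich_presentation_def using X Rel t r_fin by blast
qed

text \<open>
  With \<open>t = 3/(2d)\<close> the first two terms are \<open>1 - 3/2\<close>, and the cubic term is
  \<open>27(d - 1)/(8d\<^sup>2)\<close>.  The latter is at most \<open>15/32\<close>, with equality at \<open>d = 6\<close>, because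
  \<open>5d\<^sup>2 - 36d + 36 = (5d - 6)(d - 6)\<close>.
\<close>

lemma golod_shafarevich_inequality:
  fixes d p :: nat
  assumes d: "6 \<le> d" and p: "(d - 1)\<^sup>2 < p"
  defines "t \<equiv> 3 / (2 * real d)"
  shows "1 - real d * t + real (d * (d - 1)) * t ^ 3 + real d * t ^ p < 0"
proof -
  have d': "6 \<le> real d" using d by simp
  have dt: "real d * t = 3 / 2" using d' by (simp add: t_def)
  have t: "0 < t" "t \<le> 1 / 4" using d' by (simp_all add: t_def field_simps)
  have "real (d * (d - 1)) * t ^ 3 = 27 * (real d - 1) / (8 * (real d)\<^sup>2)"
    using d d' by (simp add: t_def power3_eq_cube power2_eq_square of_nat_diff field_simps)
  also have "\<dots> \<le> 15 / 32"
  proof -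
    have "0 \<le> (5 * real d - 6) * (real d - 6)" using d' by (intro mult_nonneg_nonneg) auto
    then have "36 * (real d - 1) \<le> 5 * (real d)\<^sup>2" by (simp add: algebra_simps power2_eq_square)
    then show ?thesis using d' by (simp add: field_simps)
  qed
  finally have cubic: "real (d * (d - 1)) * t ^ 3 \<le> 15 / 32" .
  have "5\<^sup>2 \<le> (d - 1)\<^sup>2" using d by (intro power_mono) auto
  then have p5: "5 \<le> p" using p by simp
  have "t ^ p \<le> t ^ 5" using t p5 by (intro power_decreasing) auto
  also have "\<dots> = t * t ^ 4" by (simp flip: power_Suc)
  also have "\<dots> \<le> t * (1 / 4) ^ 4" using t by (intro mult_left_mono power_mono) auto
  finally have "real d * t ^ p \<le> real d * (t * (1 / 4) ^ 4)"
    by (intro mult_left_mono) auto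
  also have "\<dots> = (real d * t) * (1 / 4) ^ 4" by (simp only: mult.assoc)
  also have "\<dots> = 3 / 512" unfolding dt by (simp add: power4_eq_xxxx)
  finally show ?thesis using cubic dt by simp
qed

theorem vertex_presentation_golod_shafarevich:
  assumes d: "6 \<le> d" and p: "prime p" "(d - 1)\<^sup>2 < p"
  shows "golod_shafarevich_presentation p {1..d} (vertex_relators d p)"
proof -
  let ?F = "free_group {1..d}" and ?t = "3 / (2 * real d)"
  interpret nc_series "residue_ring (int p)" "{1..d}" by (rule nc_series_residue_ring[OF p(1)])
  define x :: "nat \<Rightarrow> nat fword" where "x i = [(i, True)]" for i
  define P where "P = (\<lambda>i. x i [^]\<^bsub>?F\<^esub> p) ` {1..d}"
  \<comment> \<open>The triples \<open>(i, j, k)\<close> with \<open>i < j\<close> and \<open>k \<in> {i, j}\<close> are counted as ordered pairs \<open>(k, l)\<close>, where \<open>l\<close> is the other index.\<close>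
  define c where "c k l = commutator ?F (commutator ?F (x (min k l)) (x (max k l))) (x k)" for k l
  define C where "C = (\<lambda>(k, l). c k l) ` (SIGMA k:{1..d}. {1..d} - {k})"
  have Rel: "vertex_relators d p \<subseteq> P \<union> C"
  proof
    fix r assume "r \<in> vertex_relators d p"
    then consider (pow) i where "i \<in> {1..d}" "r = x i [^]\<^bsub>?F\<^esub> p"
      | (comm) i j k where "i \<in> {1..d}" "j \<in> {1..d}" "i < j" "k \<in> {i, j}"
          "r = commutator ?F (commutator ?F (x i) (x j)) (x k)"
      unfolding vertex_relators_def Let_def x_def by blast
    then show "r \<in> P \<union> C"
    proof cases
      case pow
      then show ?thesis by (simp add: P_def)
    next
      case comm
      then have "(k = i \<and> r = c i j) \<or> (k = j \<and> r = c j i)" by (auto simp: c_def min_def max_def)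
      then show ?thesis using comm by (force simp: C_def)
    qed
  qed
  have fin: "finite P" "finite C" by (simp_all add: P_def C_def)
  define m where "m r = (if r \<in> C then 3 else p)" for r
  have deg: "enat (m r) \<le> zassenhaus_degree p {1..d} r" if r: "r \<in> vertex_relators d p" for r
  proof (rule le_zassenhaus_degree[OF p(1)], cases "r \<in> C")
    case True
    then obtain q where q: "q \<in> (SIGMA k:{1..d}. {1..d} - {k})" "r = c (fst q) (snd q)"
      unfolding C_def case_prod_beta by (elim imageE)
    define k l where "k = fst q" and "l = snd q"
    have kl: "k \<in> {1..d}" "l \<in> {1..d}" "r = c k l" using q by (auto simp: k_def l_def)
    have "min k l \<in> {1..d}" "max k l \<in> {1..d}" using kl by auto
    then have "magnus_order_ge ((1 + 1) + 1) (c k l)"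
      unfolding c_def x_def using kl by (intro magnus_order_ge_commutator magnus_order_ge_letter)
    then show "magnus_order_ge (m r) r" using True kl by (simp add: m_def numeral_3_eq_3)
  next
    case False
    then obtain i where "i \<in> {1..d}" "r = x i [^]\<^bsub>?F\<^esub> p" using r Rel by (auto simp: P_def)
    then show "magnus_order_ge (m r) r"
      using False magnus_order_ge_prime_pow[OF p(1), of i "{1..d}"] by (simp add: m_def x_def)
  qed
  have t: "0 < ?t" "?t < 1" using d by auto
  have "card C \<le> card (SIGMA k:{1..d}. {1..d} - {k})"
    unfolding C_def by (intro card_image_le) auto
  also have "\<dots> = d * (d - 1)" by (simp add: card_SigmaI)
  finally have cC: "card C \<le> d * (d - 1)" .
  have cP: "card P \<le> d" unfolding P_def using card_image_le[of "{1..d}"] by simp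
  have "(\<Sum>r\<in>vertex_relators d p. ?t ^ m r) \<le> (\<Sum>r\<in>P \<union> C. ?t ^ m r)"
    using Rel fin t by (intro sum_mono2) auto
  also have "P \<union> C = C \<union> (P - C)" by auto
  also have "(\<Sum>r\<in>C \<union> (P - C). ?t ^ m r) = (\<Sum>r\<in>C. ?t ^ m r) + (\<Sum>r\<in>P - C. ?t ^ m r)"
    using fin by (intro sum.union_disjoint) auto
  also have "\<dots> = real (card C) * ?t ^ 3 + real (card (P - C)) * ?t ^ p"
    by (simp add: m_def)
  also have "\<dots> \<le> real (d * (d - 1)) * ?t ^ 3 + real d * ?t ^ p"
    using t cC cP card_mono[OF fin(1), of "P - C"]
    by (intro add_mono mult_right_mono) (auto simp del: of_nat_mult)
  finally have neg: "1 - real (card {1..d}) * ?t + (\<Sum>r\<in>vertex_relators d p. ?t ^ m r) < 0"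
    using golod_shafarevich_inequality[OF d p(2)] by simp
  have "finite (vertex_relators d p)" using finite_subset[OF Rel] fin by blast
  moreover have "vertex_relators d p \<subseteq> carrier ?F"
    using presentation_vertex_relators by (rule presentation.Rel)
  ultimately show ?thesis
    by (intro golod_shafarevich_presentationI[OF _ _ _ deg t neg]) simp_all
qed

theorem proposition7p4:
  fixes d p :: nat
  assumes "d \<ge> 6" and "prime p" and "p > (d - 1)\<^sup>2"
  shows "golod_shafarevich_group p (kms_group d (complete_graph_edges d) (residue_ring (int p))) \<and>
    property_T (kms_group d (complete_graph_edges d) (residue_ring (int p)))"
proof
  show "golod_shafarevich_group p (kms_group d (complete_graph_edges d) (residue_ring (int p)))"
    unfolding golod_shafarevich_group_def
    using vertex_presentation_golod_shafarevich[OF assms] vertex_presentation_iso_kms[OF assms(2)] by blast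
  interpret kms: kms_prime_field p d by unfold_locales (rule assms)
  interpret class2_torsion_generated "kms_group d (complete_graph_edges d) (residue_ring (int p))"
    p "{1..d}" "\<lambda>i. kms.root_elt i 1"
    by (rule kms.class2_torsion_generated)
  show "property_T (kms_group d (complete_graph_edges d) (residue_ring (int p)))"
    using assms by (intro property_T) auto
qed

end
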